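(* Let $G$ be an arithmetical groupoid, $\eta\colon G\to\mathbb G$ its abstract norm, $H\subset G_+$ a right-saturated subcategory, $C=\mathbb G/\mathbf q(\eta(H))$ and $C_M=\{[\eta(u)]\in C: u\in\mathcal A(G_+)\}$. Let $\theta\colon H\to\mathcal B(C_M)$ be the block homomorphism of $H\subset G_+$ and let $\mathsf d$ be a distance on $H$. Assume that for every $a\in G$ with $s(a)\in H_0$ we have $a\in HH^{-1}$ if and only if $\eta(a)\in\mathbf q(\eta(H))$. Then $\theta$ is a transfer homomorphism and $\mathsf c_{\mathsf d}(H,\theta)\le 2$. Therefore, for all $a\in H$, $$\mathsf c_{\mathsf d}(a)\le\max\{\mathsf c_p(\theta(a)),2\},\qquad \mathsf c_{\mathsf d}(H)\le\max\{\mathsf c_p(\mathcal B(C_M)),2\},$$ $$\mathsf c_{\mathsf d,\mathrm{mon}}(a)\le\max\{\mathsf c_{p,\mathrm{mon}}(\theta(a)),2\},\qquad \mathsf c_{\mathsf d,\mathrm{mon}}(H)\le\max\{\mathsf c_{p,\mathrm{mon}}(\mathcal B(C_M)),2\},$$ $$\mathsf c_{\mathsf d,\mathrm{eq}}(a)\le\max\{\mathsf c_{p,\mathrm{eq}}(\theta(a)),2\},\qquad \mathsf c_{\mathsf d,\mathrm{eq}}(H)\le\max\{\mathsf c_{p,\mathrm{eq}}(\mathcal B(C_M)),2\}.$$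
   Context: **Small categories.** A small category $H$ is identified with its set of morphisms (elements); $H_0$ is the set of identities; $a\in H$ has source $s(a)$ and target $t(a)$, and $ab$ is defined iff $t(a)=s(b)$ (composition left to right). Homomorphisms are functors. $H^\times$ is the set of isomorphisms (units); $H$ is reduced if $H^\times=H_0$, a groupoid if $H=H^\times$, cancellative if $ab=ac$ or $ba=ca$ implies $b=c$. $H(e,f)$ is the set of elements with source $e$ and target $f$; $H(e)=H(e,e)$; $H(e,\cdot)$, $H(\cdot,f)$ are the sets of elements with source $e$, resp. target $f$. For subsets, $AB=\{ab: a\in A,b\in B,t(a)=s(b)\}$. Semigroups (with neutral element) are one-object small categories. Small categories are tacitly nonempty. $a\simeq b$ if $b=\varepsilon a\eta$ with units $\varepsilon,\eta$. An atom is a non-unit $u$ such that $u=ab$ implies that $a$ or $b$ is a unit; $\mathcal A(H)$ is the set of atoms; $H$ is atomic if each non-unit is a finite product of atoms. **Arithmetical groupoids.** A lattice-ordered groupoid is a groupoid $G$ with a relation $\le$ such that for all $e,f\in G_0$, $(G(e,\cdot),\le)$ and $(G(\cdot,f),\le)$ are lattices and $G(e,f)$ is a sublattice of both (meets and joins of two elements of $G(e,f)$ taken in $G(e,\cdot)$ and in $G(\cdot,f)$ agree and lie in $G(e,f)$). An element $a$ is integral if $a\le s(a)$ and $a\le t(a)$; $G_+$ is the set of integral elements. $G$ is arithmetical if for all $e,f\in G_0$: (P1) $a\le s(a)$ iff $a\le t(a)$ for all $a\in G$; (P2) $G(e,\cdot)$ and $G(\cdot,f)$ are modular; (P3) if $a\le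 b$ in $G(e,\cdot)$ and $c\in G(\cdot,e)$ then $ca\le cb$, and if $a\le b$ in $G(\cdot,f)$ and $c\in G(f,\cdot)$ then $ac\le bc$; (P4) every nonempty $M\subset G(e,\cdot)\cap G_+$ has a supremum in $G(e,\cdot)$, similarly for $M\subset G(\cdot,f)\cap G_+$, and if $M\subset G(e,f)$ the two suprema agree; (P5) $G(e,f)$ contains an integral element; (P6) $G(e,\cdot)$ and $G(\cdot,f)$ satisfy the ACC on integral elements. Then $G_+$ is a reduced atomic subcategory. Each $G(e)$ is a free abelian group, and $x\mapsto a^{-1}xa$ ($a\in G(e,f)$) is an order isomorphism of groups $G(e)\to G(f)$ independent of $a$. For $x\in G(e)$ let $(x)=\{a^{-1}xa:a\in G(e,\cdot)\}$. The universal vertex group is $\mathbb G=\{(x):x\in G(e),e\in G_0\}$, with group structure and order transported along the bijection $G(e)\to\mathbb G$, $x\mapsto(x)$ (independent of $e$); $\mathbb G_+$ is the free abelian monoid on the set $\mathcal A(\mathbb G_+)$. For $u\in\mathcal A(G_+)$ put $\eta(u)=(x)$ with $x=\sup\{x'\in G(s(u)):x'\le u\}$. This extends uniquely to a (surjective) homomorphism $\eta:G\to\mathbb G$, the abstract norm. **Class group and block homomorphism.** A subcategory $H\subset G_+$ is right-saturated if $HH^{-1}\cap G_+=H$ (with $H^{-1}=\{a^{-1}:a\in H\}$). $\mathbf q(\eta(H))\subset\mathbb G$ is the quotient group of $\eta(H)$, i.e. the subgroup of $\mathbb G$ generated by $\eta(H)$. $C=\mathbb G/\mathbf q(\eta(H))$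 is written additively and $[\mathcal X]$ is the class of $\mathcal X\in\mathbb G$. $\mathcal F(C_M)$ is the free abelian monoid on $C_M$ and $\mathcal B(C_M)=\{g_1\cdots g_l\in\mathcal F(C_M):g_1+\cdots+g_l=0\}$. The block homomorphism is $\theta(a)=[\eta(u_1)]\cdots[\eta(u_k)]$ where $a=s(a)u_1\cdots u_k$ with $u_i\in\mathcal A(G_+)$ (independent of the choice of the $u_i$). **Rigid factorizations** of a cancellative small category $H$. Consider tuples $(\varepsilon;u_1,\dots,u_k)$, $k\ge0$, $\varepsilon\in H^\times$, $u_i\in\mathcal A(H)$ with $\varepsilon u_1\cdots u_k$ defined. Identify $(\varepsilon;u_1,\dots,u_k)$ and $(\varepsilon';v_1,\dots,v_l)$ if $k=l$, $\varepsilon u_1\cdots u_k=\varepsilon'v_1\cdots v_k$, and either $k=0$ or there are $\delta_2,\dots,\delta_k\in H^\times$, $\delta_{k+1}=t(u_k)$, with $\varepsilon'v_1=\varepsilon u_1\delta_2^{-1}$, $v_i=\delta_iu_i\delta_{i+1}^{-1}$ ($i\in[2,k]$). Classes are written $\varepsilon*u_1*\cdots*u_k$ (with $\varepsilon$ omitted if it is an identity and $k>0$); they form a small category $\mathsf Z^*(H)$ under $(\varepsilon*u_1*\cdots*u_k)*(\varepsilon'*v_1*\cdots*v_l)=\varepsilon*u_1*\cdots*u_k\varepsilon'*v_1*\cdots*v_l$ (and $\varepsilon\varepsilon'*v_1*\cdots*v_l$ if $k=0$), with source $s(\varepsilon)$ and target $t(u_k)$ ($t(\varepsilon)$ if $k=0$).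 $|z|=k$; $\pi:\mathsf Z^*(H)\to H$ is multiplication; $\mathsf Z^*(a)=\pi^{-1}(\{a\})$. **Distances.** A distance on $H$ is a map $\mathsf d:\{(z,z')\in\mathsf Z^*(H)^2:\pi(z)=\pi(z')\}\to\mathbb N_0$ such that, whenever $\pi(z)=\pi(z')=\pi(z'')$: $\mathsf d(z,z)=0$; $\mathsf d(z,z')=\mathsf d(z',z)$; $\mathsf d(z,z')\le\mathsf d(z,z'')+\mathsf d(z'',z')$; $\mathsf d(x*z,x*z')=\mathsf d(z,z')=\mathsf d(z*y,z'*y)$ whenever defined; $\big||z|-|z'|\big|\le\mathsf d(z,z')\le\max\{|z|,|z'|,1\}$. The permutable distance is $\mathsf d_p(\varepsilon*u_1*\cdots*u_k,\eta*v_1*\cdots*v_l)=\max\{k,l\}-n$, where $n$ is the largest cardinality of $I\subset[1,k]$ admitting an injection $\sigma:I\to[1,l]$ with $u_i\simeq v_{\sigma(i)}$ for $i\in I$. **Catenary degrees** ($H$ atomic). An $N$-chain between $z,z'\in\mathsf Z^*(a)$ is a sequence $z=z_0,\dots,z_n=z'$ in $\mathsf Z^*(a)$ with $\mathsf d(z_{i-1},z_i)\le N$; it is monotone if the lengths $|z_i|$ are weakly increasing or weakly decreasing. $\mathsf c_{\mathsf d}(a)$ [$\mathsf c_{\mathsf d,\mathrm{mon}}(a)$] is the least $N\in\mathbb N_0\cup\{\infty\}$ such that any two elements of $\mathsf Z^*(a)$ are connected by an [a monotone] $N$-chain; $\mathsf c_{\mathsf d,\mathrm{eq}}(a)$ is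 the least $N$ such that any two of equal length are connected by a monotone $N$-chain. $\mathsf c_{\mathsf d}(H)$ etc. are the suprema over $a\in H$. Subscript $p$ refers to $\mathsf d=\mathsf d_p$. **Transfer homomorphisms.** A homomorphism $\phi:H\to T$ of cancellative small categories is a transfer homomorphism if (T1) $T=T^\times\phi(H)T^\times$ and $\phi^{-1}(T^\times)=H^\times$, and (T2) whenever $\phi(a)=b_1b_2$, there are $a_1,a_2\in H$ and $\varepsilon\in T^\times$ with $a=a_1a_2$, $\phi(a_1)=b_1\varepsilon^{-1}$, $\phi(a_2)=\varepsilon b_2$. It maps atoms to atoms and induces $\phi^*:\mathsf Z^*(H)\to\mathsf Z^*(T)$, $\varepsilon*u_1*\cdots*u_k\mapsto\phi(\varepsilon)*\phi(u_1)*\cdots*\phi(u_k)$. For atomic $H,T$, an $N$-chain $z=z_0,\dots,z_n=z'$ in $\mathsf Z^*(a)$ lies in the permutable fiber of $z$ if $\mathsf d_p(\phi^*(z_i),\phi^*(z))=0$ for all $i$; $\mathsf c_{\mathsf d}(a,\phi)$ is the least $N$ such that any $z,z'\in\mathsf Z^*(a)$ with $\mathsf d_p(\phi^*(z),\phi^*(z'))=0$ are connected by an $N$-chain in distance $\mathsf d$ lying in the permutable fiber of $z$; $\mathsf c_{\mathsf d}(H,\phi)=\sup_{a\in H}\mathsf c_{\mathsf d}(a,\phi)$. *)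

theory Defs
  imports
    "HOL-Algebra.Lattice"
    "HOL-Algebra.Coset"
    "HOL-Algebra.Generated_Groups"
    "HOL-Algebra.FiniteProduct"
    "HOL-Library.Multiset"
    "HOL-Library.Extended_Nat"
begin

section \<open>Small categories\<close>

text \<open>
  A small category is identified with its set of morphisms (the carrier); source and target
  are identity morphisms. Composition is written left to right, and \<open>a \<bullet> b\<close> is meaningful
  only for \<open>tgt a = src b\<close>: the record field is a total function, so every definition below
  states the required composability explicitly.
\<close>

record 'a small_cat = "'a partial_object" +
  src :: "'a \<Rightarrow> 'a"
  tgt :: "'a \<Rightarrow> 'a"
  cmp :: "'a \<Rightarrow> 'a \<Rightarrow> 'a" (infixl \<open>\<bullet>\<index>\<close> 70)

locale small_category =
  fixes C :: "('a, 'm) small_cat_scheme" (structure)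
  assumes nonempty: "carrier C \<noteq> {}"
    and src_closed: "a \<in> carrier C \<Longrightarrow> src C a \<in> carrier C"
    and tgt_closed: "a \<in> carrier C \<Longrightarrow> tgt C a \<in> carrier C"
    and src_src: "a \<in> carrier C \<Longrightarrow> src C (src C a) = src C a"
    and tgt_src: "a \<in> carrier C \<Longrightarrow> tgt C (src C a) = src C a"
    and src_tgt: "a \<in> carrier C \<Longrightarrow> src C (tgt C a) = tgt C a"
    and tgt_tgt: "a \<in> carrier C \<Longrightarrow> tgt C (tgt C a) = tgt C a"
    and cmp_closed: "\<lbrakk>a \<in> carrier C; b \<in> carrier C; tgt C a = src C b\<rbrakk> \<Longrightarrow> a \<bullet> b \<in> carrier C"
    and src_cmp: "\<lbrakk>a \<in> carrier C; b \<in> carrier C; tgt C a = src C b\<rbrakk> \<Longrightarrow> src C (a \<bullet> b) = src C a"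
    and tgt_cmp: "\<lbrakk>a \<in> carrier C; b \<in> carrier C; tgt C a = src C b\<rbrakk> \<Longrightarrow> tgt C (a \<bullet> b) = tgt C b"
    and cmp_assoc: "\<lbrakk>a \<in> carrier C; b \<in> carrier C; c \<in> carrier C; tgt C a = src C b; tgt C b = src C c\<rbrakk>
      \<Longrightarrow> (a \<bullet> b) \<bullet> c = a \<bullet> (b \<bullet> c)"
    and src_id: "a \<in> carrier C \<Longrightarrow> src C a \<bullet> a = a"
    and tgt_id: "a \<in> carrier C \<Longrightarrow> a \<bullet> tgt C a = a"

definition identities :: "('a, 'm) small_cat_scheme \<Rightarrow> 'a set"
  where "identities C = {e \<in> carrier C. src C e = e \<and> tgt C e = e}"

definition from_obj :: "('a, 'm) small_cat_scheme \<Rightarrow> 'a \<Rightarrow> 'a set"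
  where "from_obj C e = {a \<in> carrier C. src C a = e}"

definition into_obj :: "('a, 'm) small_cat_scheme \<Rightarrow> 'a \<Rightarrow> 'a set"
  where "into_obj C f = {a \<in> carrier C. tgt C a = f}"

definition hom_set :: "('a, 'm) small_cat_scheme \<Rightarrow> 'a \<Rightarrow> 'a \<Rightarrow> 'a set"
  where "hom_set C e f = from_obj C e \<inter> into_obj C f"

definition cat_inverse :: "('a, 'm) small_cat_scheme \<Rightarrow> 'a \<Rightarrow> 'a \<Rightarrow> bool"
  where "cat_inverse C a b \<longleftrightarrow> b \<in> hom_set C (tgt C a) (src C a) \<and>
    a \<bullet>\<^bsub>C\<^esub> b = src C a \<and> b \<bullet>\<^bsub>C\<^esub> a = tgt C a"

definition cat_units :: "('a, 'm) small_cat_scheme \<Rightarrow> 'a set"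
  where "cat_units C = {a \<in> carrier C. \<exists>b. cat_inverse C a b}"

definition cat_inv :: "('a, 'm) small_cat_scheme \<Rightarrow> 'a \<Rightarrow> 'a"
  where "cat_inv C a = (THE b. cat_inverse C a b)"

definition cat_set_mult :: "('a, 'm) small_cat_scheme \<Rightarrow> 'a set \<Rightarrow> 'a set \<Rightarrow> 'a set"
  where "cat_set_mult C A B = {a \<bullet>\<^bsub>C\<^esub> b | a b. a \<in> A \<and> b \<in> B \<and> tgt C a = src C b}"

locale cancellative_category = small_category +
  assumes l_cancel: "\<lbrakk>a \<in> carrier C; b \<in> carrier C; c \<in> carrier C; tgt C a = src C b; tgt C a = src C c;
      a \<bullet> b = a \<bullet> c\<rbrakk> \<Longrightarrow> b = c"
    and r_cancel: "\<lbrakk>a \<in> carrier C; b \<in> carrier C; c \<in> carrier C; tgt C b = src C a; tgt C c = src C a;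
      b \<bullet> a = c \<bullet> a\<rbrakk> \<Longrightarrow> b = c"

locale groupoid = small_category G for G (structure) +
  assumes all_units: "cat_units G = carrier G"

text \<open>The subcategory with set of morphisms \<open>H\<close> is the record \<open>C\<lparr>carrier := H\<rparr>\<close>.\<close>

definition subcategory :: "'a set \<Rightarrow> ('a, 'm) small_cat_scheme \<Rightarrow> bool"
  where "subcategory H C \<longleftrightarrow> H \<subseteq> carrier C \<and> H \<noteq> {} \<and>
    (\<forall>a\<in>H. src C a \<in> H \<and> tgt C a \<in> H) \<and>
    (\<forall>a\<in>H. \<forall>b\<in>H. tgt C a = src C b \<longrightarrow> a \<bullet>\<^bsub>C\<^esub> b \<in> H)"

definition cat_hom :: "('a, 'm) small_cat_scheme \<Rightarrow> ('b, 'n) small_cat_scheme \<Rightarrow> ('a \<Rightarrow> 'b) set"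
  where "cat_hom C D = {\<phi> \<in> carrier C \<rightarrow> carrier D.
    (\<forall>a\<in>carrier C. \<phi> (src C a) = src D (\<phi> a) \<and> \<phi> (tgt C a) = tgt D (\<phi> a)) \<and>
    (\<forall>a\<in>carrier C. \<forall>b\<in>carrier C. tgt C a = src C b \<longrightarrow> \<phi> (a \<bullet>\<^bsub>C\<^esub> b) = \<phi> a \<bullet>\<^bsub>D\<^esub> \<phi> b)}"

definition monoid_cat :: "('a, 'm) monoid_scheme \<Rightarrow> 'a small_cat"
  where "monoid_cat M =
    \<lparr>carrier = carrier M, src = (\<lambda>_. \<one>\<^bsub>M\<^esub>), tgt = (\<lambda>_. \<one>\<^bsub>M\<^esub>), cmp = monoid.mult M\<rparr>"

definition cat_associated :: "('a, 'm) small_cat_scheme \<Rightarrow> 'a \<Rightarrow> 'a \<Rightarrow> bool"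
  where "cat_associated C a b \<longleftrightarrow> (\<exists>\<epsilon>\<in>cat_units C. \<exists>\<eta>\<in>cat_units C.
    tgt C \<epsilon> = src C a \<and> tgt C a = src C \<eta> \<and> b = \<epsilon> \<bullet>\<^bsub>C\<^esub> a \<bullet>\<^bsub>C\<^esub> \<eta>)"

definition atoms :: "('a, 'm) small_cat_scheme \<Rightarrow> 'a set"
  where "atoms C = {u \<in> carrier C - cat_units C.
    \<forall>a\<in>carrier C. \<forall>b\<in>carrier C. tgt C a = src C b \<longrightarrow> u = a \<bullet>\<^bsub>C\<^esub> b
      \<longrightarrow> a \<in> cat_units C \<or> b \<in> cat_units C}"

fun composable :: "('a, 'm) small_cat_scheme \<Rightarrow> 'a \<Rightarrow> 'a list \<Rightarrow> bool" where
  "composable C e [] \<longleftrightarrow> True"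
| "composable C e (u # us) \<longleftrightarrow> src C u = e \<and> composable C (tgt C u) us"


section \<open>Rigid factorizations\<close>

type_synonym 'a rtuple = "'a \<times> 'a list"
type_synonym 'a rfac = "'a rtuple set"

definition rtuples :: "('a, 'm) small_cat_scheme \<Rightarrow> 'a rtuple set"
  where "rtuples C = {(\<epsilon>, us). \<epsilon> \<in> cat_units C \<and> set us \<subseteq> atoms C \<and> composable C (tgt C \<epsilon>) us}"

definition rtuple_prod :: "('a, 'm) small_cat_scheme \<Rightarrow> 'a rtuple \<Rightarrow> 'a"
  where "rtuple_prod C x = foldl (cmp C) (fst x) (snd x)"

definition rtuple_tgt :: "('a, 'm) small_cat_scheme \<Rightarrow> 'a rtuple \<Rightarrow> 'a"
  where "rtuple_tgt C x = (if snd x = [] then tgt C (fst x) else tgt C (last (snd x)))"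

text \<open>
  Lists are indexed from 0, so \<open>\<delta> i\<close> is the unit inserted between \<open>us ! (i - 1)\<close> and \<open>us ! i\<close>;
  \<open>\<delta> k\<close> at the end is an identity.
\<close>

definition rigid_rel :: "('a, 'm) small_cat_scheme \<Rightarrow> ('a rtuple \<times> 'a rtuple) set"
  where "rigid_rel C = {((\<epsilon>, us), (\<epsilon>', vs)).
    (\<epsilon>, us) \<in> rtuples C \<and> (\<epsilon>', vs) \<in> rtuples C \<and> length us = length vs \<and>
    rtuple_prod C (\<epsilon>, us) = rtuple_prod C (\<epsilon>', vs) \<and>
    (us = [] \<or> (\<exists>\<delta>. let k = length us in
       (\<forall>i\<in>{1..<k}. \<delta> i \<in> cat_units C \<and> tgt C (\<delta> i) = src C (us ! i)) \<and>
       \<delta> k = tgt C (us ! (k - 1)) \<and>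
       \<epsilon>' \<bullet>\<^bsub>C\<^esub> vs ! 0 = \<epsilon> \<bullet>\<^bsub>C\<^esub> us ! 0 \<bullet>\<^bsub>C\<^esub> cat_inv C (\<delta> 1) \<and>
       (\<forall>i\<in>{1..<k}. vs ! i = \<delta> i \<bullet>\<^bsub>C\<^esub> us ! i \<bullet>\<^bsub>C\<^esub> cat_inv C (\<delta> (Suc i)))))}"

definition rclass :: "('a, 'm) small_cat_scheme \<Rightarrow> 'a rtuple \<Rightarrow> 'a rfac"
  where "rclass C x = rigid_rel C `` {x}"

definition rtuple_mult :: "('a, 'm) small_cat_scheme \<Rightarrow> 'a rtuple \<Rightarrow> 'a rtuple \<Rightarrow> 'a rtuple"
  where "rtuple_mult C x y = (if snd x = [] then (fst x \<bullet>\<^bsub>C\<^esub> fst y, snd y)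
    else (fst x, butlast (snd x) @ [last (snd x) \<bullet>\<^bsub>C\<^esub> fst y] @ snd y))"

text \<open>
  Operations on classes are the operations on representatives, on which they do not depend;
  \<^const>\<open>the_elem\<close> extracts the common value. Sources and targets in \<open>\<Z>\<^sup>*(C)\<close> are the
  factorizations of length 0 of the corresponding identities of \<open>C\<close>.
\<close>

definition Zstar :: "('a, 'm) small_cat_scheme \<Rightarrow> 'a rfac small_cat"
  where "Zstar C =
    \<lparr>carrier = rtuples C // rigid_rel C,
     src = (\<lambda>z. the_elem ((\<lambda>x. rclass C (src C (fst x), [])) ` z)),
     tgt = (\<lambda>z. the_elem ((\<lambda>x. rclass C (rtuple_tgt C x, [])) ` z)),
     cmp = (\<lambda>z w. the_elem ((\<lambda>(x, y). rclass C (rtuple_mult C x y)) ` (z \<times> w)))\<rparr>"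

definition fac_length :: "'a rfac \<Rightarrow> nat"
  where "fac_length z = the_elem ((\<lambda>x. length (snd x)) ` z)"

definition fac_prod :: "('a, 'm) small_cat_scheme \<Rightarrow> 'a rfac \<Rightarrow> 'a"
  where "fac_prod C z = the_elem (rtuple_prod C ` z)"

definition facs_of :: "('a, 'm) small_cat_scheme \<Rightarrow> 'a \<Rightarrow> 'a rfac set"
  where "facs_of C a = {z \<in> carrier (Zstar C). fac_prod C z = a}"

definition fac_map ::
    "('a, 'm) small_cat_scheme \<Rightarrow> ('b, 'n) small_cat_scheme \<Rightarrow> ('a \<Rightarrow> 'b) \<Rightarrow> 'a rfac \<Rightarrow> 'b rfac"
  where "fac_map C D \<phi> z = the_elem ((\<lambda>x. rclass D (\<phi> (fst x), map \<phi> (snd x))) ` z)"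


section \<open>Distances and catenary degrees\<close>

text \<open>Only the values of \<open>d\<close> on pairs of factorizations of the same element matter.\<close>

definition is_distance :: "('a, 'm) small_cat_scheme \<Rightarrow> ('a rfac \<Rightarrow> 'a rfac \<Rightarrow> nat) \<Rightarrow> bool"
  where "is_distance C d \<longleftrightarrow> (\<forall>a. \<forall>z\<in>facs_of C a. \<forall>z'\<in>facs_of C a.
    d z z = 0 \<and> d z z' = d z' z \<and>
    (\<forall>z''\<in>facs_of C a. d z z' \<le> d z z'' + d z'' z') \<and>
    (\<forall>x\<in>carrier (Zstar C). tgt (Zstar C) x = src (Zstar C) z \<longrightarrow>
       d (x \<bullet>\<^bsub>Zstar C\<^esub> z) (x \<bullet>\<^bsub>Zstar C\<^esub> z') = d z z') \<and>
    (\<forall>y\<in>carrier (Zstar C). tgt (Zstar C) z = src (Zstar C) y \<longrightarrow>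
       d (z \<bullet>\<^bsub>Zstar C\<^esub> y) (z' \<bullet>\<^bsub>Zstar C\<^esub> y) = d z z') \<and>
    \<bar>int (fac_length z) - int (fac_length z')\<bar> \<le> int (d z z') \<and>
    d z z' \<le> Max {fac_length z, fac_length z', 1})"

definition rtuple_perm_dist :: "('a, 'm) small_cat_scheme \<Rightarrow> 'a rtuple \<Rightarrow> 'a rtuple \<Rightarrow> nat"
  where "rtuple_perm_dist C x y = (let us = snd x; vs = snd y in
    max (length us) (length vs) -
    Max {card I | I. I \<subseteq> {..<length us} \<and>
      (\<exists>\<sigma>. inj_on \<sigma> I \<and> \<sigma> ` I \<subseteq> {..<length vs} \<and>
        (\<forall>i\<in>I. cat_associated C (us ! i) (vs ! \<sigma> i)))})"

definition perm_dist :: "('a, 'm) small_cat_scheme \<Rightarrow> 'a rfac \<Rightarrow> 'a rfac \<Rightarrow> nat"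
  where "perm_dist C z w = the_elem ((\<lambda>(x, y). rtuple_perm_dist C x y) ` (z \<times> w))"

definition fac_chain :: "('a, 'm) small_cat_scheme \<Rightarrow> ('a rfac \<Rightarrow> 'a rfac \<Rightarrow> nat) \<Rightarrow> 'a \<Rightarrow> enat
    \<Rightarrow> nat \<Rightarrow> (nat \<Rightarrow> 'a rfac) \<Rightarrow> 'a rfac \<Rightarrow> 'a rfac \<Rightarrow> bool"
  where "fac_chain C d a N n c z z' \<longleftrightarrow> c 0 = z \<and> c n = z' \<and> (\<forall>i\<le>n. c i \<in> facs_of C a) \<and>
    (\<forall>i<n. enat (d (c i) (c (Suc i))) \<le> N)"

definition monotone_chain :: "nat \<Rightarrow> (nat \<Rightarrow> 'a rfac) \<Rightarrow> bool"
  where "monotone_chain n c \<longleftrightarrow>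
    (\<forall>i<n. fac_length (c i) \<le> fac_length (c (Suc i))) \<or>
    (\<forall>i<n. fac_length (c (Suc i)) \<le> fac_length (c i))"

definition catenary :: "('a, 'm) small_cat_scheme \<Rightarrow> ('a rfac \<Rightarrow> 'a rfac \<Rightarrow> nat) \<Rightarrow> 'a \<Rightarrow> enat"
  where "catenary C d a = (LEAST N. \<forall>z\<in>facs_of C a. \<forall>z'\<in>facs_of C a.
    \<exists>n c. fac_chain C d a N n c z z')"

definition catenary_mon :: "('a, 'm) small_cat_scheme \<Rightarrow> ('a rfac \<Rightarrow> 'a rfac \<Rightarrow> nat) \<Rightarrow> 'a \<Rightarrow> enat"
  where "catenary_mon C d a = (LEAST N. \<forall>z\<in>facs_of C a. \<forall>z'\<in>facs_of C a.
    \<exists>n c. fac_chain C d a N n c z z' \<and> monotone_chain n c)"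

definition catenary_eq :: "('a, 'm) small_cat_scheme \<Rightarrow> ('a rfac \<Rightarrow> 'a rfac \<Rightarrow> nat) \<Rightarrow> 'a \<Rightarrow> enat"
  where "catenary_eq C d a = (LEAST N. \<forall>z\<in>facs_of C a. \<forall>z'\<in>facs_of C a.
    fac_length z = fac_length z' \<longrightarrow> (\<exists>n c. fac_chain C d a N n c z z' \<and> monotone_chain n c))"

definition cat_catenary :: "('a, 'm) small_cat_scheme \<Rightarrow> ('a rfac \<Rightarrow> 'a rfac \<Rightarrow> nat) \<Rightarrow> enat"
  where "cat_catenary C d = (SUP a\<in>carrier C. catenary C d a)"

definition cat_catenary_mon :: "('a, 'm) small_cat_scheme \<Rightarrow> ('a rfac \<Rightarrow> 'a rfac \<Rightarrow> nat) \<Rightarrow> enat"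
  where "cat_catenary_mon C d = (SUP a\<in>carrier C. catenary_mon C d a)"

definition cat_catenary_eq :: "('a, 'm) small_cat_scheme \<Rightarrow> ('a rfac \<Rightarrow> 'a rfac \<Rightarrow> nat) \<Rightarrow> enat"
  where "cat_catenary_eq C d = (SUP a\<in>carrier C. catenary_eq C d a)"


section \<open>Transfer homomorphisms\<close>

definition transfer_hom ::
    "('a, 'm) small_cat_scheme \<Rightarrow> ('b, 'n) small_cat_scheme \<Rightarrow> ('a \<Rightarrow> 'b) \<Rightarrow> bool"
  where "transfer_hom C D \<phi> \<longleftrightarrow>
    cancellative_category C \<and> cancellative_category D \<and> \<phi> \<in> cat_hom C D \<and>
    carrier D = cat_set_mult D (cat_set_mult D (cat_units D) (\<phi> ` carrier C)) (cat_units D) \<and>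
    {a \<in> carrier C. \<phi> a \<in> cat_units D} = cat_units C \<and>
    (\<forall>a\<in>carrier C. \<forall>b1\<in>carrier D. \<forall>b2\<in>carrier D.
      tgt D b1 = src D b2 \<longrightarrow> \<phi> a = b1 \<bullet>\<^bsub>D\<^esub> b2 \<longrightarrow>
      (\<exists>a1\<in>carrier C. \<exists>a2\<in>carrier C. \<exists>\<epsilon>\<in>cat_units D.
        tgt C a1 = src C a2 \<and> a = a1 \<bullet>\<^bsub>C\<^esub> a2 \<and> tgt D \<epsilon> = src D b2 \<and>
        \<phi> a1 = b1 \<bullet>\<^bsub>D\<^esub> cat_inv D \<epsilon> \<and> \<phi> a2 = \<epsilon> \<bullet>\<^bsub>D\<^esub> b2))"

definition fiber_catenary :: "('a, 'm) small_cat_scheme \<Rightarrow> ('b, 'n) small_cat_scheme \<Rightarrow> ('a \<Rightarrow> 'b)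
    \<Rightarrow> ('a rfac \<Rightarrow> 'a rfac \<Rightarrow> nat) \<Rightarrow> 'a \<Rightarrow> enat"
  where "fiber_catenary C D \<phi> d a = (LEAST N. \<forall>z\<in>facs_of C a. \<forall>z'\<in>facs_of C a.
    perm_dist D (fac_map C D \<phi> z) (fac_map C D \<phi> z') = 0 \<longrightarrow>
    (\<exists>n c. fac_chain C d a N n c z z' \<and>
      (\<forall>i\<le>n. perm_dist D (fac_map C D \<phi> (c i)) (fac_map C D \<phi> z) = 0)))"

definition cat_fiber_catenary :: "('a, 'm) small_cat_scheme \<Rightarrow> ('b, 'n) small_cat_scheme \<Rightarrow> ('a \<Rightarrow> 'b)
    \<Rightarrow> ('a rfac \<Rightarrow> 'a rfac \<Rightarrow> nat) \<Rightarrow> enat"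
  where "cat_fiber_catenary C D \<phi> d = (SUP a\<in>carrier C. fiber_catenary C D \<phi> d a)"


section \<open>Arithmetical groupoids\<close>

record 'a ordered_cat = "'a small_cat" +
  leq :: "'a \<Rightarrow> 'a \<Rightarrow> bool" (infixl \<open>\<preceq>\<index>\<close> 50)

definition ord_on :: "('a, 'm) ordered_cat_scheme \<Rightarrow> 'a set \<Rightarrow> 'a gorder"
  where "ord_on G S = \<lparr>carrier = S, eq = (=), le = leq G\<rparr>"

abbreviation ord_from :: "('a, 'm) ordered_cat_scheme \<Rightarrow> 'a \<Rightarrow> 'a gorder"
  where "ord_from G e \<equiv> ord_on G (from_obj G e)"

abbreviation ord_into :: "('a, 'm) ordered_cat_scheme \<Rightarrow> 'a \<Rightarrow> 'a gorder"
  where "ord_into G f \<equiv> ord_on G (into_obj G f)"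

definition modular :: "('a, 'm) gorder_scheme \<Rightarrow> bool"
  where "modular L \<longleftrightarrow> (\<forall>x\<in>carrier L. \<forall>y\<in>carrier L. \<forall>z\<in>carrier L. x \<sqsubseteq>\<^bsub>L\<^esub> z \<longrightarrow>
    x \<squnion>\<^bsub>L\<^esub> (y \<sqinter>\<^bsub>L\<^esub> z) = (x \<squnion>\<^bsub>L\<^esub> y) \<sqinter>\<^bsub>L\<^esub> z)"

definition integral_elems :: "('a, 'm) ordered_cat_scheme \<Rightarrow> 'a set"
  where "integral_elems G = {a \<in> carrier G. a \<preceq>\<^bsub>G\<^esub> src G a \<and> a \<preceq>\<^bsub>G\<^esub> tgt G a}"

abbreviation integral_cat :: "('a, 'm) ordered_cat_scheme \<Rightarrow> ('a, 'm) ordered_cat_scheme"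
  where "integral_cat G \<equiv> G\<lparr>carrier := integral_elems G\<rparr>"

definition acc_on :: "('a, 'm) ordered_cat_scheme \<Rightarrow> 'a set \<Rightarrow> bool"
  where "acc_on G S \<longleftrightarrow> (\<forall>c::nat \<Rightarrow> 'a. (\<forall>n. c n \<in> S \<and> c n \<preceq>\<^bsub>G\<^esub> c (Suc n)) \<longrightarrow>
    (\<exists>N. \<forall>n\<ge>N. c n = c N))"

locale lattice_ordered_groupoid = groupoid G for G :: "('a, 'm) ordered_cat_scheme" (structure) +
  assumes lattice_from: "e \<in> identities G \<Longrightarrow> lattice (ord_from G e)"
    and lattice_into: "f \<in> identities G \<Longrightarrow> lattice (ord_into G f)"
    and join_agree: "\<lbrakk>e \<in> identities G; f \<in> identities G; a \<in> hom_set G e f; b \<in> hom_set G e f\<rbrakk> \<Longrightarrow>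
      a \<squnion>\<^bsub>ord_from G e\<^esub> b = a \<squnion>\<^bsub>ord_into G f\<^esub> b \<and> a \<squnion>\<^bsub>ord_from G e\<^esub> b \<in> hom_set G e f"
    and meet_agree: "\<lbrakk>e \<in> identities G; f \<in> identities G; a \<in> hom_set G e f; b \<in> hom_set G e f\<rbrakk> \<Longrightarrow>
      a \<sqinter>\<^bsub>ord_from G e\<^esub> b = a \<sqinter>\<^bsub>ord_into G f\<^esub> b \<and> a \<sqinter>\<^bsub>ord_from G e\<^esub> b \<in> hom_set G e f"

locale arithmetical_groupoid = lattice_ordered_groupoid +
  assumes P1: "a \<in> carrier G \<Longrightarrow> a \<preceq> src G a \<longleftrightarrow> a \<preceq> tgt G a"
    and P2_from: "e \<in> identities G \<Longrightarrow> modular (ord_from G e)"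
    and P2_into: "f \<in> identities G \<Longrightarrow> modular (ord_into G f)"
    and P3_from: "\<lbrakk>e \<in> identities G; a \<in> from_obj G e; b \<in> from_obj G e; a \<preceq> b; c \<in> into_obj G e\<rbrakk>
      \<Longrightarrow> c \<bullet> a \<preceq> c \<bullet> b"
    and P3_into: "\<lbrakk>f \<in> identities G; a \<in> into_obj G f; b \<in> into_obj G f; a \<preceq> b; c \<in> from_obj G f\<rbrakk>
      \<Longrightarrow> a \<bullet> c \<preceq> b \<bullet> c"
    and P4_from: "\<lbrakk>e \<in> identities G; M \<subseteq> from_obj G e \<inter> integral_elems G; M \<noteq> {}\<rbrakk>
      \<Longrightarrow> \<exists>x. is_lub (ord_from G e) x M"
    and P4_into: "\<lbrakk>f \<in> identities G; M \<subseteq> into_obj G f \<inter> integral_elems G; M \<noteq> {}\<rbrakk>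
      \<Longrightarrow> \<exists>x. is_lub (ord_into G f) x M"
    and P4_agree: "\<lbrakk>e \<in> identities G; f \<in> identities G; M \<subseteq> hom_set G e f \<inter> integral_elems G; M \<noteq> {}\<rbrakk>
      \<Longrightarrow> \<Squnion>\<^bsub>ord_from G e\<^esub>M = \<Squnion>\<^bsub>ord_into G f\<^esub>M"
    and P5: "\<lbrakk>e \<in> identities G; f \<in> identities G\<rbrakk> \<Longrightarrow> hom_set G e f \<inter> integral_elems G \<noteq> {}"
    and P6_from: "e \<in> identities G \<Longrightarrow> acc_on G (from_obj G e \<inter> integral_elems G)"
    and P6_into: "f \<in> identities G \<Longrightarrow> acc_on G (into_obj G f \<inter> integral_elems G)"


section \<open>Universal vertex group and abstract norm\<close>

definition vertex_class :: "('a, 'm) small_cat_scheme \<Rightarrow> 'a \<Rightarrow> 'a set"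
  where "vertex_class G x = {cat_inv G a \<bullet>\<^bsub>G\<^esub> x \<bullet>\<^bsub>G\<^esub> a | a. a \<in> from_obj G (src G x)}"

text \<open>
  The group structure of the vertex groups \<open>G(e)\<close> is transported along \<open>x \<mapsto> (x)\<close>; the result
  does not depend on \<open>e\<close>.
\<close>

definition vertex_group :: "('a, 'm) small_cat_scheme \<Rightarrow> 'a set monoid"
  where "vertex_group G =
    \<lparr>carrier = {vertex_class G x | x e. e \<in> identities G \<and> x \<in> hom_set G e e},
     monoid.mult = (\<lambda>X Y. THE Z. \<exists>e\<in>identities G. \<exists>x\<in>hom_set G e e. \<exists>y\<in>hom_set G e e.
       X = vertex_class G x \<and> Y = vertex_class G y \<and> Z = vertex_class G (x \<bullet>\<^bsub>G\<^esub> y)),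
     one = (THE E. \<exists>e\<in>identities G. E = vertex_class G e)\<rparr>"

text \<open>
  The abstract norm is determined only on the carrier of \<open>G\<close>; extensionality makes it unique as
  a function on the whole type.
\<close>

definition abstract_norm :: "('a, 'm) ordered_cat_scheme \<Rightarrow> 'a \<Rightarrow> 'a set"
  where "abstract_norm G = (THE \<eta>. \<eta> \<in> extensional (carrier G) \<and>
    \<eta> \<in> cat_hom G (monoid_cat (vertex_group G)) \<and>
    (\<forall>u\<in>atoms (integral_cat G). \<eta> u = vertex_class G
      (\<Squnion>\<^bsub>ord_from G (src G u)\<^esub> {x \<in> hom_set G (src G u) (src G u). x \<preceq>\<^bsub>G\<^esub> u})))"


section \<open>Class group and block homomorphism\<close>

definition right_fractions :: "('a, 'm) small_cat_scheme \<Rightarrow> 'a set \<Rightarrow> 'a set"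
  where "right_fractions G H = cat_set_mult G H (cat_inv G ` H)"

definition right_saturated :: "('a, 'm) ordered_cat_scheme \<Rightarrow> 'a set \<Rightarrow> bool"
  where "right_saturated G H \<longleftrightarrow> right_fractions G H \<inter> integral_elems G = H"

definition norm_subgroup :: "('a, 'm) ordered_cat_scheme \<Rightarrow> 'a set \<Rightarrow> 'a set set"
  where "norm_subgroup G H = generate (vertex_group G) (abstract_norm G ` H)"

definition class_group :: "('a, 'm) ordered_cat_scheme \<Rightarrow> 'a set \<Rightarrow> 'a set set monoid"
  where "class_group G H = vertex_group G Mod norm_subgroup G H"

definition norm_class :: "('a, 'm) ordered_cat_scheme \<Rightarrow> 'a set \<Rightarrow> 'a set \<Rightarrow> 'a set set"
  where "norm_class G H X = norm_subgroup G H #>\<^bsub>vertex_group G\<^esub> X"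

definition atom_classes :: "('a, 'm) ordered_cat_scheme \<Rightarrow> 'a set \<Rightarrow> 'a set set set"
  where "atom_classes G H = {norm_class G H (abstract_norm G u) | u. u \<in> atoms (integral_cat G)}"

text \<open>
  The free abelian monoid on \<open>M\<close> consists of the multisets over \<open>M\<close>. The group \<open>C\<close> is written
  multiplicatively, so zero-sum means that the product is \<open>\<one>\<close>.
\<close>

definition block_monoid :: "('c, 'm) monoid_scheme \<Rightarrow> 'c set \<Rightarrow> 'c multiset monoid"
  where "block_monoid C M =
    \<lparr>carrier = {B. set_mset B \<subseteq> M \<and> (\<Otimes>\<^bsub>C\<^esub>g\<in>set_mset B. g [^]\<^bsub>C\<^esub> count B g) = \<one>\<^bsub>C\<^esub>},
     monoid.mult = (+), one = {#}\<rparr>"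

definition block_cat :: "('a, 'm) ordered_cat_scheme \<Rightarrow> 'a set \<Rightarrow> 'a set set multiset small_cat"
  where "block_cat G H = monoid_cat (block_monoid (class_group G H) (atom_classes G H))"

definition block_hom :: "('a, 'm) ordered_cat_scheme \<Rightarrow> 'a set \<Rightarrow> 'a \<Rightarrow> 'a set set multiset"
  where "block_hom G H a = (THE B. \<exists>us. set us \<subseteq> atoms (integral_cat G) \<and>
    composable G (src G a) us \<and> a = foldl (cmp G) (src G a) us \<and>
    B = mset (map (\<lambda>u. norm_class G H (abstract_norm G u)) us))"

end

theory Submission
  imports Defs "HOL-Combinatorics.Permutations"
begin

text \<open>
  Factorizations of an integral element \<open>a\<close> into atoms of \<open>G\<^sub>+\<close> are the maximal chains between \<open>a\<close>
  and its source in a modular lattice. In a diamond \<open>u v = u' v'\<close> of atoms the norms of opposite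
  sides agree; hence, by the Jordan-Hoelder argument, the multiset of norms of the atoms is an
  invariant of \<open>a\<close>. Two consecutive atoms of different norm can be exchanged, so every splitting of
  this multiset comes from a splitting of \<open>a\<close>. The hypothesis on \<open>H\<close> says that an integral element
  whose source lies in \<open>H\<close> belongs to \<open>H\<close> iff the product of its classes is trivial, and so the block
  homomorphism is a transfer homomorphism.
  
  For the fibers, let \<open>w\<close> and \<open>w'\<close> be the first atoms of two factorizations of \<open>a\<close>, which may be
  assumed to have the same image, put \<open>m = w \<or> w'\<close> and write \<open>w = m g\<close>, \<open>w' = m g'\<close>. If \<open>g\<close> is an
  atom of \<open>G\<^sub>+\<close>, then \<open>w\<close> and \<open>w'\<close> can be completed by one further atom of \<open>H\<close> each to the same left
  divisor of \<open>a\<close>: this is a step of distance at most 2. Otherwise let \<open>p\<close> be an atom above \<open>g\<close> and \<open>h\<close>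
  above \<open>g'\<close> such that \<open>g'\<close> has one factor more than \<open>h\<close>, in the class of \<open>p\<close>; then
  \<open>m (p \<and> h)\<close> has the same image as \<open>w\<close>, and it is closer to both \<open>w\<close> and \<open>w'\<close>.
  
  Chains in the block monoid are lifted step by step; a step of length \<open>N\<close> replaces at most \<open>N\<close> atoms
  and lifts to a replacement of the same number of atoms in \<open>H\<close>.
\<close>


section \<open>Products of multisets, matchings of lists and chains\<close>

text \<open>For elements with a common source, \<open>a \<preceq> b\<close> means
  \<open>a = b \<bullet> c\<close> with \<open>c\<close> integral. The source is thus the top among
  integral elements, atoms lie directly below it, joins are greatest common left divisors and meets
  are least common right multiples. The modular law therefore speaks about factorizations, and norms
  are compared along diamonds.

  The obstacle in the fibers is that \<open>\<theta>\<close> sees only classes of norms. Atoms of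
  \<open>H\<close> with the same image may have different norms, so two factorizations cannot be
  matched factor by factor in \<open>G\<^sub>+\<close>. What saves the argument is that perspective
  intervals have the same norms: if \<open>g\<close> and \<open>g'\<close> have only identities as
  common left divisors, the cofactor of \<open>g\<close> in their meet has the norms of
  \<open>g'\<close>, hence the classes of \<open>g\<close> whenever those of \<open>g\<close> and
  \<open>g'\<close> agree. Interpolated elements need no search in \<open>H\<close>: their source
  lies in \<open>H\<close>, and their image alone decides whether they belong to \<open>H\<close>
  and are atoms there.

  The constant 2 is the number of neighbouring atoms replaced in one step; translation invariance of
  \<open>d\<close> removes all others.\<close>

definition mset_prod :: "('c, 'm) monoid_scheme \<Rightarrow> 'c multiset \<Rightarrow> 'c"
  where "mset_prod M B = (\<Otimes>\<^bsub>M\<^esub>g\<in>set_mset B. g [^]\<^bsub>M\<^esub> count B g)"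

context comm_monoid
begin

lemma mset_prod_closed [simp]: "set_mset B \<subseteq> carrier G \<Longrightarrow> mset_prod G B \<in> carrier G"
  unfolding mset_prod_def by (rule finprod_closed) auto

lemma mset_prod_empty [simp]: "mset_prod G {#} = \<one>"
  by (simp add: mset_prod_def)

lemma mset_prod_add_mset [simp]:
  assumes x: "x \<in> carrier G" and B: "set_mset B \<subseteq> carrier G"
  shows "mset_prod G (add_mset x B) = x \<otimes> mset_prod G B"
proof -
  let ?S = "set_mset B - {x}"
  have S: "finite ?S" "x \<notin> ?S" "(\<lambda>g. g [^] count C g) \<in> ?S \<rightarrow> carrier G" for C
    using B by auto
  \<comment> \<open>The index \<open>x\<close> may be added even if it does not occur in
    \<open>B\<close>: its exponent is then 0 and the factor is \<open>\<one>\<close>.\<close>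
  have "mset_prod G B = (\<Otimes>g\<in>insert x ?S. g [^] count B g)"
  proof (cases "x \<in># B")
    case True thus ?thesis by (simp add: mset_prod_def insert_absorb)
  next
    case False
    have "(\<Otimes>g\<in>insert x ?S. g [^] count B g) = x [^] count B x \<otimes> (\<Otimes>g\<in>?S. g [^] count B g)"
      using S x by (intro finprod_insert) auto
    also have "\<dots> = mset_prod G B"
      using False B by (auto simp: mset_prod_def not_in_iff intro!: l_one finprod_closed)
    finally show ?thesis ..
  qed
  also have "\<dots> = x [^] count B x \<otimes> (\<Otimes>g\<in>?S. g [^] count B g)"
    using S x by (intro finprod_insert) auto
  finally have B': "mset_prod G B = x [^] count B x \<otimes> (\<Otimes>g\<in>?S. g [^] count B g)" .
  have "mset_prod G (add_mset x B) = (\<Otimes>g\<in>insert x ?S. g [^] count (add_mset x B) g)"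
    by (simp add: mset_prod_def)
  also have "\<dots> = x [^] Suc (count B x) \<otimes> (\<Otimes>g\<in>?S. g [^] count (add_mset x B) g)"
    using B x by (subst finprod_insert) auto
  also have "(\<Otimes>g\<in>?S. g [^] count (add_mset x B) g) = (\<Otimes>g\<in>?S. g [^] count B g)"
    using S by (intro finprod_cong') auto
  also have "x [^] Suc (count B x) \<otimes> (\<Otimes>g\<in>?S. g [^] count B g) = x \<otimes> mset_prod G B"
    unfolding B' using x S(3) by (simp add: m_ac finprod_closed)
  finally show ?thesis .
qed

lemma mset_prod_union [simp]:
  "\<lbrakk>set_mset A \<subseteq> carrier G; set_mset B \<subseteq> carrier G\<rbrakk> \<Longrightarrow> mset_prod G (A + B) = mset_prod G A \<otimes> mset_prod G B"
  by (induction A) (auto simp: m_assoc)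

end

text \<open>Both fractions are expanded to a common numerator and denominator. This makes the norm
  of a fraction independent of its representation.\<close>

lemma (in comm_group) quotient_eqI:
  assumes "b \<in> carrier G" "c \<in> carrier G" "b' \<in> carrier G" "c' \<in> carrier G" "m \<in> carrier G" "m' \<in> carrier G"
    and "b \<otimes> m = b' \<otimes> m'" "c \<otimes> m = c' \<otimes> m'"
  shows "b \<otimes> inv c = b' \<otimes> inv c'"
proof -
  have "b \<otimes> inv c = (b \<otimes> m) \<otimes> inv (c \<otimes> m)"
    using assms(1-6) by (simp add: inv_mult m_ac r_inv)
  also have "\<dots> = b' \<otimes> inv c'"
    unfolding assms(7,8) using assms(1-6) by (simp add: inv_mult m_ac r_inv)
  finally show ?thesis .
qed

section \<open>The permutable distance on lists\<close>

definition card_matchings :: "'b list \<Rightarrow> 'b list \<Rightarrow> nat set"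
  where "card_matchings Xs Ys = {card I | I. I \<subseteq> {..<length Xs} \<and>
      (\<exists>\<sigma>. inj_on \<sigma> I \<and> \<sigma> ` I \<subseteq> {..<length Ys} \<and> (\<forall>i\<in>I. Xs ! i = Ys ! \<sigma> i))}"

text \<open>In the block monoid associated elements are equal, so this is its permutable distance,
  see \<open>perm_dist_BC\<close>.\<close>

definition list_dist :: "'b list \<Rightarrow> 'b list \<Rightarrow> nat"
  where "list_dist Xs Ys = max (length Xs) (length Ys) - Max (card_matchings Xs Ys)"

lemma finite_card_matchings: "finite (card_matchings Xs Ys)"
  by (rule finite_subset[of _ "card ` Pow {..<length Xs}"]) (auto simp: card_matchings_def)

lemma card_matchings_nonempty: "card_matchings Xs Ys \<noteq> {}"
  by (auto simp: card_matchings_def intro!: exI[of _ "{}"])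

text \<open>A largest matching splits off the common part \<open>R\<close>. The unmatched rests have
  the lengths of the lists minus the size of the matching, so the larger rest has exactly the size
  of the distance. A step of a chain in the block monoid is lifted in this form.\<close>

lemma list_dist_decomp:
  "\<exists>R S T. mset Xs = R + S \<and> mset Ys = R + T \<and> max (size S) (size T) = list_dist Xs Ys"
proof -
  have "Max (card_matchings Xs Ys) \<in> card_matchings Xs Ys"
    by (rule Max_in[OF finite_card_matchings card_matchings_nonempty])
  then obtain J \<sigma> where J: "J \<subseteq> {..<length Xs}" "inj_on \<sigma> J" "\<sigma> ` J \<subseteq> {..<length Ys}"
      "\<forall>i\<in>J. Xs ! i = Ys ! \<sigma> i" "Max (card_matchings Xs Ys) = card J"
    unfolding card_matchings_def by auto
  have m: "mset Zs = image_mset ((!) Zs) (mset_set A) + image_mset ((!) Zs) (mset_set ({..<length Zs} - A))"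
    if "A \<subseteq> {..<length Zs}" for A and Zs :: "'a list"
  proof -
    have "mset Zs = image_mset ((!) Zs) (mset_set {..<length Zs})"
      by (metis map_nth mset_map mset_set_set set_upt distinct_upt atLeast0LessThan mset_upt)
    also have "mset_set {..<length Zs} = mset_set A + mset_set ({..<length Zs} - A)"
      using that by (subst mset_set_Union[symmetric]) (auto intro: finite_subset arg_cong[of _ _ mset_set])
    finally show ?thesis by simp
  qed
  have "image_mset ((!) Ys) (mset_set (\<sigma> ` J)) = image_mset ((!) Ys) (image_mset \<sigma> (mset_set J))"
    using J(2) by (simp add: image_mset_mset_set)
  also have "\<dots> = image_mset ((!) Xs) (mset_set J)"
    using J(1,4) by (auto simp: multiset.map_comp intro!: image_mset_cong dest: finite_subset)
  finally have R: "image_mset ((!) Ys) (mset_set (\<sigma> ` J)) = image_mset ((!) Xs) (mset_set J)" .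
  define S where "S = image_mset ((!) Xs) (mset_set ({..<length Xs} - J))"
  define T where "T = image_mset ((!) Ys) (mset_set ({..<length Ys} - \<sigma> ` J))"
  have szS: "size S = length Xs - card J" using J(1) by (simp add: S_def card_Diff_subset finite_subset)
  have szT: "size T = length Ys - card J"
    using J(2,3) by (simp add: T_def card_Diff_subset finite_subset card_image)
  have "max (size S) (size T) = list_dist Xs Ys"
    unfolding list_dist_def J(5) szS szT by arith
  thus ?thesis using m[OF J(1)] m[OF J(3)] R unfolding S_def T_def by metis
qed

lemma list_dist_eq_0_iff: "list_dist Xs Ys = 0 \<longleftrightarrow> mset Xs = mset Ys"
proof
  assume "list_dist Xs Ys = 0"
  thus "mset Xs = mset Ys" using list_dist_decomp[of Xs Ys] by auto
next
  assume eq: "mset Xs = mset Ys"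
  then obtain f where f: "f permutes {..<length Ys}" "permute_list f Ys = Xs"
    using mset_eq_permutation by blast
  have "card {..<length Xs} \<in> card_matchings Xs Ys"
    unfolding card_matchings_def using f mset_eq_length[OF eq] permutes_image[OF f(1)] permutes_inj_on[OF f(1)]
    by (intro CollectI exI[of _ "{..<length Xs}"] exI[of _ f] conjI) (auto simp: permute_list_nth)
  hence "length Xs \<le> Max (card_matchings Xs Ys)" using Max_ge[OF finite_card_matchings] by fastforce
  thus "list_dist Xs Ys = 0" using mset_eq_length[OF eq] by (simp add: list_dist_def)
qed

lemma relpowp_chain: "R\<^sup>*\<^sup>* x y \<Longrightarrow> \<exists>n f. f 0 = x \<and> f n = y \<and> (\<forall>i<n::nat. R (f i) (f (Suc i)))"
  using rtranclp_imp_relpowp[of R x y] relpowp_fun_conv[of _ R x y] by blast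

lemma chain_rtranclp: "(\<forall>i<n::nat. R (f i) (f (Suc i))) \<Longrightarrow> R\<^sup>*\<^sup>* (f 0) (f n)"
  using relpowp_imp_rtranclp[of n R "f 0" "f n"] relpowp_fun_conv[of n R "f 0" "f n"] by blast

lemma SUP_le_max_SUP:
  fixes f :: "'a \<Rightarrow> 'c :: {complete_lattice, linorder}"
  assumes "\<And>a. a \<in> A \<Longrightarrow> \<theta> a \<in> B" "\<And>a. a \<in> A \<Longrightarrow> f a \<le> max (g (\<theta> a)) k"
  shows "(SUP a\<in>A. f a) \<le> max (SUP b\<in>B. g b) k"
proof (rule SUP_least)
  fix a assume a: "a \<in> A"
  have "g (\<theta> a) \<le> (SUP b\<in>B. g b)" using assms(1)[OF a] by (rule SUP_upper)
  thus "f a \<le> max (SUP b\<in>B. g b) k" using assms(2)[OF a] by (meson max.mono order_refl order_trans)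
qed

section \<open>Rigid factorizations in reduced categories\<close>

lemma mem_hom_set: "a \<in> hom_set C e f \<longleftrightarrow> a \<in> carrier C \<and> src C a = e \<and> tgt C a = f"
  by (auto simp: hom_set_def from_obj_def into_obj_def)

text \<open>If all units are identities, a rigid factorization is a single tuple: an identity and a
  list of atoms. Both \<open>H\<close> and the block monoid are of this kind, which reduces all
  operations on classes to operations on lists.\<close>

locale reduced_category = small_category C for C :: "('a, 'm) small_cat_scheme" (structure) +
  assumes reduced: "cat_units C \<subseteq> identities C"
begin

lemma units_identity: "e \<in> cat_units C \<Longrightarrow> e \<in> carrier C \<and> src C e = e \<and> tgt C e = e"
  using reduced by (auto simp: identities_def)

lemma identity_unit:
  assumes "e \<in> carrier C" "src C e = e"
  shows "e \<in> cat_units C"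
proof -
  have "tgt C e = e" using tgt_src[of e] assms by simp
  moreover have "e \<bullet> e = e" using src_id[of e] assms by simp
  ultimately show ?thesis
    using assms unfolding cat_units_def cat_inverse_def mem_hom_set by (intro CollectI conjI exI[of _ e]) auto
qed

lemma cat_inv_unit: 
  assumes "e \<in> cat_units C" shows "cat_inv C e = e"
  unfolding cat_inv_def
proof (rule the_equality)
  note e = units_identity[OF assms]
  have "e \<bullet> e = e" using src_id[of e] e by simp
  thus "cat_inverse C e e" using e by (simp add: cat_inverse_def mem_hom_set)
  fix b assume "cat_inverse C e b"
  hence b: "b \<in> carrier C" "src C b = e" "e \<bullet> b = e" using e by (auto simp: cat_inverse_def mem_hom_set)
  thus "b = e" using src_id[of b] by simp
qed

lemma atoms_carrier: "u \<in> atoms C \<Longrightarrow> u \<in> carrier C"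
  by (simp add: atoms_def)

lemma foldl_cmp_src:
  "\<lbrakk>c \<in> carrier C; set us \<subseteq> carrier C; composable C (tgt C c) us\<rbrakk>
    \<Longrightarrow> foldl (cmp C) c us \<in> carrier C \<and> src C (foldl (cmp C) c us) = src C c"
proof (induction us arbitrary: c)
  case (Cons u us)
  have "c \<bullet> u \<in> carrier C" "tgt C (c \<bullet> u) = tgt C u" "src C (c \<bullet> u) = src C c"
    using Cons.prems cmp_closed[of c u] tgt_cmp[of c u] src_cmp[of c u] by auto
  thus ?case using Cons.IH[of "c \<bullet> u"] Cons.prems by simp
qed simp

lemma composable_nth:
  "\<lbrakk>composable C e us; i < length us\<rbrakk> \<Longrightarrow> src C (us ! i) = (if i = 0 then e else tgt C (us ! (i - 1)))"
proof (induction us arbitrary: e i)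
  case (Cons u us)
  thus ?case using Cons.IH[of "tgt C u" "i - 1"] by (cases i) (auto simp: nth_Cons split: nat.splits)
qed simp

lemma rtuples_iff: "(e, us) \<in> rtuples C \<longleftrightarrow> e \<in> carrier C \<and> src C e = e \<and> set us \<subseteq> atoms C \<and> composable C e us"
  using units_identity[of e] identity_unit[of e] by (auto simp: rtuples_def)

text \<open>Each inserted unit is an identity, and its prescribed target determines which one; hence
  the relation compares the two lists entry by entry.\<close>

lemma rigid_rel_eq: "rigid_rel C = Id_on (rtuples C)"
proof (intro equalityI subrelI)
  fix x y assume xy: "(x, y) \<in> rigid_rel C"
  obtain e us f vs where x: "x = (e, us)" and y: "y = (f, vs)" by (cases x, cases y)
  have 1: "(e, us) \<in> rtuples C" "(f, vs) \<in> rtuples C" "length us = length vs"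
    "rtuple_prod C (e, us) = rtuple_prod C (f, vs)"
    using xy by (auto simp: rigid_rel_def x y)
  have e: "e \<in> carrier C" "src C e = e" "tgt C e = e" "set us \<subseteq> carrier C" "composable C e us"
    and f: "f \<in> carrier C" "src C f = f" "tgt C f = f" "set vs \<subseteq> carrier C" "composable C f vs"
    using 1(1,2) units_identity[OF identity_unit] atoms_carrier by (auto simp: rtuples_iff)
  \<comment> \<open>The leading identity is the source of the product, so it can be recovered from
    the product.\<close>
  have ef: "e = f"
    using foldl_cmp_src[of e us] foldl_cmp_src[of f vs] e f 1(4) by (simp add: rtuple_prod_def)
  have "us = vs"
  proof (cases "us = []")
    case True thus ?thesis using 1(3) by simp
  next
    case False
    have vne: "vs \<noteq> []" using False 1(3) by auto
    define k where "k = length us"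
    from xy False obtain \<delta> where
      \<delta>: "\<forall>i\<in>{1..<k}. \<delta> i \<in> cat_units C \<and> tgt C (\<delta> i) = src C (us ! i)"
        "\<delta> k = tgt C (us ! (k - 1))"
        "f \<bullet> vs ! 0 = e \<bullet> us ! 0 \<bullet> cat_inv C (\<delta> 1)"
        "\<forall>i\<in>{1..<k}. vs ! i = \<delta> i \<bullet> us ! i \<bullet> cat_inv C (\<delta> (Suc i))"
      unfolding rigid_rel_def x y k_def by (auto simp: Let_def)
    have us: "us ! i \<in> carrier C" if "i < k" for i using e(4) that by (auto simp: k_def)
    have D: "\<delta> (Suc i) = tgt C (us ! i)" if "i < k" for i
    proof (cases "Suc i = k")
      case True thus ?thesis using \<delta>(2) by auto
    next
      case False
      hence "\<delta> (Suc i) \<in> cat_units C" "tgt C (\<delta> (Suc i)) = src C (us ! Suc i)" using \<delta>(1) that by auto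
      thus ?thesis using units_identity composable_nth[OF e(5), of "Suc i"] False that by (auto simp: k_def)
    qed
    have inv: "us ! i \<bullet> cat_inv C (\<delta> (Suc i)) = us ! i" if "i < k" for i
      using D[OF that] us[OF that] identity_unit[of "tgt C (us ! i)"] cat_inv_unit tgt_id[of "us ! i"]
        src_tgt[of "us ! i"] tgt_closed[of "us ! i"] by simp
    have "vs ! i = us ! i" if i: "i < k" for i
    proof (cases i)
      case 0
      have "src C (us ! 0) = e" "src C (vs ! 0) = f"
        using composable_nth[OF e(5), of 0] composable_nth[OF f(5), of 0] False vne by auto
      moreover have "vs ! 0 \<in> carrier C" using f(4) False 1(3) by (auto intro!: nth_mem)
      ultimately show ?thesis
        using \<delta>(3) inv[of 0] us[of 0] src_id[of "us ! 0"] src_id[of "vs ! 0"] i 0 by simp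
    next
      case (Suc j)
      have s: "\<delta> i = src C (us ! i)" using D[of j] i Suc composable_nth[OF e(5), of i] by (simp add: k_def)
      hence "vs ! i = \<delta> i \<bullet> us ! i \<bullet> cat_inv C (\<delta> (Suc i))" using \<delta>(4) i Suc by auto
      thus ?thesis using s src_id[of "us ! i"] us[OF i] inv[OF i] by simp
    qed
    thus ?thesis using 1(3) by (intro nth_equalityI) (auto simp: k_def)
  qed
  thus "(x, y) \<in> Id_on (rtuples C)" using ef 1(1) by (simp add: x y Id_on_iff)
next
  fix x y assume "(x, y) \<in> Id_on (rtuples C)"
  then obtain e us where x: "x = (e, us)" "y = (e, us)" and r: "(e, us) \<in> rtuples C" by (cases x) auto
  have e: "e \<in> carrier C" "src C e = e" "tgt C e = e" "set us \<subseteq> carrier C" "composable C e us"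
    using r units_identity[OF identity_unit] atoms_carrier by (auto simp: rtuples_iff)
  \<comment> \<open>The identity at the junction in front of \<open>us ! i\<close>; for
    \<open>i = length us\<close> it is the final target demanded by the relation.\<close>
  define \<delta> where "\<delta> i = tgt C (us ! (i - 1))" for i
  have us: "us ! i \<in> carrier C" if "i < length us" for i using e(4) that by auto
  have inv: "us ! i \<bullet> cat_inv C (\<delta> (Suc i)) = us ! i" if "i < length us" for i
    using us[OF that] identity_unit[of "tgt C (us ! i)"] cat_inv_unit tgt_id[of "us ! i"]
        src_tgt[of "us ! i"] tgt_closed[of "us ! i"] by (simp add: \<delta>_def)
  have un: "\<delta> i \<in> cat_units C" "\<delta> i = src C (us ! i)" "tgt C (\<delta> i) = src C (us ! i)" if "i \<in> {1..<length us}" for i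
  proof -
    show s: "\<delta> i = src C (us ! i)" using composable_nth[OF e(5), of i] that by (auto simp: \<delta>_def)
    show "\<delta> i \<in> cat_units C" "tgt C (\<delta> i) = src C (us ! i)"
      unfolding s using that us[of i] by (auto intro!: identity_unit src_closed simp: src_src tgt_src)
  qed
  have "us = [] \<or> (let k = length us in
       (\<forall>i\<in>{1..<k}. \<delta> i \<in> cat_units C \<and> tgt C (\<delta> i) = src C (us ! i)) \<and>
       \<delta> k = tgt C (us ! (k - 1)) \<and>
       e \<bullet> us ! 0 = e \<bullet> us ! 0 \<bullet> cat_inv C (\<delta> 1) \<and>
       (\<forall>i\<in>{1..<k}. us ! i = \<delta> i \<bullet> us ! i \<bullet> cat_inv C (\<delta> (Suc i))))"
  proof (cases "us = []")
    case False
    hence "src C (us ! 0) = e" using composable_nth[OF e(5), of 0] by simp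
    hence "e \<bullet> us ! 0 = us ! 0" using src_id[of "us ! 0"] us[of 0] False by simp
    moreover have "\<delta> i \<bullet> us ! i = us ! i" if "i \<in> {1..<length us}" for i
      using un(2)[OF that] src_id[of "us ! i"] us[of i] that by simp
    ultimately show ?thesis using un inv False inv[of 0] by (simp add: Let_def \<delta>_def)
  qed simp
  thus "(x, y) \<in> rigid_rel C" unfolding rigid_rel_def x using r by auto
qed

lemma rclass_eq: "x \<in> rtuples C \<Longrightarrow> rclass C x = {x}"
  by (auto simp: rclass_def rigid_rel_eq)

lemma carrier_Zstar: "carrier (Zstar C) = (\<lambda>x. {x}) ` rtuples C"
  by (auto simp: Zstar_def rigid_rel_eq quotient_def)

lemma facs_of_eq: "facs_of C a = (\<lambda>x. {x}) ` {x \<in> rtuples C. rtuple_prod C x = a}"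
  by (auto simp: facs_of_def carrier_Zstar fac_prod_def)

lemma src_Zstar: "x \<in> rtuples C \<Longrightarrow> src (Zstar C) {x} = {(fst x, [])}"
  using rclass_eq[of "(fst x, [])"] by (cases x) (simp add: Zstar_def rtuples_iff)

lemma tgt_Zstar: "(rtuple_tgt C x, []) \<in> rtuples C \<Longrightarrow> tgt (Zstar C) {x} = {(rtuple_tgt C x, [])}"
  by (simp add: Zstar_def rclass_eq)

lemma cmp_Zstar: "rtuple_mult C x y \<in> rtuples C \<Longrightarrow> cmp (Zstar C) {x} {y} = {rtuple_mult C x y}"
  by (simp add: Zstar_def rclass_eq)

end

lemma fac_length_singleton [simp]: "fac_length {x} = length (snd x)"
  by (simp add: fac_length_def)

text \<open>The bound \<open>\<infinity>\<close> admits the chain with the single step from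
  \<open>z\<close> to \<open>z'\<close>. So the least bounds in the definitions of the catenary
  degrees exist and are attained, which the next three lemmas exploit.\<close>

lemma two_step_chain:
  assumes "z \<in> facs_of C a" "z' \<in> facs_of C a"
  shows "\<exists>n c. fac_chain C d a \<infinity> n c z z' \<and> monotone_chain n c"
  using assms
  by (intro exI[of _ 1] exI[of _ "\<lambda>i. if i = 0 then z else z'"]) (auto simp: fac_chain_def monotone_chain_def)

lemma catenary_chain:
  assumes "z \<in> facs_of C a" "z' \<in> facs_of C a"
  shows "\<exists>n c. fac_chain C d a (catenary C d a) n c z z'"
proof -
  have "\<forall>z\<in>facs_of C a. \<forall>z'\<in>facs_of C a. \<exists>n c. fac_chain C d a (catenary C d a) n c z z'"
    unfolding catenary_def by (rule LeastI[of _ \<infinity>]) (use two_step_chain[of _ C a _ d] in meson)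
  thus ?thesis using assms by blast
qed

lemma catenary_mon_chain:
  assumes "z \<in> facs_of C a" "z' \<in> facs_of C a"
  shows "\<exists>n c. fac_chain C d a (catenary_mon C d a) n c z z' \<and> monotone_chain n c"
proof -
  have "\<forall>z\<in>facs_of C a. \<forall>z'\<in>facs_of C a. \<exists>n c. fac_chain C d a (catenary_mon C d a) n c z z' \<and> monotone_chain n c"
    unfolding catenary_mon_def by (rule LeastI[of _ \<infinity>]) (use two_step_chain[of _ C a _ d] in meson)
  thus ?thesis using assms by blast
qed

lemma catenary_eq_chain:
  assumes "z \<in> facs_of C a" "z' \<in> facs_of C a" "fac_length z = fac_length z'"
  shows "\<exists>n c. fac_chain C d a (catenary_eq C d a) n c z z' \<and> monotone_chain n c"
proof -
  have "\<forall>z\<in>facs_of C a. \<forall>z'\<in>facs_of C a. fac_length z = fac_length z' \<longrightarrow>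
      (\<exists>n c. fac_chain C d a (catenary_eq C d a) n c z z' \<and> monotone_chain n c)"
    unfolding catenary_eq_def by (rule LeastI[of _ \<infinity>]) (use two_step_chain[of _ C a _ d] in meson)
  thus ?thesis using assms by blast
qed

section \<open>Groupoids\<close>

context groupoid
begin

abbreviation iv :: "'a \<Rightarrow> 'a" where "iv \<equiv> cat_inv G"

lemmas cat_simps [simp] = src_closed tgt_closed src_src tgt_src src_tgt tgt_tgt cmp_closed src_cmp tgt_cmp
  src_id tgt_id cmp_assoc

lemma id_left: "a \<in> carrier G \<Longrightarrow> src G a = e \<Longrightarrow> e \<bullet> a = a"
  by auto

lemma id_right: "a \<in> carrier G \<Longrightarrow> tgt G a = e \<Longrightarrow> a \<bullet> e = a"
  by auto

lemma id_simps [simp]: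
  "\<lbrakk>a \<in> carrier G; src G a = src G b\<rbrakk> \<Longrightarrow> src G b \<bullet> a = a"
  "\<lbrakk>a \<in> carrier G; src G a = tgt G b\<rbrakk> \<Longrightarrow> tgt G b \<bullet> a = a"
  "\<lbrakk>a \<in> carrier G; tgt G a = src G b\<rbrakk> \<Longrightarrow> a \<bullet> src G b = a"
  "\<lbrakk>a \<in> carrier G; tgt G a = tgt G b\<rbrakk> \<Longrightarrow> a \<bullet> tgt G b = a"
  by (auto simp: id_left id_right)

lemma identity_iff: "e \<in> identities G \<longleftrightarrow> e \<in> carrier G \<and> src G e = e \<and> tgt G e = e"
  by (auto simp: identities_def)

lemma identity_src [simp]: "a \<in> carrier G \<Longrightarrow> src G a \<in> identities G"
  and identity_tgt [simp]: "a \<in> carrier G \<Longrightarrow> tgt G a \<in> identities G"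
  by (auto simp: identity_iff)

lemma cat_inverse_unique:
  assumes "a \<in> carrier G" "cat_inverse G a b" "cat_inverse G a c"
  shows "b = c"
proof -
  have b: "b \<in> carrier G" "src G b = tgt G a" "tgt G b = src G a" "a \<bullet> b = src G a" "b \<bullet> a = tgt G a"
    and c: "c \<in> carrier G" "src G c = tgt G a" "tgt G c = src G a" "a \<bullet> c = src G a" "c \<bullet> a = tgt G a"
    using assms by (auto simp: cat_inverse_def mem_hom_set)
  have "b = b \<bullet> (a \<bullet> c)"
    using b c assms(1) by simp
  also have "\<dots> = (b \<bullet> a) \<bullet> c"
    using b(1-3) c(1-3) assms(1) by simp
  also have "\<dots> = c"
    using b c assms(1) by simp
  finally show ?thesis .
qed

lemma cat_inverse_iv: "a \<in> carrier G \<Longrightarrow> cat_inverse G a (iv a)"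
  unfolding cat_inv_def by (rule theI') (use all_units cat_inverse_unique in \<open>auto simp: cat_units_def\<close>)

lemma iv_closed [simp]: "a \<in> carrier G \<Longrightarrow> iv a \<in> carrier G"
  and src_iv [simp]: "a \<in> carrier G \<Longrightarrow> src G (iv a) = tgt G a"
  and tgt_iv [simp]: "a \<in> carrier G \<Longrightarrow> tgt G (iv a) = src G a"
  and iv_r [simp]: "a \<in> carrier G \<Longrightarrow> a \<bullet> iv a = src G a"
  and iv_l [simp]: "a \<in> carrier G \<Longrightarrow> iv a \<bullet> a = tgt G a"
  using cat_inverse_iv by (auto simp: cat_inverse_def mem_hom_set)

lemma iv_unique: "\<lbrakk>a \<in> carrier G; b \<in> carrier G; src G b = tgt G a; a \<bullet> b = src G a\<rbrakk> \<Longrightarrow> iv a = b"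
proof -
  assume a: "a \<in> carrier G" "b \<in> carrier G" "src G b = tgt G a" "a \<bullet> b = src G a"
  have "iv a = iv a \<bullet> (a \<bullet> b)" using a by (simp del: cmp_assoc)
  also have "\<dots> = (iv a \<bullet> a) \<bullet> b" using a(1-3) by (subst cmp_assoc) simp_all
  also have "\<dots> = b" using a by simp
  finally show ?thesis .
qed

lemma iv_l_assoc [simp]: "\<lbrakk>a \<in> carrier G; b \<in> carrier G; tgt G a = src G b\<rbrakk> \<Longrightarrow> iv a \<bullet> (a \<bullet> b) = b"
  by (subst cmp_assoc[symmetric]) auto

lemma iv_r_assoc [simp]: "\<lbrakk>a \<in> carrier G; b \<in> carrier G; src G a = src G b\<rbrakk> \<Longrightarrow> a \<bullet> (iv a \<bullet> b) = b"
  by (subst cmp_assoc[symmetric]) auto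

lemma iv_iv [simp]: "a \<in> carrier G \<Longrightarrow> iv (iv a) = a"
  by (rule iv_unique) auto

lemma iv_cmp [simp]: "\<lbrakk>a \<in> carrier G; b \<in> carrier G; tgt G a = src G b\<rbrakk> \<Longrightarrow> iv (a \<bullet> b) = iv b \<bullet> iv a"
  by (rule iv_unique) auto

lemma iv_identity: "e \<in> carrier G \<Longrightarrow> src G e = e \<Longrightarrow> iv e = e"
proof (rule iv_unique)
  assume e: "e \<in> carrier G" "src G e = e"
  have "tgt G e = e" using tgt_src[OF e(1)] e(2) by simp
  thus "src G e = tgt G e" using e by simp
  show "e \<bullet> e = src G e" using e id_left[of e e] by simp
qed

lemma iv_src [simp]: "a \<in> carrier G \<Longrightarrow> iv (src G a) = src G a"
  and iv_tgt [simp]: "a \<in> carrier G \<Longrightarrow> iv (tgt G a) = tgt G a"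
  by (auto intro: iv_identity)

lemma cancel_left: "\<lbrakk>a \<in> carrier G; b \<in> carrier G; c \<in> carrier G; tgt G a = src G b; tgt G a = src G c\<rbrakk>
    \<Longrightarrow> a \<bullet> b = a \<bullet> c \<longleftrightarrow> b = c"
  by (metis iv_l_assoc)

lemma cancel_right: "\<lbrakk>a \<in> carrier G; b \<in> carrier G; c \<in> carrier G; tgt G b = src G a; tgt G c = src G a\<rbrakk>
    \<Longrightarrow> b \<bullet> a = c \<bullet> a \<longleftrightarrow> b = c"
  by (metis cmp_assoc iv_closed iv_r src_iv tgt_id)

lemma eq_cmp_iff: "\<lbrakk>a \<in> carrier G; b \<in> carrier G; c \<in> carrier G; tgt G b = src G c; src G b = src G a\<rbrakk>
    \<Longrightarrow> a = b \<bullet> c \<longleftrightarrow> iv b \<bullet> a = c"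
  by auto

end

section \<open>The order of an arithmetical groupoid\<close>

context arithmetical_groupoid
begin

abbreviation I :: "'a set" where "I \<equiv> integral_elems G"

lemma lattice_src: "a \<in> carrier G \<Longrightarrow> lattice (ord_from G (src G a))"
  using lattice_from by auto

lemma le_refl [simp]: "a \<in> carrier G \<Longrightarrow> a \<preceq> a"
  using weak_partial_order.le_refl[of "ord_from G (src G a)" a] lattice_src[of a]
  by (simp add: ord_on_def from_obj_def lattice_def upper_semilattice_def partial_order_def)

lemma le_antisym: 
  assumes "a \<in> carrier G" "b \<in> carrier G" "src G a = src G b" "a \<preceq> b" "b \<preceq> a" shows "a = b"
  using weak_partial_order.weak_le_antisym[of "ord_from G (src G a)" a b] lattice_src[of a] assms
  by (simp add: ord_on_def from_obj_def lattice_def upper_semilattice_def partial_order_def)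

lemma le_trans: 
  assumes "a \<preceq> b" "b \<preceq> c" "a \<in> carrier G" "b \<in> carrier G" "c \<in> carrier G" "src G a = src G b" "src G b = src G c"
  shows "a \<preceq> c"
  using weak_partial_order.le_trans[of "ord_from G (src G a)" a b c] lattice_src[of a] assms
  by (simp add: ord_on_def from_obj_def lattice_def upper_semilattice_def partial_order_def)

lemma lmult: "\<lbrakk>a \<preceq> b; a \<in> carrier G; b \<in> carrier G; c \<in> carrier G; src G a = src G b; tgt G c = src G a\<rbrakk>
    \<Longrightarrow> c \<bullet> a \<preceq> c \<bullet> b"
  using P3_from[of "src G a" a b c] by (simp add: from_obj_def into_obj_def)

lemma rmult: "\<lbrakk>a \<preceq> b; a \<in> carrier G; b \<in> carrier G; c \<in> carrier G; tgt G a = tgt G b; tgt G a = src G c\<rbrakk>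
    \<Longrightarrow> a \<bullet> c \<preceq> b \<bullet> c"
  using P3_into[of "tgt G a" a b c] by (simp add: from_obj_def into_obj_def)

lemma lmult_iff: "\<lbrakk>a \<in> carrier G; b \<in> carrier G; c \<in> carrier G; src G a = src G b; tgt G c = src G a\<rbrakk>
    \<Longrightarrow> c \<bullet> a \<preceq> c \<bullet> b \<longleftrightarrow> a \<preceq> b"
  using lmult[of a b c] lmult[of "c \<bullet> a" "c \<bullet> b" "iv c"] by auto

lemma rmult_iff: "\<lbrakk>a \<in> carrier G; b \<in> carrier G; c \<in> carrier G; tgt G a = tgt G b; tgt G a = src G c\<rbrakk>
    \<Longrightarrow> a \<bullet> c \<preceq> b \<bullet> c \<longleftrightarrow> a \<preceq> b"
  using rmult[of a b c] rmult[of "a \<bullet> c" "b \<bullet> c" "iv c"] by auto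

lemma integral_iff_src: "a \<in> I \<longleftrightarrow> a \<in> carrier G \<and> a \<preceq> src G a"
  using P1 by (auto simp: integral_elems_def)

lemma integral_iff_tgt: "a \<in> I \<longleftrightarrow> a \<in> carrier G \<and> a \<preceq> tgt G a"
  using P1 by (auto simp: integral_elems_def)

lemma integral_carrier [simp]: "a \<in> I \<Longrightarrow> a \<in> carrier G"
  by (simp add: integral_iff_src)

lemma integral_src [simp]: "a \<in> carrier G \<Longrightarrow> src G a \<in> I"
  and integral_tgt [simp]: "a \<in> carrier G \<Longrightarrow> tgt G a \<in> I"
  by (auto simp: integral_iff_src simp del: integral_carrier)

lemma le_iff_integral: "\<lbrakk>a \<in> carrier G; b \<in> carrier G; src G a = src G b\<rbrakk> \<Longrightarrow> a \<preceq> b \<longleftrightarrow> iv b \<bullet> a \<in> I"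
  using lmult_iff[of a b "iv b"] by (simp add: integral_iff_src del: integral_carrier)

lemma le_iff_integral_into: "\<lbrakk>a \<in> carrier G; b \<in> carrier G; tgt G a = tgt G b\<rbrakk> \<Longrightarrow> a \<preceq> b \<longleftrightarrow> a \<bullet> iv b \<in> I"
  using rmult_iff[of a b "iv b"] by (simp add: integral_iff_tgt del: integral_carrier)

lemma le_left: "\<lbrakk>a \<in> carrier G; b \<in> I; tgt G a = src G b\<rbrakk> \<Longrightarrow> a \<bullet> b \<preceq> a"
  using le_iff_integral[of "a \<bullet> b" a] by simp

lemma le_right: "\<lbrakk>a \<in> I; b \<in> carrier G; tgt G a = src G b\<rbrakk> \<Longrightarrow> a \<bullet> b \<preceq> b"
  using le_iff_integral_into[of "a \<bullet> b" b] by simp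

lemma integral_cmp [simp]: "\<lbrakk>a \<in> I; b \<in> I; tgt G a = src G b\<rbrakk> \<Longrightarrow> a \<bullet> b \<in> I"
  using le_left[of a b] le_trans[of "a \<bullet> b" a "src G a"] by (simp add: integral_iff_src del: integral_carrier)

lemma integral_reduced: "\<lbrakk>a \<in> I; iv a \<in> I\<rbrakk> \<Longrightarrow> src G a = a"
  using le_iff_integral[of "src G a" a] by (auto simp: integral_iff_src simp del: integral_carrier intro: le_antisym)

lemma integral_mono: "\<lbrakk>a \<preceq> b; b \<in> I; a \<in> carrier G; src G a = src G b\<rbrakk> \<Longrightarrow> a \<in> I"
  using le_trans[of a b "src G b"] by (auto simp: integral_iff_src simp del: integral_carrier)

lemma le_imp_ex: "\<lbrakk>a \<preceq> b; a \<in> carrier G; b \<in> carrier G; src G a = src G b\<rbrakk>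
    \<Longrightarrow> \<exists>c\<in>I. tgt G b = src G c \<and> a = b \<bullet> c"
  by (rule bexI[of _ "iv b \<bullet> a"]) (auto simp: le_iff_integral)

definition jn :: "'a \<Rightarrow> 'a \<Rightarrow> 'a" where "jn a b = a \<squnion>\<^bsub>ord_from G (src G a)\<^esub> b"
definition mt :: "'a \<Rightarrow> 'a \<Rightarrow> 'a" where "mt a b = a \<sqinter>\<^bsub>ord_from G (src G a)\<^esub> b"

context
  fixes a b
  assumes ab: "a \<in> carrier G" "b \<in> carrier G" "src G b = src G a"
begin

interpretation L: lattice "ord_from G (src G a)" by (rule lattice_src) (rule ab)

lemma in_ord: "a \<in> carrier (ord_from G (src G a))" "b \<in> carrier (ord_from G (src G a))"
  using ab by (auto simp: ord_on_def from_obj_def)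

lemma jn_closed [simp]: "jn a b \<in> carrier G" and src_jn [simp]: "src G (jn a b) = src G a"
  using L.join_closed[OF in_ord] by (auto simp: jn_def ord_on_def from_obj_def)

lemma mt_closed [simp]: "mt a b \<in> carrier G" and src_mt [simp]: "src G (mt a b) = src G a"
  using L.meet_closed[OF in_ord] by (auto simp: mt_def ord_on_def from_obj_def)

lemma jn_left [simp]: "a \<preceq> jn a b" and jn_right [simp]: "b \<preceq> jn a b"
  using L.join_left[OF in_ord] L.join_right[OF in_ord] by (auto simp: jn_def ord_on_def)

lemma mt_left [simp]: "mt a b \<preceq> a" and mt_right [simp]: "mt a b \<preceq> b"
  using L.meet_left[OF in_ord] L.meet_right[OF in_ord] by (auto simp: mt_def ord_on_def)

lemma jn_least: "c \<in> carrier G \<Longrightarrow> src G c = src G a \<Longrightarrow> a \<preceq> c \<Longrightarrow> b \<preceq> c \<Longrightarrow> jn a b \<preceq> c"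
  using L.join_le[OF _ _ in_ord, of c] by (auto simp: jn_def ord_on_def from_obj_def)

lemma mt_greatest: "c \<in> carrier G \<Longrightarrow> src G c = src G a \<Longrightarrow> c \<preceq> a \<Longrightarrow> c \<preceq> b \<Longrightarrow> c \<preceq> mt a b"
  using L.meet_le[OF _ _ in_ord, of c] by (auto simp: mt_def ord_on_def from_obj_def)

text \<open>The agreement of the two lattice structures enters here: a meet formed among the
  elements with a fixed source keeps the common target.\<close>

lemma tgt_mt: "tgt G a = tgt G b \<Longrightarrow> tgt G (mt a b) = tgt G a"
  using meet_agree[of "src G a" "tgt G a" a b] ab by (auto simp: mt_def mem_hom_set)

lemma tgt_jn: "tgt G a = tgt G b \<Longrightarrow> tgt G (jn a b) = tgt G a"
  using join_agree[of "src G a" "tgt G a" a b] ab by (auto simp: jn_def mem_hom_set)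

end

lemma mt_comm: "mt a b = mt b a" if "src G a = src G b"
  using that by (simp add: mt_def meet_comm)

lemma jn_comm: "jn a b = jn b a" if "src G a = src G b"
  using that by (simp add: jn_def join_comm)

lemma le_iff_mt: "\<lbrakk>a \<in> carrier G; b \<in> carrier G; src G b = src G a\<rbrakk> \<Longrightarrow> a \<preceq> b \<longleftrightarrow> mt a b = a"
  by (metis le_antisym le_refl mt_closed mt_greatest mt_left mt_right src_mt)

lemma cmp_le_iff: "\<lbrakk>a \<in> carrier G; b \<in> carrier G; c \<in> carrier G; src G b = src G c; tgt G c = src G a\<rbrakk>
    \<Longrightarrow> c \<bullet> a \<preceq> b \<longleftrightarrow> a \<preceq> iv c \<bullet> b"
  using lmult_iff[of a "iv c \<bullet> b" c] by simp

lemma le_cmp_iff: "\<lbrakk>a \<in> carrier G; b \<in> carrier G; c \<in> carrier G; src G b = src G c; tgt G c = src G a\<rbrakk>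
    \<Longrightarrow> b \<preceq> c \<bullet> a \<longleftrightarrow> iv c \<bullet> b \<preceq> a"
  using lmult_iff[of "iv c \<bullet> b" a c] by simp

text \<open>Left multiplication by \<open>c\<close> is an order isomorphism whose inverse is left
  multiplication by \<open>iv c\<close>, so it preserves joins.\<close>

lemma lmult_jn: 
  assumes "a \<in> carrier G" "b \<in> carrier G" "src G b = src G a" "c \<in> carrier G" "tgt G c = src G a"
  shows "c \<bullet> jn a b = jn (c \<bullet> a) (c \<bullet> b)"
proof (rule le_antisym)
  have "jn a b \<preceq> iv c \<bullet> jn (c \<bullet> a) (c \<bullet> b)"
    using assms by (intro jn_least) (simp_all add: cmp_le_iff[symmetric])
  thus "c \<bullet> jn a b \<preceq> jn (c \<bullet> a) (c \<bullet> b)" using assms by (simp add: cmp_le_iff)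
  show "jn (c \<bullet> a) (c \<bullet> b) \<preceq> c \<bullet> jn a b"
    using assms by (intro jn_least) (simp_all add: lmult_iff)
qed (use assms in auto)

lemma lmult_mt: 
  assumes "a \<in> carrier G" "b \<in> carrier G" "src G b = src G a" "c \<in> carrier G" "tgt G c = src G a"
  shows "c \<bullet> mt a b = mt (c \<bullet> a) (c \<bullet> b)"
proof (rule le_antisym)
  have "iv c \<bullet> mt (c \<bullet> a) (c \<bullet> b) \<preceq> mt a b"
    using assms by (intro mt_greatest) (simp_all add: le_cmp_iff[symmetric])
  thus "mt (c \<bullet> a) (c \<bullet> b) \<preceq> c \<bullet> mt a b" using assms by (simp add: le_cmp_iff)
  show "c \<bullet> mt a b \<preceq> mt (c \<bullet> a) (c \<bullet> b)"
    using assms by (intro mt_greatest) (simp_all add: lmult_iff)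
qed (use assms in auto)

lemma modular_law:
  assumes "x \<in> carrier G" "y \<in> carrier G" "z \<in> carrier G" "src G x = src G z" "src G y = src G z" "x \<preceq> z"
  shows "jn x (mt y z) = mt (jn x y) z"
proof -
  have "src G (jn x y) = src G z"
    using assms by simp
  moreover have "x \<squnion>\<^bsub>ord_from G (src G z)\<^esub> (y \<sqinter>\<^bsub>ord_from G (src G z)\<^esub> z)
      = (x \<squnion>\<^bsub>ord_from G (src G z)\<^esub> y) \<sqinter>\<^bsub>ord_from G (src G z)\<^esub> z"
    using P2_from[of "src G z"] assms unfolding modular_def by (simp add: ord_on_def from_obj_def)
  ultimately show ?thesis
    using assms(4,5) by (simp add: jn_def mt_def)
qed

lemma wf_acc: "acc_on G S \<Longrightarrow> wf {(b, a). a \<in> S \<and> b \<in> S \<and> a \<preceq> b \<and> a \<noteq> b}"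
  unfolding wf_iff_no_infinite_down_chain acc_on_def
  by (auto, metis le_refl order_refl Suc_leD lessI less_imp_le_nat le_SucI)

lemma acc_induct:
  assumes "acc_on G S" "a \<in> S"
    and step: "\<And>a. a \<in> S \<Longrightarrow> (\<And>b. b \<in> S \<Longrightarrow> a \<preceq> b \<Longrightarrow> a \<noteq> b \<Longrightarrow> P b) \<Longrightarrow> P a"
  shows "P a"
proof -
  have "a \<in> S \<longrightarrow> P a"
    using wf_acc[OF assms(1)]
  proof (induction a rule: wf_induct_rule)
    case (less a)
    thus ?case using step[of a] by auto
  qed
  thus ?thesis using assms(2) by simp
qed

text \<open>Removing a left factor keeps the target and enlarges the element; this is the order for
  inductions along factorizations. The variant with fixed source below serves for climbing to a
  maximal left divisor.\<close>

lemma integral_into_induct [consumes 1, case_names step]: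
  assumes "a \<in> I"
    and "\<And>a. a \<in> I \<Longrightarrow> (\<And>b. b \<in> I \<Longrightarrow> tgt G b = tgt G a \<Longrightarrow> a \<preceq> b \<Longrightarrow> a \<noteq> b \<Longrightarrow> P b) \<Longrightarrow> P a"
  shows "P a"
proof (rule acc_induct[OF P6_into[of "tgt G a"]])
  show "tgt G a \<in> identities G" "a \<in> into_obj G (tgt G a) \<inter> I"
    using assms(1) by (auto simp: into_obj_def)
qed (use assms(2) in \<open>auto simp: into_obj_def\<close>)

lemma integral_from_induct [consumes 1, case_names step]:
  assumes "a \<in> I"
    and "\<And>a. a \<in> I \<Longrightarrow> (\<And>b. b \<in> I \<Longrightarrow> src G b = src G a \<Longrightarrow> a \<preceq> b \<Longrightarrow> a \<noteq> b \<Longrightarrow> P b) \<Longrightarrow> P a"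
  shows "P a"
proof (rule acc_induct[OF P6_from[of "src G a"]])
  show "src G a \<in> identities G" "a \<in> from_obj G (src G a) \<inter> I"
    using assms(1) by (auto simp: from_obj_def)
qed (use assms(2) in \<open>auto simp: from_obj_def\<close>)

section \<open>Vertex groups and atoms\<close>

lemma cmp_eq_right_iff: "\<lbrakk>a \<in> carrier G; b \<in> carrier G; tgt G a = src G b\<rbrakk> \<Longrightarrow> a \<bullet> b = b \<longleftrightarrow> a = src G a"
  using cancel_right[of b a "src G b"] by simp (metis src_src tgt_src)

lemma cmp_eq_left_iff: "\<lbrakk>a \<in> carrier G; b \<in> carrier G; tgt G a = src G b\<rbrakk> \<Longrightarrow> a \<bullet> b = a \<longleftrightarrow> b = src G b"
  using cancel_left[of a b "tgt G a"] by simp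

definition verts :: "'a set"
  where "verts = {x \<in> carrier G. tgt G x = src G x}"

lemma verts_carrier [simp]: "x \<in> verts \<Longrightarrow> x \<in> carrier G"
  and verts_tgt [simp]: "x \<in> verts \<Longrightarrow> tgt G x = src G x"
  and vertsI: "\<lbrakk>x \<in> carrier G; tgt G x = src G x\<rbrakk> \<Longrightarrow> x \<in> verts"
  by (auto simp: verts_def)

lemma verts_cmp [simp]: "\<lbrakk>x \<in> verts; y \<in> verts; src G x = src G y\<rbrakk> \<Longrightarrow> x \<bullet> y \<in> verts"
  and verts_iv [simp]: "x \<in> verts \<Longrightarrow> iv x \<in> verts"
  and verts_src [simp]: "a \<in> carrier G \<Longrightarrow> src G a \<in> verts"
  and verts_tgt_in [simp]: "a \<in> carrier G \<Longrightarrow> tgt G a \<in> verts"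
  by (auto intro!: vertsI)

lemmas cat_closure = cmp_closed src_cmp tgt_cmp iv_closed src_iv tgt_iv

text \<open>
  Declaring these rules again puts them in front of the membership rules for \<open>verts\<close> and
  \<open>integral_elems\<close>, which otherwise make the simplifier search an exponential number of side conditions.
\<close>

declare cat_closure [simp del]
declare cat_closure [simp]

lemma verts_mt: "\<lbrakk>x \<in> verts; y \<in> verts; src G x = src G y\<rbrakk> \<Longrightarrow> mt x y \<in> verts"
  and verts_jn: "\<lbrakk>x \<in> verts; y \<in> verts; src G x = src G y\<rbrakk> \<Longrightarrow> jn x y \<in> verts"
  by (auto intro!: vertsI simp: tgt_mt tgt_jn)

lemma verts_conj [simp]: "\<lbrakk>x \<in> verts; a \<in> carrier G; src G a = src G x\<rbrakk> \<Longrightarrow> iv a \<bullet> (x \<bullet> a) \<in> verts"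
  by (auto intro!: vertsI)

text \<open>
  The maximal integral elements of a vertex group below the identity: they correspond to the atoms
  of the positive cone of the universal vertex group.
\<close>

definition vprime :: "'a \<Rightarrow> bool"
  where "vprime p \<longleftrightarrow> p \<in> verts \<inter> I \<and> p \<noteq> src G p \<and>
    (\<forall>x \<in> verts \<inter> I. src G x = src G p \<longrightarrow> p \<preceq> x \<longrightarrow> x = p \<or> x = src G p)"

lemma vprime_verts [simp]: "vprime p \<Longrightarrow> p \<in> verts"
  and vprime_integral [simp]: "vprime p \<Longrightarrow> p \<in> I"
  and vprime_not_id: "vprime p \<Longrightarrow> p \<noteq> src G p"
  and vprime_max: "\<lbrakk>vprime p; x \<in> verts; x \<in> I; src G x = src G p; p \<preceq> x\<rbrakk> \<Longrightarrow> x = p \<or> x = src G p"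
  by (auto simp: vprime_def)

lemma integral_le_src: "\<lbrakk>a \<in> I; src G a = e\<rbrakk> \<Longrightarrow> a \<preceq> e"
  unfolding integral_iff_src by auto

declare cat_closure [simp del]
declare cat_closure [simp]

lemma le_src_eq: "\<lbrakk>a \<in> I; src G a \<preceq> a\<rbrakk> \<Longrightarrow> a = src G a"
  by (rule le_antisym) (auto intro: integral_le_src)

lemma jn_integral: "\<lbrakk>a \<in> I; b \<in> I; src G b = src G a\<rbrakk> \<Longrightarrow> jn a b \<in> I"
  unfolding integral_iff_src using jn_least[of a b "src G a"] by simp

lemma mt_integral: "\<lbrakk>a \<in> I; b \<in> carrier G; src G b = src G a\<rbrakk> \<Longrightarrow> mt a b \<in> I"
  by (rule integral_mono[of _ a]) auto

lemma vprime_above: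
  assumes "x \<in> I" "x \<in> verts" "x \<noteq> src G x"
  shows "\<exists>p. vprime p \<and> src G p = src G x \<and> x \<preceq> p"
  using assms
proof (induction x rule: integral_from_induct)
  case (step x)
  show ?case
  proof (cases "vprime x")
    case False
    then obtain y where y: "y \<in> verts" "y \<in> I" "src G y = src G x" "x \<preceq> y" "y \<noteq> x" "y \<noteq> src G x"
      using step.hyps step.prems unfolding vprime_def by blast
    then obtain p where "vprime p" "src G p = src G y" "y \<preceq> p"
      using step.IH[of y] by auto
    thus ?thesis using y step.hyps step.prems by - (rule exI[of _ p], (auto intro: le_trans[of x y p]))
  qed (use step in auto)
qed

lemma vprime_jn:
  assumes "vprime p" "vprime q" "src G p = src G q" "p \<noteq> q"
  shows "jn p q = src G p"
proof -
  have "jn p q = p \<or> jn p q = src G p"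
    using assms by (intro vprime_max) (auto intro: jn_integral verts_jn)
  moreover have "jn p q \<noteq> p"
  proof
    assume "jn p q = p"
    hence "q \<preceq> p" using jn_right[of p q] assms by simp
    thus False using vprime_max[of q p] vprime_not_id[of p] assms by auto
  qed
  ultimately show ?thesis by simp
qed

text \<open>Distinct \<open>p\<close> and \<open>q\<close> have the identity as join. If
  \<open>mt p q = y \<bullet> p\<close>, multiplying that join by \<open>y\<close> shows that
  \<open>y\<close> is the join of \<open>y \<bullet> p\<close> and \<open>y \<bullet> q\<close>,
  both below \<open>q\<close>. So \<open>y \<preceq> q\<close> and
  \<open>mt p q \<preceq> q \<bullet> p\<close>. Symmetry of the meet makes \<open>p\<close> and
  \<open>q\<close> commute.\<close>

lemma vprime_mt:
  assumes "vprime p" "vprime q" "src G p = src G q" "p \<noteq> q"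
  shows "mt p q = q \<bullet> p"
proof (rule le_antisym)
  note [simp] = assms(1,2) assms(3)[symmetric]
  define r where "r = mt p q"
  have r: "r \<in> carrier G" "src G r = src G p" "tgt G r = src G p" "r \<preceq> p" "r \<preceq> q"
    using tgt_mt[of p q] by (auto simp: r_def)
  define y where "y = r \<bullet> iv p"
  have y: "y \<in> I" "y \<in> verts" "src G y = src G p" "y \<bullet> p = r"
    using r le_iff_integral_into[of r p] by (auto simp: y_def intro!: vertsI)
  have "y = jn (y \<bullet> p) (y \<bullet> q)"
    using y(1-3) lmult_jn[of p q y] vprime_jn[OF assms] by simp
  also have "\<dots> \<preceq> q"
    using y r by (intro jn_least) (auto intro: le_right)
  finally have "y \<preceq> q" .
  hence "y \<bullet> p \<preceq> q \<bullet> p" using y(1-3) by (intro rmult) auto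
  thus "mt p q \<preceq> q \<bullet> p" using y(4) by (simp add: r_def)
  show "q \<bullet> p \<preceq> mt p q"
    by (intro mt_greatest) (auto intro: le_left le_right)
qed (use assms in auto)

lemma vprime_commute: "\<lbrakk>vprime p; vprime q; src G p = src G q\<rbrakk> \<Longrightarrow> p \<bullet> q = q \<bullet> p"
  by (metis vprime_mt mt_comm)

lemma vertex_integral_induct [consumes 2, case_names src vprime]:
  assumes "x \<in> I" "x \<in> verts" "P (src G x)"
    and "\<And>p y. \<lbrakk>vprime p; y \<in> I; y \<in> verts; src G y = src G x; src G p = src G x; P y\<rbrakk> \<Longrightarrow> P (p \<bullet> y)"
  shows "P x"
proof -
  have "P y" if "y \<in> I" "y \<in> verts" "src G y = src G x" for y
    using that
  proof (induction y rule: integral_from_induct)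
    case (step y)
    show ?case
    proof (cases "y = src G y")
      case True thus ?thesis using step assms(3) by simp
    next
      case False
      then obtain p where p: "vprime p" "src G p = src G y" "y \<preceq> p"
        using vprime_above[of y] step by auto
      define z where "z = iv p \<bullet> y"
      have z: "z \<in> I" "z \<in> verts" "src G z = src G p"
        using p step.hyps step.prems le_iff_integral[of y p] by (auto simp: z_def)
      have yz: "y = p \<bullet> z"
        using p step.hyps step.prems by (simp add: z_def)
      have "y \<preceq> z"
        unfolding yz by (rule le_right) (use p(1) z in auto)
      moreover have "y \<noteq> z"
        unfolding yz using cmp_eq_right_iff[of p z] vprime_not_id[of p] p(1) z by auto
      ultimately have "P z"
        using step.IH[of z] z p(1,2) step.prems by simp
      thus ?thesis
        unfolding yz using assms(4)[of p z] p z step.prems by simp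
    qed
  qed
  thus ?thesis using assms by simp
qed

lemma integral_quotient:
  assumes "a \<in> carrier G"
  shows "mt a (src G a) \<in> I" "iv a \<bullet> mt a (src G a) \<in> I"
  using assms le_iff_integral[of "mt a (src G a)" a] mt_integral[of "src G a" a]
  by (auto simp: mt_comm[of a "src G a"])

text \<open>The maximal elements generate the vertex group: integral loops are products of them, and
  every loop \<open>x\<close> satisfies \<open>b = x \<bullet> c\<close> with integral loops
  \<open>b\<close> and \<open>c\<close>. Applied to both arguments in turn, this makes the vertex
  group abelian.\<close>

lemma vertex_commuteI:
  assumes "y \<in> verts" "\<And>p. vprime p \<Longrightarrow> src G p = src G y \<Longrightarrow> p \<bullet> y = y \<bullet> p"
    and "x \<in> verts" "src G x = src G y"
  shows "x \<bullet> y = y \<bullet> x"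
proof -
  have int: "z \<bullet> y = y \<bullet> z" if "z \<in> I" "z \<in> verts" "src G z = src G y" for z
    using that(1,2)
  proof (induction z rule: vertex_integral_induct)
    case (vprime p z)
    have "(p \<bullet> z) \<bullet> y = p \<bullet> (y \<bullet> z)" using vprime that assms(1) by simp
    also have "\<dots> = (p \<bullet> y) \<bullet> z" using vprime that assms(1) by (subst cmp_assoc) simp_all
    also have "\<dots> = y \<bullet> (p \<bullet> z)" using vprime that assms(1,2) by simp
    finally show ?case .
  qed (use that assms(1) in auto)
  define b where "b = mt x (src G x)"
  define c where "c = iv x \<bullet> b"
  have b: "b \<in> I" "b \<in> verts" "src G b = src G y"
    using integral_quotient(1)[of x] assms by (auto simp: b_def verts_mt)
  have c: "c \<in> I" "c \<in> verts" "src G c = src G y"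
    using integral_quotient(2)[of x, folded b_def] assms(1,3,4) b by (auto simp: c_def)
  have "b \<bullet> y = y \<bullet> b" "c \<bullet> y = y \<bullet> c"
    using int b c by auto
  have "b = x \<bullet> c" using assms b by (simp add: c_def)
  have "(x \<bullet> y) \<bullet> c = x \<bullet> (c \<bullet> y)" using assms c \<open>c \<bullet> y = y \<bullet> c\<close> by simp
  also have "\<dots> = b \<bullet> y" using assms c \<open>b = x \<bullet> c\<close> by simp
  also have "\<dots> = (y \<bullet> x) \<bullet> c" using \<open>b \<bullet> y = y \<bullet> b\<close> \<open>b = x \<bullet> c\<close> assms c by simp
  finally show ?thesis
    using cancel_right[of c "x \<bullet> y" "y \<bullet> x"] assms c by simp
qed

lemma vertex_commute: "\<lbrakk>x \<in> verts; y \<in> verts; src G x = src G y\<rbrakk> \<Longrightarrow> x \<bullet> y = y \<bullet> x"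
proof (rule vertex_commuteI)
  fix p assume "y \<in> verts" "vprime p" "src G p = src G y"
  thus "p \<bullet> y = y \<bullet> p"
    by (intro vertex_commuteI[of p y, symmetric]) (auto intro: vprime_commute)
qed auto

text \<open>The loop \<open>a \<bullet> iv b\<close> commutes with \<open>x\<close>, so conjugation
  depends only on the end points of the arrow.\<close>

lemma conj_eq:
  assumes "x \<in> verts" "a \<in> carrier G" "b \<in> carrier G" "src G a = src G x" "src G b = src G x" "tgt G a = tgt G b"
  shows "iv a \<bullet> (x \<bullet> a) = iv b \<bullet> (x \<bullet> b)"
proof -
  have "(a \<bullet> iv b) \<bullet> x = x \<bullet> (a \<bullet> iv b)"
    using assms by (intro vertex_commute) (auto intro!: vertsI)
  hence "iv a \<bullet> (((a \<bullet> iv b) \<bullet> x) \<bullet> b) = iv a \<bullet> ((x \<bullet> (a \<bullet> iv b)) \<bullet> b)"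
    by simp
  thus ?thesis using assms by simp
qed

lemma conj_mono:
  "\<lbrakk>x \<preceq> y; x \<in> verts; y \<in> verts; a \<in> carrier G; src G y = src G x; src G a = src G x\<rbrakk>
    \<Longrightarrow> iv a \<bullet> (x \<bullet> a) \<preceq> iv a \<bullet> (y \<bullet> a)"
  by (intro lmult rmult) auto

lemma conj_integral: "\<lbrakk>x \<in> verts; x \<in> I; a \<in> carrier G; src G a = src G x\<rbrakk> \<Longrightarrow> iv a \<bullet> (x \<bullet> a) \<in> I"
  using conj_mono[of x "src G x" a] integral_le_src[of x] unfolding integral_iff_src[of "_ \<bullet> _"] by simp

lemma vprime_conj:
  assumes "vprime p" "a \<in> carrier G" "src G a = src G p"
  shows "vprime (iv a \<bullet> (p \<bullet> a))"
  unfolding vprime_def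
proof (intro conjI ballI impI)
  note [simp] = assms
  show "iv a \<bullet> (p \<bullet> a) \<in> verts \<inter> I" by (simp add: conj_integral)
  show "iv a \<bullet> (p \<bullet> a) \<noteq> src G (iv a \<bullet> (p \<bullet> a))"
  proof
    assume "iv a \<bullet> (p \<bullet> a) = src G (iv a \<bullet> (p \<bullet> a))"
    hence "p \<bullet> a = a \<bullet> tgt G a" using eq_cmp_iff[of "p \<bullet> a" a "tgt G a"] by simp
    hence "p = src G p" using cancel_right[of a p "src G p"] by simp
    thus False using vprime_not_id by simp
  qed
  fix x assume x: "x \<in> verts \<inter> I" "src G x = src G (iv a \<bullet> (p \<bullet> a))" "iv a \<bullet> (p \<bullet> a) \<preceq> x"
  \<comment> \<open>Conjugating back reduces the claim to the maximality of
    \<open>p\<close>.\<close>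
  define y where "y = a \<bullet> (x \<bullet> iv a)"
  have x': "x \<in> verts" "x \<in> I" "src G x = tgt G a"
    using x by auto
  have y: "y \<in> verts" "src G y = src G p"
    using x' unfolding y_def by (auto intro!: vertsI)
  have yI: "y \<in> I"
    using conj_integral[of x "iv a"] x' by (simp add: y_def)
  have xy: "x = iv a \<bullet> (y \<bullet> a)"
    using x' unfolding y_def by simp
  have "p \<preceq> y"
  proof -
    have "iv (iv a) \<bullet> ((iv a \<bullet> (p \<bullet> a)) \<bullet> iv a) \<preceq> iv (iv a) \<bullet> (x \<bullet> iv a)"
      by (rule conj_mono[OF x(3)]) (use x' in auto)
    thus ?thesis by (simp add: y_def)
  qed
  hence "y = p \<or> y = src G p" using vprime_max[of p y] y yI by simp
  thus "x = iv a \<bullet> (p \<bullet> a) \<or> x = src G (iv a \<bullet> (p \<bullet> a))"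
    unfolding xy using y by auto
qed

section \<open>Atoms of the category of integral elements\<close>

lemma units_integral_cat: "cat_units (integral_cat G) = {a \<in> I. src G a = a}"
proof (intro equalityI subsetI)
  fix a assume "a \<in> cat_units (integral_cat G)"
  then obtain b where b: "a \<in> I" "b \<in> I" "src G b = tgt G a" "a \<bullet> b = src G a"
    by (auto simp: cat_units_def cat_inverse_def mem_hom_set)
  hence "iv a = b" by (intro iv_unique) auto
  hence "src G a = a" using b(1,2) by (intro integral_reduced) auto
  thus "a \<in> {a \<in> I. src G a = a}" using b(1) by simp
next
  fix a assume "a \<in> {a \<in> I. src G a = a}"
  hence a: "a \<in> I" "src G a = a" by auto
  moreover have "tgt G a = a" using a by (metis integral_carrier tgt_src)
  ultimately show "a \<in> cat_units (integral_cat G)"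
    by (auto simp: id_left cat_units_def cat_inverse_def mem_hom_set intro!: exI[of _ a])
qed

text \<open>The order form of an atom: a maximal integral element strictly below its source. Left
  divisors are upper bounds, so \<open>atom_iff\<close> can identify these with the atoms of
  \<open>G\<^sub>+\<close>.\<close>

definition atom :: "'a \<Rightarrow> bool"
  where "atom u \<longleftrightarrow> u \<in> I \<and> u \<noteq> src G u \<and>
    (\<forall>w \<in> I. src G w = src G u \<longrightarrow> u \<preceq> w \<longrightarrow> w = u \<or> w = src G u)"

lemma atom_integral [simp]: "atom u \<Longrightarrow> u \<in> I"
  and atom_not_id: "atom u \<Longrightarrow> u \<noteq> src G u"
  and atom_max: "\<lbrakk>atom u; w \<in> I; src G w = src G u; u \<preceq> w\<rbrakk> \<Longrightarrow> w = u \<or> w = src G u"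
  by (auto simp: atom_def)

lemma atom_carrier [simp]: "atom u \<Longrightarrow> u \<in> carrier G"
  by simp

declare cat_closure [simp del]
declare cat_closure [simp]

lemma atom_iff: "u \<in> atoms (integral_cat G) \<longleftrightarrow> atom u"
proof
  assume u: "u \<in> atoms (integral_cat G)"
  hence uI: "u \<in> I" and nu: "u \<noteq> src G u" and "\<forall>a\<in>I. \<forall>b\<in>I. tgt G a = src G b \<longrightarrow> u = a \<bullet> b
      \<longrightarrow> a \<in> cat_units (integral_cat G) \<or> b \<in> cat_units (integral_cat G)"
    unfolding atoms_def by (simp_all add: units_integral_cat) metis
  hence max: "a = src G a \<or> b = src G b" if "a \<in> I" "b \<in> I" "tgt G a = src G b" "u = a \<bullet> b" for a b
    using that unfolding units_integral_cat by fastforce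
  show "atom u"
    unfolding atom_def
  proof (intro conjI ballI impI uI nu)
    fix w assume w: "w \<in> I" "src G w = src G u" "u \<preceq> w"
    hence "w = src G w \<or> iv w \<bullet> u = src G (iv w \<bullet> u)"
      using uI le_iff_integral[of u w] by (intro max) auto
    thus "w = u \<or> w = src G u"
    proof
      assume "iv w \<bullet> u = src G (iv w \<bullet> u)"
      moreover have "src G (iv w \<bullet> u) = tgt G w" using w(1,2) uI by simp
      ultimately have "w \<bullet> (iv w \<bullet> u) = w \<bullet> tgt G w" by simp
      thus ?thesis using w(1,2) uI by simp
    qed (use w in auto)
  qed
next
  assume u: "atom u"
  have "a = src G a \<or> b = src G b" if ab: "a \<in> I" "b \<in> I" "tgt G a = src G b" "u = a \<bullet> b" for a b
  proof -
    have s: "src G a = src G u" using ab by simp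
    have "a = u \<or> a = src G u"
    proof (rule atom_max[OF u ab(1) s])
      show "u \<preceq> a" unfolding ab(4) using ab(1-3) by (intro le_left) auto
    qed
    thus ?thesis
    proof
      assume "a = u"
      hence "a \<bullet> b = a" using ab(4) by simp
      thus ?thesis using ab(1-3) by (subst (asm) cmp_eq_left_iff) auto
    next
      assume "a = src G u"
      thus ?thesis using s by simp
    qed
  qed
  thus "u \<in> atoms (integral_cat G)"
    using u atom_not_id[OF u] unfolding atoms_def units_integral_cat by (auto dest: sym)
qed

lemma atom_above:
  assumes "x \<in> I" "x \<noteq> src G x"
  shows "\<exists>u. atom u \<and> src G u = src G x \<and> x \<preceq> u"
  using assms
proof (induction x rule: integral_from_induct)
  case (step x)
  show ?case
  proof (cases "atom x")
    case False
    then obtain y where y: "y \<in> I" "src G y = src G x" "x \<preceq> y" "y \<noteq> x" "y \<noteq> src G x"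
      using step.hyps step.prems unfolding atom_def by blast
    then obtain u where "atom u" "src G u = src G y" "y \<preceq> u"
      using step.IH[of y] by auto
    thus ?thesis using y step.hyps by - (rule exI[of _ u], (auto intro: le_trans[of x y u]))
  qed (use step in auto)
qed

lemma integral_atom_induct [consumes 1, case_names identity atom]:
  assumes "a \<in> I"
    and id: "\<And>e. e \<in> carrier G \<Longrightarrow> src G e = e \<Longrightarrow> tgt G e = e \<Longrightarrow> P e"
    and atom: "\<And>u b. \<lbrakk>atom u; b \<in> I; tgt G u = src G b; P b\<rbrakk> \<Longrightarrow> P (u \<bullet> b)"
  shows "P a"
  using assms(1)
proof (induction a rule: integral_into_induct)
  case (step a)
  show ?case
  proof (cases "a = src G a")
    case True
    thus ?thesis using id step by (metis integral_carrier tgt_src)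
  next
    case False
    then obtain u where u: "atom u" "src G u = src G a" "a \<preceq> u"
      using atom_above[of a] step by auto
    then obtain b where b: "b \<in> I" "tgt G u = src G b" "a = u \<bullet> b"
      using le_imp_ex[of a u] step by auto
    have "a \<preceq> b" unfolding b(3) using u(1) b(1,2) by (intro le_right) auto
    moreover have "a \<noteq> b"
      unfolding b(3) using u(1) b(1,2) atom_not_id[of u] cmp_eq_right_iff[of u b] by simp
    moreover have "tgt G b = tgt G a"
      unfolding b(3) using u(1) b(1,2) by simp
    ultimately have "P b"
      using step.IH[of b] b(1) by simp
    thus ?thesis unfolding b(3) using atom[OF u(1) b(1,2)] by simp
  qed
qed

text \<open>
  For an ideal \<open>u\<close> this is the annihilator of the quotient of its order by \<open>u\<close>, and
  \<open>bound_vprime\<close> says that the annihilator of a simple module is a maximal two-sided ideal.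
\<close>

definition bound :: "'a \<Rightarrow> 'a"
  where "bound u = \<Squnion>\<^bsub>ord_from G (src G u)\<^esub> {x \<in> hom_set G (src G u) (src G u). x \<preceq> u}"

lemma
  assumes u: "u \<in> I"
  shows bound_verts [simp]: "bound u \<in> verts"
    and src_bound [simp]: "src G (bound u) = src G u"
    and bound_le: "bound u \<preceq> u"
    and le_bound: "\<lbrakk>x \<in> verts; src G x = src G u; x \<preceq> u\<rbrakk> \<Longrightarrow> x \<preceq> bound u"
proof -
  let ?e = "src G u"
  let ?L = "ord_from G ?e" and ?R = "ord_into G ?e"
  define M where "M = {x \<in> hom_set G ?e ?e. x \<preceq> u}"
  \<comment> \<open>An integral arrow back to the source turns \<open>u\<close> into a loop
    \<open>u \<bullet> c\<close> below \<open>u\<close>, so the set whose supremum is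
    \<open>bound u\<close> is not empty.\<close>
  obtain c where c: "c \<in> I" "src G c = tgt G u" "tgt G c = ?e"
    using P5[of "tgt G u" ?e] u by (auto simp: mem_hom_set)
  have ne: "M \<noteq> {}"
    using c u le_left[of u c] by (auto simp: M_def mem_hom_set intro!: exI[of _ "u \<bullet> c"])
  have M: "M \<subseteq> hom_set G ?e ?e \<inter> I"
    using u integral_mono[of _ u] by (auto simp: M_def mem_hom_set)
  have M1: "M \<subseteq> from_obj G ?e \<inter> I" and M2: "M \<subseteq> into_obj G ?e \<inter> I"
    using M by (auto simp: hom_set_def)
  have lub: "least ?L (bound u) (Upper ?L M)"
    using someI_ex[OF P4_from[OF _ M1 ne]] u unfolding bound_def sup_def M_def[symmetric] by simp
  \<comment> \<open>The same supremum, formed among the elements with fixed target, shows that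
    \<open>bound u\<close> is again a loop.\<close>
  have "least ?R (\<Squnion>\<^bsub>?R\<^esub> M) (Upper ?R M)"
    using someI_ex[OF P4_into[OF _ M2 ne]] u unfolding sup_def by simp
  moreover have "\<Squnion>\<^bsub>?R\<^esub> M = bound u"
    using P4_agree[OF _ _ M ne] u by (simp add: bound_def M_def)
  ultimately have "bound u \<in> into_obj G ?e"
    by (auto simp: least_def Upper_def ord_on_def)
  thus v: "bound u \<in> verts" and s: "src G (bound u) = src G u"
    using lub by (auto simp: least_def Upper_def ord_on_def from_obj_def into_obj_def intro!: vertsI)
  show "bound u \<preceq> u"
    using lub u by (auto simp: least_def Upper_def ord_on_def M_def mem_hom_set from_obj_def)
  show "x \<preceq> bound u" if "x \<in> verts" "src G x = src G u" "x \<preceq> u"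
    using lub that by (auto simp: least_def Upper_def ord_on_def M_def mem_hom_set from_obj_def)
qed

lemma bound_integral [simp]: "u \<in> I \<Longrightarrow> bound u \<in> I"
  by (rule integral_mono[of _ u]) (auto intro: bound_le)

lemma atom_jn:
  assumes "atom u" "w \<in> I" "src G w = src G u" "\<not> w \<preceq> u"
  shows "jn w u = src G u"
proof -
  have "jn w u = u \<or> jn w u = src G u"
    using assms by (intro atom_max) (auto intro: jn_integral)
  moreover have "jn w u \<noteq> u"
  proof
    assume "jn w u = u"
    moreover have "w \<preceq> jn w u" using assms(1-3) by (intro jn_left) auto
    ultimately show False using assms(4) by simp
  qed
  ultimately show ?thesis by simp
qed

lemma bound_vprime:
  assumes u: "atom u"
  shows "vprime (bound u)"
  unfolding vprime_def
proof (intro conjI ballI impI)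
  let ?P = "bound u"
  note [simp] = u
  show "?P \<in> verts \<inter> I" by simp
  show "?P \<noteq> src G ?P"
  proof
    assume "?P = src G ?P"
    hence "src G u \<preceq> u" using bound_le[of u] by simp
    thus False using le_src_eq[of u] atom_not_id[OF u] by simp
  qed
  fix Q assume Q': "Q \<in> verts \<inter> I" "src G Q = src G ?P" "?P \<preceq> Q"
  hence Q[simp]: "Q \<in> verts" "Q \<in> I" "src G Q = src G u" by auto
  show "Q = ?P \<or> Q = src G ?P"
  proof (cases "Q \<preceq> u")
    case True
    hence "Q \<preceq> ?P" by (intro le_bound) auto
    thus ?thesis using Q' by (auto intro: le_antisym)
  next
    case False
    \<comment> \<open>Here \<open>Q\<close> and \<open>u\<close> have the identity as join.
      Multiplied by \<open>R\<close>, this makes \<open>R\<close> the join of \<open>?P\<close> and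
      \<open>R \<bullet> u\<close>, both below \<open>u\<close>. Hence
      \<open>R \<preceq> ?P = Q \<bullet> R\<close>, and cancelling \<open>R\<close> leaves the
      identity below \<open>Q\<close>.\<close>
    define R where "R = iv Q \<bullet> ?P"
    have R[simp]: "R \<in> I" "R \<in> verts" "src G R = src G u"
      using Q'(3) le_iff_integral[of ?P Q] by (auto simp: R_def)
    have QR: "Q \<bullet> R = ?P" "R \<bullet> Q = ?P"
      using vertex_commute[of R Q] by (simp_all add: R_def)
    have "R = jn (R \<bullet> Q) (R \<bullet> u)"
      using lmult_jn[of Q u R] atom_jn[OF u _ _ False] by simp
    also have "\<dots> \<preceq> u"
      using QR bound_le[of u] by (intro jn_least) (auto intro: le_right)
    finally have "R \<preceq> ?P" by (intro le_bound) auto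
    hence "src G u \<bullet> R \<preceq> Q \<bullet> R" using QR by simp
    hence "src G u \<preceq> Q"
      by (subst (asm) rmult_iff) auto
    thus ?thesis using le_src_eq[of Q] by simp
  qed
qed

lemma bound_eqI:
  assumes "atom u" "vprime p" "src G p = src G u" "p \<preceq> u"
  shows "bound u = p"
  using vprime_max[of p "bound u"] le_bound[of u p] vprime_not_id[OF bound_vprime, of u] assms by auto

text \<open>The cofactor \<open>v\<close> is an atom by modularity. Its bound is found without
  computation: \<open>bound w \<bullet> u\<close> lies below both \<open>u\<close> and
  \<open>w\<close>, hence below \<open>u \<bullet> v\<close>, so the conjugate of
  \<open>bound w\<close> by \<open>u\<close> lies below \<open>v\<close>, and maximality makes it
  equal to \<open>bound v\<close>.\<close>

lemma diamond:
  assumes u: "atom u" and w: "atom w" and uw: "src G u = src G w" "u \<noteq> w"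
  shows "\<exists>v x. atom v \<and> atom x \<and> tgt G u = src G v \<and> tgt G w = src G x \<and> mt u w = u \<bullet> v \<and> mt u w = w \<bullet> x
    \<and> bound x = iv w \<bullet> (bound u \<bullet> w) \<and> bound v = iv u \<bullet> (bound w \<bullet> u)"
proof -
  have *: "\<exists>v. atom v \<and> tgt G u = src G v \<and> mt u w = u \<bullet> v \<and> bound v = iv u \<bullet> (bound w \<bullet> u)"
    if u[simp]: "atom u" and w[simp]: "atom w" and uw[simp]: "src G w = src G u" and ne: "u \<noteq> w" for u w
  proof -
    have nle: "\<not> u \<preceq> w"
      using atom_max[of u w] ne atom_not_id[OF w] by auto
    obtain v where v[simp]: "v \<in> I" "src G v = tgt G u" and m: "mt u w = u \<bullet> v"
      using le_imp_ex[of "mt u w" u] by auto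
    have at: "atom v"
      unfolding atom_def
    proof (intro conjI ballI impI)
      show "v \<in> I" by simp
      show "v \<noteq> src G v"
      proof
        assume "v = src G v"
        hence "mt u w = u" using m by simp
        thus False using nle mt_right[of u w] by simp
      qed
      fix y assume y[simp]: "y \<in> I" "src G y = src G v" and vy: "v \<preceq> y"
      define z where "z = u \<bullet> y"
      have z[simp]: "z \<in> I" "src G z = src G u" by (auto simp: z_def)
      have mz: "mt u w \<preceq> z" unfolding m z_def by (intro lmult vy) auto
      have zu: "z \<preceq> u" unfolding z_def by (intro le_left) auto
      show "y = v \<or> y = src G v"
      proof (cases "z \<preceq> w")
        case True
        hence "z \<preceq> mt u w" using zu by (intro mt_greatest) auto
        hence "z = mt u w" using mz by - (rule le_antisym, auto)
        hence "u \<bullet> y = u \<bullet> v" unfolding z_def m .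
        hence "y = v" by (rule iffD1[OF cancel_left, rotated -1]) auto
        thus ?thesis ..
      next
        case False
        \<comment> \<open>An element between \<open>mt u w\<close> and \<open>u\<close> that is not
          below \<open>w\<close> has the identity as join with \<open>w\<close>; the modular law
          then collapses it to \<open>u\<close>.\<close>
        have "z = jn z (mt w u)"
          using mz mt_comm[of u w] by (intro le_antisym[OF _ _ _ jn_left jn_least]) auto
        also have "\<dots> = mt (jn z w) u" using zu by (intro modular_law) auto
        also have "\<dots> = mt (src G u) u" using atom_jn[of w z] False by simp
        also have "\<dots> = u"
          using le_iff_mt[of u "src G u"] mt_comm[of u "src G u"] by (simp add: integral_le_src)
        finally have "u \<bullet> y = u" by (simp add: z_def)
        thus ?thesis by (subst (asm) cmp_eq_left_iff) auto
      qed
    qed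
    have "bound w \<bullet> u \<preceq> mt u w"
    proof (rule mt_greatest)
      have "bound w \<bullet> u \<preceq> bound w" by (intro le_left) auto
      thus "bound w \<bullet> u \<preceq> w" by (rule le_trans) (auto intro: bound_le)
    qed (auto intro: le_right)
    hence "bound w \<bullet> u \<preceq> u \<bullet> v" unfolding m .
    hence "bound v = iv u \<bullet> (bound w \<bullet> u)"
      using at by (intro bound_eqI vprime_conj bound_vprime) (auto simp: le_cmp_iff)
    thus ?thesis using at m by auto
  qed
  show ?thesis
    using *[of u w] *[of w u] assms mt_comm[of u w] by metis
qed

section \<open>Norms of atoms and the exchange of neighbours\<close>

lemma vertex_class_conj:
  assumes "x \<in> verts" "a \<in> carrier G" "src G a = src G x"
  shows "vertex_class G (iv a \<bullet> (x \<bullet> a)) = vertex_class G x"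
proof -
  have 1: "vertex_class G (iv a \<bullet> (x \<bullet> a)) \<subseteq> vertex_class G x"
    if xa: "x \<in> verts" "a \<in> carrier G" "src G a = src G x" for x a
  proof
    fix y assume "y \<in> vertex_class G (iv a \<bullet> (x \<bullet> a))"
    then obtain b where b: "b \<in> carrier G" "src G b = tgt G a" and y: "y = iv b \<bullet> (iv a \<bullet> (x \<bullet> a)) \<bullet> b"
      using xa unfolding vertex_class_def from_obj_def by auto
    have "y = iv (a \<bullet> b) \<bullet> x \<bullet> (a \<bullet> b)"
      unfolding y using b xa by simp
    moreover have "a \<bullet> b \<in> from_obj G (src G x)"
      using b xa by (simp add: from_obj_def)
    ultimately show "y \<in> vertex_class G x"
      unfolding vertex_class_def by blast
  qed
  show ?thesis
    using 1[OF assms] 1[of "iv a \<bullet> (x \<bullet> a)" "iv a"] assms by auto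
qed

lemma vertex_class_eq_iff:
  assumes "x \<in> verts" "y \<in> verts" "a \<in> carrier G" "src G a = src G x" "tgt G a = src G y"
  shows "vertex_class G x = vertex_class G y \<longleftrightarrow> y = iv a \<bullet> (x \<bullet> a)"
proof
  assume *: "vertex_class G x = vertex_class G y"
  have "y \<in> vertex_class G y"
    unfolding vertex_class_def from_obj_def
    by (rule CollectI, rule exI[of _ "src G y"]) (use assms(2) in simp)
  hence "y \<in> vertex_class G x" using * by simp
  then obtain b where b: "b \<in> carrier G" "src G b = src G x" "y = iv b \<bullet> (x \<bullet> b)"
    using assms by (auto simp: vertex_class_def from_obj_def)
  have "tgt G a = tgt G b" using b(1,2) assms(1,5) unfolding b(3) by simp
  thus "y = iv a \<bullet> (x \<bullet> a)" unfolding b(3) using b(1,2) assms(1,3,4) by (intro conj_eq) auto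
qed (use vertex_class_conj assms in auto)

definition anorm :: "'a \<Rightarrow> 'a set" where "anorm u = vertex_class G (bound u)"

text \<open>\<open>Q\<close> is \<open>bound v\<close> transported to the source of
  \<open>u\<close>, and \<open>P\<close> is \<open>bound u\<close>. If \<open>Q\<close> and
  \<open>u \<bullet> v\<close> had the identity as join, multiplying by \<open>P\<close> would give
  \<open>P \<preceq> u \<bullet> v\<close>, because \<open>P \<bullet> Q = Q \<bullet> P \<preceq> Q
  \<bullet> u = u \<bullet> bound v\<close>. This would force equal norms. So some atom
  \<open>u'\<close> lies above that join; it has the norm of \<open>v\<close>, and the diamond of
  \<open>u\<close> and \<open>u'\<close> supplies \<open>v'\<close>.\<close>

lemma exchange:
  assumes u[simp]: "atom u" and v[simp]: "atom v" and uv[simp]: "tgt G u = src G v" and ne: "anorm u \<noteq> anorm v"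
  shows "\<exists>u' v'. atom u' \<and> atom v' \<and> tgt G u' = src G v' \<and> u \<bullet> v = u' \<bullet> v' \<and> anorm u' = anorm v \<and> anorm v' = anorm u"
proof -
  define P where "P = bound u"
  define Q where "Q = u \<bullet> (bound v \<bullet> iv u)"
  have P[simp]: "vprime P" "src G P = src G u" and Pu: "P \<preceq> u"
    by (auto simp: P_def bound_vprime bound_le)
  have Q: "Q = iv (iv u) \<bullet> (bound v \<bullet> iv u)" by (simp add: Q_def)
  have [simp]: "vprime Q" unfolding Q by (intro vprime_conj bound_vprime) auto
  have [simp]: "src G Q = src G u" unfolding Q by simp
  have Qc: "vertex_class G Q = anorm v" unfolding Q anorm_def by (rule vertex_class_conj) auto
  define z where "z = jn Q (u \<bullet> v)"
  have z[simp]: "z \<in> I" "src G z = src G u" by (auto simp: z_def intro!: jn_integral)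
  have "z \<noteq> src G z"
  proof
    assume e: "z = src G z"
    have "P = P \<bullet> z" using e by simp
    also have "P \<bullet> z = jn (P \<bullet> Q) (P \<bullet> (u \<bullet> v))" unfolding z_def by (rule lmult_jn) auto
    also have "\<dots> \<preceq> u \<bullet> v"
    proof (rule jn_least)
      have "P \<bullet> Q = Q \<bullet> P" by (rule vertex_commute) auto
      also have "\<dots> \<preceq> Q \<bullet> u" by (intro lmult Pu) auto
      also have "Q \<bullet> u = u \<bullet> bound v" by (simp add: Q_def)
      finally have "P \<bullet> Q \<preceq> u \<bullet> bound v" .
      thus "P \<bullet> Q \<preceq> u \<bullet> v" by (rule le_trans) (auto intro!: lmult bound_le)
      show "P \<bullet> (u \<bullet> v) \<preceq> u \<bullet> v" by (intro le_right) auto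
    qed auto
    finally have "P \<preceq> u \<bullet> v" .
    moreover have "P \<bullet> u \<preceq> P" by (intro le_left) auto
    ultimately have "P \<bullet> u \<preceq> u \<bullet> v" by - (rule le_trans[of "P \<bullet> u" P], auto)
    hence "iv u \<bullet> (P \<bullet> u) \<preceq> v" by (subst (asm) le_cmp_iff) auto
    hence "bound v = iv u \<bullet> (P \<bullet> u)" by (intro bound_eqI vprime_conj) auto
    hence "anorm u = anorm v" using vertex_class_conj[of P u] by (simp add: anorm_def P_def)
    thus False using ne by simp
  qed
  then obtain u' where u'[simp]: "atom u'" "src G u' = src G u" and zu: "z \<preceq> u'"
    using atom_above[of z] by auto
  have "Q \<preceq> u'" by (rule le_trans[of _ z]) (auto simp: z_def intro: zu[unfolded z_def])
  hence "bound u' = Q" by (intro bound_eqI) auto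
  hence anorm': "anorm u' = anorm v" using Qc by (simp add: anorm_def)
  have uvu: "u \<bullet> v \<preceq> u'" by (rule le_trans[of _ z]) (auto simp: z_def intro: zu[unfolded z_def])
  have "u \<noteq> u'" using anorm' ne by auto
  then obtain y x where yx[simp]: "atom y" "atom x" "src G y = tgt G u" "tgt G u' = src G x"
      and m: "mt u u' = u \<bullet> y" "mt u u' = u' \<bullet> x" and bx: "bound x = iv u' \<bullet> (bound u \<bullet> u')"
    using diamond[of u u'] by auto
  have "u \<bullet> v \<preceq> mt u u'" using uvu by (intro mt_greatest) (auto intro: le_left)
  hence "v \<preceq> y" unfolding m(1) by (subst (asm) lmult_iff) auto
  hence "y = v" using atom_max[of v y] atom_not_id[of y] by auto
  hence "u \<bullet> v = u' \<bullet> x" using m by simp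
  moreover have "anorm x = anorm u" unfolding anorm_def bx by (rule vertex_class_conj) auto
  ultimately show ?thesis using anorm' by - (rule exI[of _ u'], rule exI[of _ x], auto)
qed

text \<open>The bound of \<open>u\<close> is conjugated along an arrow to \<open>f\<close>; any atom
  above the result has it as its bound. Thus every norm of an atom occurs at every vertex.\<close>

lemma atom_transport:
  assumes "atom u" "f \<in> identities G"
  shows "\<exists>v. atom v \<and> src G v = f \<and> anorm v = anorm u"
proof -
  have f[simp]: "f \<in> carrier G" "src G f = f" "tgt G f = f" using assms(2) by (auto simp: identity_iff)
  obtain a where "a \<in> hom_set G (src G u) f"
    using P5[of "src G u" f] assms by auto
  hence a[simp]: "a \<in> carrier G" "src G a = src G u" "tgt G a = f"
    by (auto simp: mem_hom_set)
  define p where "p = iv a \<bullet> (bound u \<bullet> a)"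
  have p: "vprime p" "src G p = f" "vertex_class G p = anorm u"
    using assms vprime_conj[of "bound u" a] vertex_class_conj[of "bound u" a] by (auto simp: p_def bound_vprime anorm_def)
  then obtain v where v: "atom v" "src G v = f" "p \<preceq> v"
    using atom_above[of p] vprime_not_id[of p] by auto
  hence "bound v = p" using p by (intro bound_eqI) auto
  thus ?thesis using v p by (auto simp: anorm_def)
qed

section \<open>The norms of an integral element\<close>

lemma anorm_conj: "\<lbrakk>x \<in> I; w \<in> I; a \<in> carrier G; src G a = src G w; bound x = iv a \<bullet> (bound w \<bullet> a)\<rbrakk> \<Longrightarrow> anorm x = anorm w"
  by (simp add: anorm_def vertex_class_conj)

lemma mt_src_left: "a \<in> I \<Longrightarrow> src G a = e \<Longrightarrow> mt e a = a"
  using le_iff_mt[of a "src G a"] mt_comm[of a "src G a"] integral_le_src[of a] by auto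

lemma atom_cmp_not_id: 
  assumes "atom u" "b \<in> I" "tgt G u = src G b"
  shows "src G (u \<bullet> b) \<noteq> u \<bullet> b"
proof
  assume *: "src G (u \<bullet> b) = u \<bullet> b"
  have "u \<bullet> b \<preceq> u" using assms by (intro le_left) auto
  hence "src G u \<preceq> u" using * assms by simp
  thus False using le_src_eq[of u] atom_not_id[OF assms(1)] assms by simp
qed

text \<open>A relation and not yet a function: that all factorizations of an element give the same
  multiset is the content of \<open>norm_mset_unique\<close>.\<close>

inductive norm_mset :: "'a \<Rightarrow> 'a set multiset \<Rightarrow> bool" where
  identity: "\<lbrakk>e \<in> carrier G; src G e = e\<rbrakk> \<Longrightarrow> norm_mset e {#}"
| cmp: "\<lbrakk>atom u; b \<in> I; tgt G u = src G b; norm_mset b M\<rbrakk> \<Longrightarrow> norm_mset (u \<bullet> b) (add_mset (anorm u) M)"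

lemma norm_mset_exists: "a \<in> I \<Longrightarrow> \<exists>M. norm_mset a M"
  by (induction a rule: integral_atom_induct) (auto intro: norm_mset.intros)

text \<open>Two factorizations with distinct first atoms \<open>u\<close> and \<open>w\<close> are
  compared through a third and a fourth one, which pass through \<open>mt u w\<close> and agree from
  there on. The norms of the two upper sides of the diamond are those of the opposite lower
  sides.\<close>

lemma norm_mset_unique: "norm_mset a M \<Longrightarrow> norm_mset a N \<Longrightarrow> M = N"
proof (induction "size M" arbitrary: a M N rule: less_induct)
  case less
  from less.prems(1) show ?case
  proof cases
    case identity
    from less.prems(2) show ?thesis
    proof cases
      case (cmp u b N')
      thus ?thesis using identity atom_cmp_not_id[of u b] by simp
    qed (use identity in auto)
  next
    case u: (cmp u b M')
    from less.prems(2) show ?thesis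
    proof cases
      case identity
      thus ?thesis using u atom_cmp_not_id[of u b] by simp
    next
      case w: (cmp w b' N')
      have eq: "u \<bullet> b = w \<bullet> b'" using u(1) w(1) by simp
      have s: "src G u = src G w" using arg_cong[OF eq, of "src G"] u(3-5) w(3-5) by simp
      show ?thesis
      proof (cases "u = w")
        case True
        have "b = b'" by (rule iffD1[OF cancel_left, of u]) (use eq True u(3-5) w(3-5) in auto)
        hence "M' = N'" using less.hyps[of M' b N'] u(2,6) w(6) by simp
        thus ?thesis using u(2) w(2) True by simp
      next
        case False
        obtain v x where vx: "atom v" "atom x" "tgt G u = src G v" "tgt G w = src G x"
          and m: "mt u w = u \<bullet> v" "mt u w = w \<bullet> x"
          and bound: "bound x = iv w \<bullet> (bound u \<bullet> w)" "bound v = iv u \<bullet> (bound w \<bullet> u)"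
          using diamond[OF u(3) w(3) s False] by blast
        have anorm: "anorm x = anorm u" "anorm v = anorm w"
          using anorm_conj[OF _ _ _ _ bound(1)] anorm_conj[OF _ _ _ _ bound(2)] u(3) w(3) vx(1,2) s by simp_all
        have "u \<bullet> b \<preceq> mt u w"
        proof (rule mt_greatest)
          show "u \<bullet> b \<preceq> u" using u(3-5) by (intro le_left) auto
          show "u \<bullet> b \<preceq> w" unfolding eq using w(3-5) by (intro le_left) auto
        qed (use u(3-5) w(3) s in auto)
        then obtain c where c: "c \<in> I" "tgt G (mt u w) = src G c" "u \<bullet> b = mt u w \<bullet> c"
          using le_imp_ex[of "u \<bullet> b" "mt u w"] u(3-5) w(3) s by auto
        have tv: "tgt G v = src G c" using c(2) vx u(3) unfolding m(1) by simp
        have tx: "tgt G x = src G c" using c(2) vx w(3) unfolding m(2) by simp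
        have b: "b = v \<bullet> c"
          by (rule iffD1[OF cancel_left, of u]) (use c vx tv u(3-5) m(1) in auto)
        have b': "b' = x \<bullet> c"
          by (rule iffD1[OF cancel_left, of w]) (use c vx tx w(3-5) m(2) eq in auto)
        obtain K where K: "norm_mset c K" using norm_mset_exists[OF c(1)] by auto
        have "norm_mset b (add_mset (anorm v) K)" unfolding b using vx c(1) tv K by (intro norm_mset.cmp) auto
        hence M': "M' = add_mset (anorm v) K" using less.hyps[of M' b] u(2,6) by simp
        have "norm_mset b' (add_mset (anorm x) K)" unfolding b' using vx c(1) tx K by (intro norm_mset.cmp) auto
        \<comment> \<open>The induction runs on the size of the first multiset. The multiset at
          \<open>b'\<close> that comes from the diamond is put first, because its size is that of
          \<open>M'\<close>, whereas the size of \<open>N'\<close> is still unknown.\<close>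
        hence N': "N' = add_mset (anorm x) K"
          using less.hyps[of "add_mset (anorm x) K" b' N'] u(2) w(6) M' by simp
        show ?thesis using u(2) w(2) M' N' anorm by simp
      qed
    qed
  qed
qed

definition norms :: "'a \<Rightarrow> 'a set multiset" where "norms a = (THE M. norm_mset a M)"

lemma norms_eqI: "norm_mset a M \<Longrightarrow> norms a = M"
  unfolding norms_def using norm_mset_unique by blast

lemma norm_mset_norms: "a \<in> I \<Longrightarrow> norm_mset a (norms a)"
  using norm_mset_exists norms_eqI by blast

lemma norms_src [simp]: "a \<in> carrier G \<Longrightarrow> norms (src G a) = {#}"
  and norms_tgt [simp]: "a \<in> carrier G \<Longrightarrow> norms (tgt G a) = {#}"
  by (auto intro!: norms_eqI norm_mset.identity)

lemma norms_atom_cmp: "\<lbrakk>atom u; b \<in> I; tgt G u = src G b\<rbrakk> \<Longrightarrow> norms (u \<bullet> b) = add_mset (anorm u) (norms b)"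
  by (intro norms_eqI norm_mset.cmp norm_mset_norms)

lemma norms_atom [simp]: "atom u \<Longrightarrow> norms u = {#anorm u#}"
  using norms_atom_cmp[of u "tgt G u"] by simp

lemma norms_cmp: "\<lbrakk>a \<in> I; b \<in> I; tgt G a = src G b\<rbrakk> \<Longrightarrow> norms (a \<bullet> b) = norms a + norms b"
proof (induction a rule: integral_atom_induct)
  case (identity e)
  have "norms e = {#}" using norms_src[of e] identity by simp
  thus ?case using identity id_left[of b e] by simp
next
  case (atom u c)
  thus ?case by (simp add: norms_atom_cmp)
qed

lemma norms_empty: "\<lbrakk>a \<in> I; norms a = {#}\<rbrakk> \<Longrightarrow> src G a = a"
  using norm_mset_norms[of a] by (auto elim: norm_mset.cases)

lemma norms_pull:
  assumes "a \<in> I" "g \<in># norms a"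
  shows "\<exists>u b. atom u \<and> b \<in> I \<and> tgt G u = src G b \<and> a = u \<bullet> b \<and> anorm u = g"
  using assms
proof (induction a rule: integral_atom_induct)
  case (identity e)
  thus ?case using norms_src[of e] by simp
next
  case (atom u b)
  show ?case
  proof (cases "anorm u = g")
    case False
    hence "g \<in># norms b" using atom.prems atom.hyps by (simp add: norms_atom_cmp)
    then obtain v c where v: "atom v" "c \<in> I" "tgt G v = src G c" "b = v \<bullet> c" "anorm v = g"
      using atom.IH by blast
    have "tgt G u = src G v" using atom.hyps(3) v by simp
    then obtain u' v' where w: "atom u'" "atom v'" "tgt G u' = src G v'" "u \<bullet> v = u' \<bullet> v'" "anorm u' = anorm v"
      using exchange[of u v] atom.hyps v False by blast
    have t: "tgt G v' = src G c"
      using arg_cong[OF w(4), of "tgt G"] w(1-3) v(1-3) atom.hyps(1) \<open>tgt G u = src G v\<close> by simp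
    have "u \<bullet> b = (u \<bullet> v) \<bullet> c" unfolding v(4) using v(1-3) atom.hyps(1) \<open>tgt G u = src G v\<close> by simp
    also have "\<dots> = u' \<bullet> (v' \<bullet> c)" unfolding w(4) using w(1-3) t v(2) by simp
    finally have "u \<bullet> b = u' \<bullet> (v' \<bullet> c)" .
    moreover have "v' \<bullet> c \<in> I" "tgt G u' = src G (v' \<bullet> c)" using w(1-3) t v(2) by auto
    ultimately show ?thesis using w(1,5) v(5) by blast
  qed (use atom in blast)
qed

lemma norms_split:
  assumes "a \<in> I" "norms a = A + B"
  shows "\<exists>b c. b \<in> I \<and> c \<in> I \<and> tgt G b = src G c \<and> a = b \<bullet> c \<and> norms b = A \<and> norms c = B"
  using assms
proof (induction A arbitrary: a)
  case empty
  thus ?case by - (rule exI[of _ "src G a"], rule exI[of _ a], simp)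
next
  case (add g A)
  obtain u b where u: "atom u" "b \<in> I" "tgt G u = src G b" "a = u \<bullet> b" "anorm u = g"
    using norms_pull[of a g] add.prems by auto
  have "norms b = A + B" using add.prems(2) u(1-3,5) unfolding u(4) by (simp add: norms_atom_cmp)
  then obtain c d where c: "c \<in> I" "d \<in> I" "tgt G c = src G d" "b = c \<bullet> d" "norms c = A" "norms d = B"
    using add.IH[of b] u(2) by blast
  have t: "tgt G u = src G c" using u(3) c(1-3) unfolding c(4) by simp
  have "u \<bullet> c \<in> I" "tgt G (u \<bullet> c) = src G d" "a = (u \<bullet> c) \<bullet> d" "norms (u \<bullet> c) = add_mset g A"
    unfolding u(4) c(4) using u(1,5) c t by (auto simp: norms_atom_cmp)
  thus ?case using c by blast
qed

section \<open>Perspective intervals\<close>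

lemma jn_mono_src:
  assumes "u \<in> I" "g \<in> I" "g' \<in> I" "src G g = src G u" "src G g' = src G u" "g \<preceq> g'" "jn u g = src G u"
  shows "jn u g' = src G u"
proof (rule le_antisym)
  show "jn u g' \<preceq> src G u" using assms by (intro jn_least) (auto intro: integral_le_src)
  have "g \<preceq> jn u g'" using assms by (intro le_trans[OF assms(6)] jn_right) auto
  hence "jn u g \<preceq> jn u g'" using assms(1-5) by (intro jn_least) auto
  thus "src G u \<preceq> jn u g'" using assms(7) by simp
qed (use assms in auto)

lemma mt_absorb:
  assumes "g \<in> carrier G" "u \<in> carrier G" "h \<in> carrier G" "src G u = src G g" "src G h = src G g" "g \<preceq> u"
  shows "mt g (mt u h) = mt g h"
proof (rule le_antisym)
  have "mt g (mt u h) \<preceq> mt u h" using assms(1-5) by (intro mt_right) auto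
  hence "mt g (mt u h) \<preceq> h" using assms(1-5) by - (rule le_trans[of _ "mt u h"], auto)
  thus "mt g (mt u h) \<preceq> mt g h" using assms(1-5) by (intro mt_greatest) auto
  have "mt g h \<preceq> u" using assms by - (rule le_trans[of _ g], auto)
  thus "mt g h \<preceq> mt g (mt u h)" using assms(1-5) by (intro mt_greatest) auto
qed (use assms in auto)

text \<open>By the modular law \<open>q \<bullet> jn x k\<close> is the join of
  \<open>q \<bullet> k\<close> with \<open>mt u q\<close>, which is the meet of \<open>q\<close>
  with the join of \<open>q \<bullet> k\<close> and \<open>u\<close>, that is \<open>q\<close>. So
  the join condition survives the removal of the first factor \<open>q\<close>, with
  \<open>u\<close> replaced by \<open>x\<close>.\<close>

lemma complement_shift:
  assumes "q \<in> I" "k \<in> I" "tgt G q = src G k" "u \<in> I" "src G u = src G q" "jn u (q \<bullet> k) = src G u"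
    "x \<in> carrier G" "src G x = src G k" "mt u q = q \<bullet> x"
  shows "jn x k = src G k"
proof -
  have "q \<bullet> jn x k = jn (q \<bullet> x) (q \<bullet> k)" using assms(1-3,7,8) by (intro lmult_jn) auto
  also have "\<dots> = jn (q \<bullet> k) (mt u q)" using assms(1-3,7,8) by (subst jn_comm) (auto simp: assms(9))
  also have "\<dots> = mt (jn (q \<bullet> k) u) q" using assms(1-5) by (intro modular_law) (auto intro: le_left)
  also have "jn (q \<bullet> k) u = src G u" using assms(1-6) by (subst jn_comm) auto
  also have "mt (src G u) q = q" using assms(1,5) by (intro mt_src_left) auto
  finally have "q \<bullet> jn x k = q \<bullet> src G k" using assms(1-3) by simp
  thus ?thesis using assms(1-3,7,8) by (subst (asm) cancel_left) auto
qed

text \<open>As \<open>q \<bullet> k\<close> lies below \<open>q\<close>, its meet with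
  \<open>u\<close> is its meet with \<open>mt u q\<close>, and \<open>q\<close> can be taken
  out.\<close>

lemma mt_shift:
  assumes "q \<in> I" "k \<in> I" "tgt G q = src G k" "u \<in> I" "src G u = src G q"
    "x \<in> carrier G" "src G x = src G k" "mt u q = q \<bullet> x"
  shows "mt u (q \<bullet> k) = q \<bullet> mt x k"
proof -
  have "q \<bullet> mt x k = mt (q \<bullet> x) (q \<bullet> k)" using assms(1-3,6,7) by (intro lmult_mt) auto
  also have "\<dots> = mt (q \<bullet> k) (mt q u)" using assms(1-7) by (subst mt_comm) (auto simp: assms(8)[symmetric] mt_comm)
  also have "\<dots> = mt (q \<bullet> k) u" using assms(1-5) by (intro mt_absorb) (auto intro: le_left)
  also have "\<dots> = mt u (q \<bullet> k)" using assms(1-5) by (intro mt_comm) auto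
  finally show ?thesis by simp
qed

text \<open>The atom \<open>u\<close> is carried through the factors of \<open>g\<close>. The
  diamond at a factor \<open>q\<close> replaces \<open>u\<close> by the opposite side
  \<open>x\<close>, with which the induction continues, and contributes an atom \<open>v\<close>
  with the norm of \<open>q\<close>.\<close>

lemma norms_transpose_atom:
  assumes "g \<in> I" "atom u" "src G g = src G u" "jn u g = src G u"
  shows "norms (iv u \<bullet> mt u g) = norms g"
  using assms
proof (induction g arbitrary: u rule: integral_atom_induct)
  case (identity e)
  have "mt u e = u" using identity mt_src_left[of u e] mt_comm[of u e] by simp
  thus ?case using identity norms_src[of e] by simp
next
  case (atom q k)
  note q = atom.hyps
  have u: "atom u" "src G u = src G q" using atom.prems q by auto
  have jq: "jn u q = src G u"
    by (rule jn_mono_src[of u "q \<bullet> k"]) (use u q atom.prems in \<open>auto intro: le_left\<close>)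
  have "u \<noteq> q"
  proof
    assume "u = q"
    moreover have "jn q q \<preceq> q" using q by (intro jn_least) auto
    ultimately show False using jq le_src_eq[of u] atom_not_id[of u] u by simp
  qed
  then obtain v x where vx: "atom v" "atom x" "tgt G u = src G v" "tgt G q = src G x"
    and m: "mt u q = u \<bullet> v" "mt u q = q \<bullet> x" and bound: "bound v = iv u \<bullet> (bound q \<bullet> u)"
    using diamond[OF u(1) q(1) u(2)] by blast
  have anorm: "anorm v = anorm q" using anorm_conj[OF _ _ _ _ bound] u q vx by simp
  have sx: "src G x = src G k" using vx q by simp
  have "jn x k = src G k"
    by (rule complement_shift[of q k u]) (use u q atom.prems vx sx m(2) in auto)
  hence IH: "norms (iv x \<bullet> mt x k) = norms k" using atom.IH[of x] vx sx by simp
  define c where "c = iv x \<bullet> mt x k"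
  have c: "c \<in> I" "tgt G x = src G c" "mt x k = x \<bullet> c"
    using le_iff_integral[of "mt x k" x] vx q sx by (auto simp: c_def)
  have "mt u (q \<bullet> k) = q \<bullet> mt x k"
    by (rule mt_shift) (use u q vx sx m(2) in auto)
  also have "\<dots> = (q \<bullet> x) \<bullet> c" using c(1,2) q(1) vx(2,4) by (simp add: c(3))
  also have "\<dots> = (u \<bullet> v) \<bullet> c" using m by simp
  finally have m': "mt u (q \<bullet> k) = (u \<bullet> v) \<bullet> c" .
  have tv: "tgt G v = src G c"
  proof -
    have "tgt G (u \<bullet> v) = tgt G (q \<bullet> x)" using m by simp
    thus ?thesis using vx u(1) q(1) c(2) by simp
  qed
  have "iv u \<bullet> mt u (q \<bullet> k) = v \<bullet> c" unfolding m' using u(1) vx c(1) tv by simp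
  thus ?case using IH anorm vx c(1) tv q by (simp add: norms_atom_cmp c_def[symmetric])
qed

text \<open>The perspective intervals from \<open>g \<and> h\<close> to \<open>g\<close> and from \<open>h\<close> to \<open>g \<or> h\<close> have the same factors.\<close>

lemma norms_transpose:
  assumes "g \<in> I" "h \<in> I" "src G h = src G g" "jn g h = src G g"
  shows "norms (iv g \<bullet> mt g h) = norms h"
  using assms
proof (induction g arbitrary: h rule: integral_atom_induct)
  case (identity e)
  thus ?case using mt_src_left[of h e] id_left[of h e] iv_identity[of e] by simp
next
  case (atom u k)
  note u = atom.hyps
  have h: "h \<in> I" "src G h = src G u" using atom.prems u by auto
  have jh: "jn h (u \<bullet> k) = src G h" using atom.prems u h by (subst jn_comm) auto
  have jhu: "jn h u = src G h"
    by (rule jn_mono_src[of h "u \<bullet> k"]) (use u h jh in \<open>auto intro: le_left\<close>)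
  have juh: "jn u h = src G u" using jhu h u by (subst jn_comm) auto
  \<comment> \<open>\<open>h\<close> carried past the atom \<open>u\<close>: the case of an atom
    shows that its norms are unchanged.\<close>
  define x where "x = iv u \<bullet> mt u h"
  have x: "x \<in> I" "src G x = src G k" "mt h u = u \<bullet> x"
    using le_iff_integral[of "mt u h" u] u h by (auto simp: x_def mt_comm)
  have Thx: "norms x = norms h" unfolding x_def by (rule norms_transpose_atom) (use h u juh in auto)
  have "jn x k = src G k" by (rule complement_shift[of u k h]) (use u h jh x in auto)
  hence "jn k x = src G k" using u x by (subst jn_comm) auto
  hence IH: "norms (iv k \<bullet> mt k x) = norms x" using atom.IH[of x] x by simp
  have "mt h (u \<bullet> k) = u \<bullet> mt x k" by (rule mt_shift) (use u h x in auto)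
  moreover have "mt h (u \<bullet> k) = mt (u \<bullet> k) h" using u h by (intro mt_comm) auto
  moreover have "mt x k = mt k x" using u x by (intro mt_comm) auto
  ultimately have "mt (u \<bullet> k) h = u \<bullet> mt k x" by simp
  hence "iv (u \<bullet> k) \<bullet> mt (u \<bullet> k) h = iv k \<bullet> mt k x" using u x by simp
  thus ?case using IH Thx by simp
qed

section \<open>The universal vertex group and the abstract norm\<close>

abbreviation VG :: "'a set monoid" where "VG \<equiv> vertex_group G"
abbreviation vc :: "'a \<Rightarrow> 'a set" where "vc \<equiv> vertex_class G"

lemma identity_exists: "\<exists>e. e \<in> identities G"
  using nonempty by (auto intro: identity_src)

lemma hom_exists: "\<lbrakk>e \<in> identities G; f \<in> identities G\<rbrakk> \<Longrightarrow> \<exists>a\<in>carrier G. src G a = e \<and> tgt G a = f"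
  using P5[of e f] by (auto simp: mem_hom_set)

lemma carrier_VG: "carrier VG = vc ` verts"
  by (auto simp: vertex_group_def mem_hom_set identity_iff intro: vertsI)

lemma vc_closed [simp]: "x \<in> verts \<Longrightarrow> vc x \<in> carrier VG"
  by (simp add: carrier_VG)

lemma vc_rep:
  assumes "X \<in> carrier VG" "e \<in> identities G"
  shows "\<exists>x\<in>verts. src G x = e \<and> X = vc x"
proof -
  obtain y where y: "y \<in> verts" "X = vc y" using assms by (auto simp: carrier_VG)
  obtain a where a: "a \<in> carrier G" "src G a = src G y" "tgt G a = e"
    using hom_exists[of "src G y" e] y(1) assms(2) by auto
  have "src G (iv a \<bullet> (y \<bullet> a)) = e" using a y(1) by simp
  moreover have "vc (iv a \<bullet> (y \<bullet> a)) = X" using vertex_class_conj[of y a] a y by simp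
  ultimately show ?thesis using a y(1) by (intro bexI[of _ "iv a \<bullet> (y \<bullet> a)"]) auto
qed

lemma vc_identity: "\<lbrakk>e \<in> identities G; f \<in> identities G\<rbrakk> \<Longrightarrow> vc e = vc f"
proof -
  assume ef: "e \<in> identities G" "f \<in> identities G"
  then obtain a where a: "a \<in> carrier G" "src G a = e" "tgt G a = f" using hom_exists by blast
  have "vc (iv a \<bullet> (src G a \<bullet> a)) = vc (src G a)"
    by (rule vertex_class_conj) (use a(1) in auto)
  moreover have "iv a \<bullet> (src G a \<bullet> a) = tgt G a" using a(1) by simp
  ultimately have "vc (tgt G a) = vc (src G a)" by simp
  thus ?thesis unfolding a(2,3) ..
qed

lemma vc_one: "e \<in> identities G \<Longrightarrow> \<one>\<^bsub>VG\<^esub> = vc e"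
  unfolding vertex_group_def by (auto intro!: the_equality dest: vc_identity)

lemma vc_mult:
  assumes "x \<in> verts" "y \<in> verts" "src G x = src G y"
  shows "vc x \<otimes>\<^bsub>VG\<^esub> vc y = vc (x \<bullet> y)"
proof -
  have "(THE Z. \<exists>e\<in>identities G. \<exists>x'\<in>hom_set G e e. \<exists>y'\<in>hom_set G e e.
       vc x = vc x' \<and> vc y = vc y' \<and> Z = vc (x' \<bullet> y')) = vc (x \<bullet> y)"
  proof (rule the_equality)
    show "\<exists>e\<in>identities G. \<exists>x'\<in>hom_set G e e. \<exists>y'\<in>hom_set G e e.
       vc x = vc x' \<and> vc y = vc y' \<and> vc (x \<bullet> y) = vc (x' \<bullet> y')"
      by (rule bexI[of _ "src G x"], rule bexI[of _ x], rule bexI[of _ y]) (use assms in \<open>auto simp: mem_hom_set\<close>)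
  next
    fix Z assume "\<exists>e\<in>identities G. \<exists>x'\<in>hom_set G e e. \<exists>y'\<in>hom_set G e e.
       vc x = vc x' \<and> vc y = vc y' \<and> Z = vc (x' \<bullet> y')"
    then obtain e x' y' where e0: "e \<in> identities G" "x' \<in> hom_set G e e" "y' \<in> hom_set G e e"
      and eq: "vc x = vc x'" "vc y = vc y'" and Z: "Z = vc (x' \<bullet> y')"
      by blast
    hence e: "e \<in> identities G" "x' \<in> carrier G" "src G x' = e" "tgt G x' = e"
      "y' \<in> carrier G" "src G y' = e" "tgt G y' = e"
      by (auto simp: mem_hom_set)
    have v: "x' \<in> verts" "y' \<in> verts" using e by (auto intro: vertsI)
    \<comment> \<open>Conjugation along one arrow \<open>a\<close> carries both representatives to
      any other vertex, and hence also their product.\<close>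
    obtain a where a: "a \<in> carrier G" "src G a = src G x" "tgt G a = e"
      using hom_exists[of "src G x" e] assms(1) e(1) by auto
    have x': "x' = iv a \<bullet> (x \<bullet> a)"
      using eq(1) by (subst (asm) vertex_class_eq_iff[of x x' a]) (use assms a v e in auto)
    have y': "y' = iv a \<bullet> (y \<bullet> a)"
      using eq(2) by (subst (asm) vertex_class_eq_iff[of y y' a]) (use assms a v e in auto)
    have "x' \<bullet> y' = iv a \<bullet> ((x \<bullet> y) \<bullet> a)"
      unfolding x' y' using assms a by simp
    thus "Z = vc (x \<bullet> y)" unfolding Z using vertex_class_conj[of "x \<bullet> y" a] assms a(1,2) by simp
  qed
  thus ?thesis by (simp add: vertex_group_def)
qed

lemma comm_group_VG: "comm_group VG"
proof -
  obtain e where e: "e \<in> identities G" using identity_exists by auto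
  have e': "e \<in> carrier G" "src G e = e" "e \<in> verts" using e by (auto simp: identity_iff intro: vertsI)
  note one = vc_one[OF e]
  have rep: "\<exists>x\<in>verts. src G x = e \<and> X = vc x" if "X \<in> carrier VG" for X
    using vc_rep[OF that e] .
  show ?thesis
  proof (rule comm_groupI)
    show "\<one>\<^bsub>VG\<^esub> \<in> carrier VG" unfolding one using e' by simp
    fix X assume "X \<in> carrier VG"
    then obtain x where x: "x \<in> verts" "src G x = e" "X = vc x" using rep by blast
    show "\<one>\<^bsub>VG\<^esub> \<otimes>\<^bsub>VG\<^esub> X = X"
      unfolding one x(3) using vc_mult[of e x] e' x(1,2) id_left[of x e] by simp
    show "\<exists>Y\<in>carrier VG. Y \<otimes>\<^bsub>VG\<^esub> X = \<one>\<^bsub>VG\<^esub>"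
      unfolding one x(3) using vc_mult[of "iv x" x] x(1,2) by (intro bexI[of _ "vc (iv x)"]) auto
    fix Y assume "Y \<in> carrier VG"
    then obtain y where y: "y \<in> verts" "src G y = e" "Y = vc y" using rep by blast
    show "X \<otimes>\<^bsub>VG\<^esub> Y \<in> carrier VG"
      unfolding x(3) y(3) using x(1,2) y(1,2) by (simp add: vc_mult)
    show "X \<otimes>\<^bsub>VG\<^esub> Y = Y \<otimes>\<^bsub>VG\<^esub> X"
      unfolding x(3) y(3) using x(1,2) y(1,2) vertex_commute[of x y] by (simp add: vc_mult)
    fix Z assume "Z \<in> carrier VG"
    then obtain z where z: "z \<in> verts" "src G z = e" "Z = vc z" using rep by blast
    show "X \<otimes>\<^bsub>VG\<^esub> Y \<otimes>\<^bsub>VG\<^esub> Z = X \<otimes>\<^bsub>VG\<^esub> (Y \<otimes>\<^bsub>VG\<^esub> Z)"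
      unfolding x(3) y(3) z(3) using x(1,2) y(1,2) z(1,2) by (simp add: vc_mult)
  qed
qed

sublocale VG: comm_group "vertex_group G" by (rule comm_group_VG)

lemma anorm_closed [simp]: "u \<in> I \<Longrightarrow> anorm u \<in> carrier VG"
  by (simp add: anorm_def)

lemma norms_subset: "a \<in> I \<Longrightarrow> set_mset (norms a) \<subseteq> anorm ` Collect atom"
proof (induction a rule: integral_atom_induct)
  case (identity e) thus ?case using norms_src[of e] by simp
qed (auto simp: norms_atom_cmp)

lemma norms_carrier [simp]: "a \<in> I \<Longrightarrow> set_mset (norms a) \<subseteq> carrier VG"
  using norms_subset[of a] by auto

section \<open>Extension of the norm from integral elements to the groupoid\<close>

definition N :: "'a \<Rightarrow> 'a set" where "N a = mset_prod VG (norms a)"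

lemma N_closed [simp]: "a \<in> I \<Longrightarrow> N a \<in> carrier VG"
  by (simp add: N_def)

lemma N_cmp: "\<lbrakk>a \<in> I; b \<in> I; tgt G a = src G b\<rbrakk> \<Longrightarrow> N (a \<bullet> b) = N a \<otimes>\<^bsub>VG\<^esub> N b"
  by (simp add: N_def norms_cmp)

lemma N_tgt [simp]: "a \<in> carrier G \<Longrightarrow> N (tgt G a) = \<one>\<^bsub>VG\<^esub>" and N_src [simp]: "a \<in> carrier G \<Longrightarrow> N (src G a) = \<one>\<^bsub>VG\<^esub>"
  by (simp_all add: N_def)

lemma N_atom [simp]: "atom u \<Longrightarrow> N u = anorm u"
  by (simp add: N_def)

text \<open>The meet is a common right multiple. This is the Ore condition by which fractions are
  compared and multiplied.\<close>

lemma common_multiple: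
  assumes "c \<in> I" "c' \<in> I" "src G c = src G c'"
  shows "\<exists>m\<in>I. \<exists>m'\<in>I. tgt G c = src G m \<and> tgt G c' = src G m' \<and> c \<bullet> m = c' \<bullet> m'"
  using le_imp_ex[of "mt c c'" c] le_imp_ex[of "mt c c'" c'] assms by auto metis

lemma N_quotient:
  assumes "b \<in> I" "c \<in> I" "tgt G b = tgt G c" "b' \<in> I" "c' \<in> I" "tgt G b' = tgt G c'" "b \<bullet> iv c = b' \<bullet> iv c'"
  shows "N b \<otimes>\<^bsub>VG\<^esub> inv\<^bsub>VG\<^esub> N c = N b' \<otimes>\<^bsub>VG\<^esub> inv\<^bsub>VG\<^esub> N c'"
proof -
  have s: "src G c = src G c'"
    using arg_cong[OF assms(7), of "tgt G"] assms(1-6) by simp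
  obtain m m' where m: "m \<in> I" "m' \<in> I" "tgt G c = src G m" "tgt G c' = src G m'" "c \<bullet> m = c' \<bullet> m'"
    using common_multiple[OF assms(2,5) s] by blast
  have "b \<bullet> m = (b \<bullet> iv c) \<bullet> (c \<bullet> m)" using assms(1-3) m(1,3) by simp
  also have "\<dots> = b' \<bullet> m'" unfolding assms(7) m(5) using assms(4-6) m(2,4) by simp
  finally have bm: "b \<bullet> m = b' \<bullet> m'" .
  show ?thesis
  proof (rule VG.quotient_eqI[of _ _ _ _ "N m" "N m'"])
    show "N b \<otimes>\<^bsub>VG\<^esub> N m = N b' \<otimes>\<^bsub>VG\<^esub> N m'"
      using N_cmp[of b m] N_cmp[of b' m'] assms m bm by simp
    show "N c \<otimes>\<^bsub>VG\<^esub> N m = N c' \<otimes>\<^bsub>VG\<^esub> N m'"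
      using N_cmp[of c m] N_cmp[of c' m'] assms m by simp
  qed (use assms m in auto)
qed

text \<open>
  Every \<open>a\<close> is the quotient of the integral elements \<open>a \<and> 1\<close> and \<open>inverse a \<bullet> (a \<and> 1)\<close>.
\<close>

definition eta :: "'a \<Rightarrow> 'a set"
  where "eta a = (if a \<in> carrier G then N (mt a (src G a)) \<otimes>\<^bsub>VG\<^esub> inv\<^bsub>VG\<^esub> N (iv a \<bullet> mt a (src G a)) else undefined)"

lemma integral_quotient_eq:
  assumes "a \<in> carrier G"
  shows "tgt G (mt a (src G a)) = tgt G (iv a \<bullet> mt a (src G a))"
    "a = mt a (src G a) \<bullet> iv (iv a \<bullet> mt a (src G a))"
  using assms by simp_all

lemma quotient_exists:
  assumes "a \<in> carrier G"
  shows "\<exists>b\<in>I. \<exists>c\<in>I. tgt G b = tgt G c \<and> a = b \<bullet> iv c"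
  using integral_quotient[OF assms] integral_quotient_eq[OF assms] by blast

lemma eta_quotient:
  assumes "b \<in> I" "c \<in> I" "tgt G b = tgt G c"
  shows "eta (b \<bullet> iv c) = N b \<otimes>\<^bsub>VG\<^esub> inv\<^bsub>VG\<^esub> N c"
proof -
  define a where "a = b \<bullet> iv c"
  have a: "a \<in> carrier G" using assms by (simp add: a_def)
  have "N (mt a (src G a)) \<otimes>\<^bsub>VG\<^esub> inv\<^bsub>VG\<^esub> N (iv a \<bullet> mt a (src G a)) = N b \<otimes>\<^bsub>VG\<^esub> inv\<^bsub>VG\<^esub> N c"
    by (rule N_quotient[OF integral_quotient[OF a] integral_quotient_eq(1)[OF a] assms])
      (use integral_quotient_eq(2)[OF a] in \<open>simp add: a_def\<close>)
  thus ?thesis using a by (simp add: eta_def a_def[symmetric])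
qed

lemma eta_closed: "a \<in> carrier G \<Longrightarrow> eta a \<in> carrier VG"
  using integral_quotient[of a] by (simp add: eta_def)

lemma eta_integral: "a \<in> I \<Longrightarrow> eta a = N a"
  using eta_quotient[of a "tgt G a"] by simp

text \<open>With \<open>c \<bullet> m = b' \<bullet> n\<close> the product of
  \<open>b \<bullet> iv c\<close> and \<open>b' \<bullet> iv c'\<close> is the fraction of
  \<open>b \<bullet> m\<close> by \<open>c' \<bullet> n\<close>. The values of \<open>N\<close>
  commute, so they can be regrouped.\<close>

lemma eta_cmp:
  assumes "a \<in> carrier G" "a' \<in> carrier G" "tgt G a = src G a'"
  shows "eta (a \<bullet> a') = eta a \<otimes>\<^bsub>VG\<^esub> eta a'"
proof -
  obtain b c where b: "b \<in> I" "c \<in> I" "tgt G b = tgt G c" "a = b \<bullet> iv c"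
    using quotient_exists[OF assms(1)] by blast
  obtain b' c' where b': "b' \<in> I" "c' \<in> I" "tgt G b' = tgt G c'" "a' = b' \<bullet> iv c'"
    using quotient_exists[OF assms(2)] by blast
  have s: "src G c = src G b'" using assms(3) b(1-3) b'(1-3) unfolding b(4) b'(4) by simp
  obtain m n where m: "m \<in> I" "n \<in> I" "tgt G c = src G m" "tgt G b' = src G n" "c \<bullet> m = b' \<bullet> n"
    using common_multiple[OF b(2) b'(1) s] by blast
  have t: "tgt G m = tgt G n" using arg_cong[OF m(5), of "tgt G"] m(1-4) b b' by simp
  have "a \<bullet> a' = b \<bullet> (iv c \<bullet> (b' \<bullet> n)) \<bullet> iv (c' \<bullet> n)"
    unfolding b(4) b'(4) using b(1-3) b'(1-3) m(2,4) s by simp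
  also have "\<dots> = (b \<bullet> m) \<bullet> iv (c' \<bullet> n)"
    unfolding m(5)[symmetric] using b(1-3) b'(1-3) m(1-4) t by simp
  finally have "eta (a \<bullet> a') = eta ((b \<bullet> m) \<bullet> iv (c' \<bullet> n))" by simp
  also have "\<dots> = N (b \<bullet> m) \<otimes>\<^bsub>VG\<^esub> inv\<^bsub>VG\<^esub> N (c' \<bullet> n)"
    using b(1-3) b'(1-3) m(1-4) t by (intro eta_quotient) auto
  also have "\<dots> = (N b \<otimes>\<^bsub>VG\<^esub> N m) \<otimes>\<^bsub>VG\<^esub> (inv\<^bsub>VG\<^esub> N c' \<otimes>\<^bsub>VG\<^esub> inv\<^bsub>VG\<^esub> N n)"
    using b(1-3) b'(1-3) m(1-4) by (simp add: N_cmp VG.inv_mult)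
  also have "\<dots> = (N m \<otimes>\<^bsub>VG\<^esub> inv\<^bsub>VG\<^esub> N n) \<otimes>\<^bsub>VG\<^esub> (N b \<otimes>\<^bsub>VG\<^esub> inv\<^bsub>VG\<^esub> N c')"
    using b(1-3) b'(1-3) m(1-4) by (simp add: VG.m_ac)
  also have "N m \<otimes>\<^bsub>VG\<^esub> inv\<^bsub>VG\<^esub> N n = N b' \<otimes>\<^bsub>VG\<^esub> inv\<^bsub>VG\<^esub> N c"
  proof -
    have "N c \<otimes>\<^bsub>VG\<^esub> N m = N b' \<otimes>\<^bsub>VG\<^esub> N n"
      using N_cmp[of c m] N_cmp[of b' n] b b' m by simp
    thus ?thesis
      using b(1-3) b'(1-3) m(1-4) by (intro VG.quotient_eqI[of _ _ _ _ "N c" "N n"]) (auto simp: VG.m_ac)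
  qed
  also have "(N b' \<otimes>\<^bsub>VG\<^esub> inv\<^bsub>VG\<^esub> N c) \<otimes>\<^bsub>VG\<^esub> (N b \<otimes>\<^bsub>VG\<^esub> inv\<^bsub>VG\<^esub> N c')
      = (N b \<otimes>\<^bsub>VG\<^esub> inv\<^bsub>VG\<^esub> N c) \<otimes>\<^bsub>VG\<^esub> (N b' \<otimes>\<^bsub>VG\<^esub> inv\<^bsub>VG\<^esub> N c')"
    using b(1-3) b'(1-3) by (simp add: VG.m_ac)
  also have "\<dots> = eta a \<otimes>\<^bsub>VG\<^esub> eta a'"
    unfolding b(4) b'(4) using b(1-3) b'(1-3) by (simp add: eta_quotient)
  finally show ?thesis .
qed

text \<open>The definite description has a value because \<open>eta\<close> qualifies. It is the
  only one: values on atoms fix a homomorphism on integral elements, and any \<open>a\<close> has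
  \<open>b = a \<bullet> c\<close> with integral \<open>b\<close> and \<open>c\<close>, where the
  value at \<open>c\<close> can be cancelled.\<close>

lemma abstract_norm_eq: "abstract_norm G = eta"
  unfolding abstract_norm_def
proof (rule the_equality)
  show "eta \<in> extensional (carrier G) \<and> eta \<in> cat_hom G (monoid_cat VG) \<and>
    (\<forall>u\<in>atoms (integral_cat G). eta u = vc (\<Squnion>\<^bsub>ord_from G (src G u)\<^esub> {x \<in> hom_set G (src G u) (src G u). x \<preceq> u}))"
  proof (intro conjI)
    show "eta \<in> extensional (carrier G)" by (simp add: extensional_def eta_def)
  qed (auto simp: atom_iff eta_integral cat_hom_def monoid_cat_def
        eta_closed eta_cmp bound_def[symmetric] anorm_def[symmetric])
next
  fix h assume "h \<in> extensional (carrier G) \<and> h \<in> cat_hom G (monoid_cat VG) \<and>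
    (\<forall>u\<in>atoms (integral_cat G). h u = vc (\<Squnion>\<^bsub>ord_from G (src G u)\<^esub> {x \<in> hom_set G (src G u) (src G u). x \<preceq> u}))"
  hence ext: "h \<in> extensional (carrier G)" and clo: "\<And>a. a \<in> carrier G \<Longrightarrow> h a \<in> carrier VG"
    and src: "\<And>a. a \<in> carrier G \<Longrightarrow> h (src G a) = \<one>\<^bsub>VG\<^esub>"
    and cmp: "\<And>a b. \<lbrakk>a \<in> carrier G; b \<in> carrier G; tgt G a = src G b\<rbrakk> \<Longrightarrow> h (a \<bullet> b) = h a \<otimes>\<^bsub>VG\<^esub> h b"
    and atom: "\<And>u. atom u \<Longrightarrow> h u = anorm u"
    by (auto simp: cat_hom_def monoid_cat_def atom_iff bound_def[symmetric] anorm_def[symmetric])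
  have int: "h a = N a" if "a \<in> I" for a
    using that
  proof (induction a rule: integral_atom_induct)
    case (identity e)
    thus ?case using src[of e] N_src[of e] by simp
  qed (auto simp: cmp N_cmp atom)
  have "h a = eta a" if a: "a \<in> carrier G" for a
  proof -
    obtain b c where b: "b \<in> I" "c \<in> I" "tgt G b = tgt G c" "a = b \<bullet> iv c"
      using quotient_exists[OF a] by blast
    have ac: "b = a \<bullet> c" "tgt G a = src G c" unfolding b(4) using b(1-3) by auto
    have "h a \<otimes>\<^bsub>VG\<^esub> N c = eta a \<otimes>\<^bsub>VG\<^esub> N c"
      using cmp[of a c] eta_cmp[of a c] int[of b] int[of c] eta_integral[of b] eta_integral[of c] a b(1,2) ac by simp
    thus ?thesis using VG.right_cancel[of "N c" "h a" "eta a"] clo[OF a] eta_closed[OF a] b(2) by simp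
  qed
  thus "h = eta" using ext by (intro extensionalityI[of _ "carrier G"]) (auto simp: extensional_def eta_def)
qed

lemma abstract_norm_closed: "a \<in> carrier G \<Longrightarrow> abstract_norm G a \<in> carrier VG"
  by (simp add: abstract_norm_eq eta_closed)

lemma abstract_norm_integral: "a \<in> I \<Longrightarrow> abstract_norm G a = mset_prod VG (norms a)"
  by (simp add: abstract_norm_eq eta_integral N_def)

text \<open>The right-nested form of the products written with \<open>foldl\<close>; it fits
  inductions that remove the first atom.\<close>

fun lprod :: "'a \<Rightarrow> 'a list \<Rightarrow> 'a" where
  "lprod e [] = e"
| "lprod e (u # us) = u \<bullet> lprod (tgt G u) us"

lemma
  assumes "set us \<subseteq> I" "composable G e us" "e \<in> carrier G" "src G e = e"
  shows lprod_integral: "lprod e us \<in> I" and src_lprod: "src G (lprod e us) = e"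
  using assms
proof (induction us arbitrary: e)
  case Nil
  { case 1 thus ?case using integral_src[of e] by simp }
  { case 2 thus ?case by simp }
next
  case (Cons u us)
  have *: "lprod (tgt G u) us \<in> I" "src G (lprod (tgt G u) us) = tgt G u" if "u \<in> I" "set us \<subseteq> I" "composable G (tgt G u) us"
    using Cons.IH[of "tgt G u"] that by auto
  { case 1 thus ?case using * by simp }
  { case 2 thus ?case using * by simp }
qed

lemma foldl_lprod:
  "\<lbrakk>c \<in> I; set us \<subseteq> I; composable G (tgt G c) us\<rbrakk> \<Longrightarrow> foldl (cmp G) c us = c \<bullet> lprod (tgt G c) us"
proof (induction us arbitrary: c)
  case (Cons u us)
  have "lprod (tgt G u) us \<in> I" "src G (lprod (tgt G u) us) = tgt G u"
    using Cons.prems lprod_integral[of us "tgt G u"] src_lprod[of us "tgt G u"] by auto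
  thus ?case using Cons.IH[of "c \<bullet> u"] Cons.prems by simp
qed simp

lemma foldl_identity:
  "\<lbrakk>e \<in> carrier G; src G e = e; set us \<subseteq> I; composable G e us\<rbrakk> \<Longrightarrow> foldl (cmp G) e us = lprod e us"
  using foldl_lprod[of e us] tgt_src[of e] integral_src[of e] lprod_integral[of us e] src_lprod[of us e]
    id_left[of "lprod e us" e] by simp

lemma norms_lprod:
  "\<lbrakk>set us \<subseteq> Collect atom; composable G e us; e \<in> carrier G; src G e = e\<rbrakk> \<Longrightarrow> norms (lprod e us) = mset (map anorm us)"
proof (induction us arbitrary: e)
  case Nil thus ?case using norms_src[of e] by simp
next
  case (Cons u us)
  have "set us \<subseteq> I" using Cons.prems by auto
  hence "lprod (tgt G u) us \<in> I" "src G (lprod (tgt G u) us) = tgt G u"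
    using Cons.prems lprod_integral[of us "tgt G u"] src_lprod[of us "tgt G u"] by auto
  thus ?case using Cons.IH[of "tgt G u"] Cons.prems by (simp add: norms_atom_cmp)
qed

lemma atom_list_exists:
  "a \<in> I \<Longrightarrow> \<exists>us. set us \<subseteq> Collect atom \<and> composable G (src G a) us \<and> a = lprod (src G a) us"
proof (induction a rule: integral_atom_induct)
  case (identity e)
  show ?case by (rule exI[of _ "[]"]) (use identity in simp)
next
  case (atom u b)
  then obtain us where "set us \<subseteq> Collect atom" "composable G (src G b) us" "b = lprod (src G b) us" by blast
  thus ?case using atom.hyps by (intro exI[of _ "u # us"]) simp
qed

end

section \<open>Class group and block homomorphism\<close>

locale saturated_subcategory = arithmetical_groupoid G for G :: "('a, 'm) ordered_cat_scheme" (structure) +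
  fixes H :: "'a set"
  assumes subcat: "subcategory H (integral_cat G)"
    and saturated: "right_saturated G H"
    and fractions: "\<forall>a\<in>carrier G. src G a \<in> identities (G\<lparr>carrier := H\<rparr>) \<longrightarrow>
           (a \<in> right_fractions G H \<longleftrightarrow> abstract_norm G a \<in> norm_subgroup G H)"
begin

abbreviation HC where "HC \<equiv> G\<lparr>carrier := H\<rparr>"
abbreviation K where "K \<equiv> norm_subgroup G H"
abbreviation CG where "CG \<equiv> class_group G H"
abbreviation cl where "cl \<equiv> norm_class G H"
abbreviation BM where "BM \<equiv> block_monoid CG (atom_classes G H)"
abbreviation BC where "BC \<equiv> block_cat G H"

lemma H_integral [simp]: "a \<in> H \<Longrightarrow> a \<in> I"
  and H_src [simp]: "a \<in> H \<Longrightarrow> src G a \<in> H"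
  and H_tgt [simp]: "a \<in> H \<Longrightarrow> tgt G a \<in> H"
  and H_cmp: "\<lbrakk>a \<in> H; b \<in> H; tgt G a = src G b\<rbrakk> \<Longrightarrow> a \<bullet> b \<in> H"
  and H_nonempty: "H \<noteq> {}"
  using subcat by (auto simp: subcategory_def)

lemma subgroup_K: "subgroup K VG"
  unfolding norm_subgroup_def by (rule VG.generate_is_subgroup) (auto intro: abstract_norm_closed)

lemma comm_group_CG: "comm_group CG"
  unfolding class_group_def by (rule VG.abelian_FactGroup) (rule subgroup_K)

sublocale CG: comm_group "class_group G H" by (rule comm_group_CG)

lemma normal_K: "K \<lhd> VG"
  using VG.subgroup_imp_normal subgroup_K by blast

lemma cl_closed [simp]: "X \<in> carrier VG \<Longrightarrow> cl X \<in> carrier CG"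
  by (simp add: norm_class_def class_group_def carrier_FactGroup)

lemma cl_mult: "\<lbrakk>X \<in> carrier VG; Y \<in> carrier VG\<rbrakk> \<Longrightarrow> cl (X \<otimes>\<^bsub>VG\<^esub> Y) = cl X \<otimes>\<^bsub>CG\<^esub> cl Y"
  using normal.rcos_sum[OF normal_K] by (simp add: norm_class_def class_group_def)

lemma cl_one_iff: "X \<in> carrier VG \<Longrightarrow> cl X = \<one>\<^bsub>CG\<^esub> \<longleftrightarrow> X \<in> K"
  using VG.coset_join1[of K X] VG.coset_join2[of X K] subgroup_K subgroup.subset[OF subgroup_K]
  by (auto simp: norm_class_def class_group_def)

lemma cl_mset_prod: "set_mset M \<subseteq> carrier VG \<Longrightarrow> cl (mset_prod VG M) = mset_prod CG (image_mset cl M)"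
proof (induction M)
  case empty
  have "\<one>\<^bsub>VG\<^esub> \<in> K" using subgroup_K by (rule subgroup.one_closed)
  thus ?case using cl_one_iff[of "\<one>\<^bsub>VG\<^esub>"] by simp
next
  case (add x M)
  have "set_mset (image_mset cl M) \<subseteq> carrier CG" using add.prems by auto
  thus ?case using add by (simp add: cl_mult)
qed

text \<open>Meant for all integral elements, since factors outside \<open>H\<close> occur in the
  arguments as well; \<open>block_hom_eq\<close> identifies it with the block homomorphism.\<close>

definition block :: "'a \<Rightarrow> 'a set set multiset" where "block a = image_mset cl (norms a)"

lemma block_cmp: "\<lbrakk>a \<in> I; b \<in> I; tgt G a = src G b\<rbrakk> \<Longrightarrow> block (a \<bullet> b) = block a + block b"
  by (simp add: block_def norms_cmp)

lemma size_block [simp]: "size (block a) = size (norms a)"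
  by (simp add: block_def)

lemma block_empty_iff: "a \<in> I \<Longrightarrow> block a = {#} \<longleftrightarrow> src G a = a"
  by (metis block_def norms_empty norms_src image_mset_is_empty_iff integral_carrier)

lemma atom_classes_eq: "atom_classes G H = cl ` anorm ` Collect atom"
proof -
  have "cl (abstract_norm G u) = cl (anorm u)" if "atom u" for u
    using that by (simp add: abstract_norm_integral)
  thus ?thesis unfolding atom_classes_def by (auto simp: atom_iff image_iff)
qed

lemma block_atom_classes: "a \<in> I \<Longrightarrow> set_mset (block a) \<subseteq> atom_classes G H"
  using norms_subset[of a] by (auto simp: atom_classes_eq block_def)

lemma block_carrier: "a \<in> I \<Longrightarrow> set_mset (block a) \<subseteq> carrier CG"
  using norms_carrier[of a] by (auto simp: block_def simp del: norms_carrier)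

lemma block_split:
  assumes "a \<in> I" "block a = X + Y"
  shows "\<exists>b c. b \<in> I \<and> c \<in> I \<and> tgt G b = src G c \<and> a = b \<bullet> c \<and> block b = X \<and> block c = Y"
proof -
  obtain A B where "norms a = A + B" "X = image_mset cl A" "Y = image_mset cl B"
    using assms(2) image_mset_eq_plusD unfolding block_def by metis
  thus ?thesis using norms_split[OF assms(1), of A B] unfolding block_def by blast
qed

lemma identity_HC: "src G a \<in> H \<Longrightarrow> a \<in> carrier G \<Longrightarrow> src G a \<in> identities HC"
  by (simp add: identities_def)

text \<open>A norm in the subgroup makes \<open>a\<close> a right fraction of \<open>H\<close>, and
  right saturation turns an integral right fraction into an element of \<open>H\<close>. The other
  direction holds as the norms of \<open>H\<close> generate the subgroup.\<close>

lemma H_iff: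
  assumes "a \<in> I" "src G a \<in> H"
  shows "a \<in> H \<longleftrightarrow> mset_prod CG (block a) = \<one>\<^bsub>CG\<^esub>"
proof -
  have "a \<in> H \<longleftrightarrow> abstract_norm G a \<in> K"
  proof
    assume "a \<in> H"
    thus "abstract_norm G a \<in> K" unfolding norm_subgroup_def by (intro generate.incl) auto
  next
    assume "abstract_norm G a \<in> K"
    hence "a \<in> right_fractions G H" using fractions assms identity_HC[of a] by auto
    thus "a \<in> H" using saturated assms(1) unfolding right_saturated_def by blast
  qed
  also have "\<dots> \<longleftrightarrow> cl (abstract_norm G a) = \<one>\<^bsub>CG\<^esub>"
    using cl_one_iff abstract_norm_closed assms(1) by simp
  finally show ?thesis
    using assms(1) by (simp add: abstract_norm_integral cl_mset_prod block_def)
qed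

lemma carrier_BM: "X \<in> carrier BM \<longleftrightarrow> set_mset X \<subseteq> atom_classes G H \<and> mset_prod CG X = \<one>\<^bsub>CG\<^esub>"
  by (simp add: block_monoid_def mset_prod_def)

lemma block_BM [simp]: "a \<in> H \<Longrightarrow> block a \<in> carrier BM"
  using H_iff[of a] block_atom_classes[of a] by (simp add: carrier_BM)

lemma H_I: "\<lbrakk>a \<in> I; src G a \<in> H; block a \<in> carrier BM\<rbrakk> \<Longrightarrow> a \<in> H"
  using H_iff[of a] by (simp add: carrier_BM)

text \<open>The source of \<open>c\<close> is the target of \<open>b\<close>, and its class product
  is a quotient of two trivial ones.\<close>

lemma H_right_factor:
  assumes "b \<in> H" "c \<in> I" "tgt G b = src G c" "b \<bullet> c \<in> H"
  shows "c \<in> H"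
proof -
  have s: "src G c \<in> H" using assms(1) assms(3)[symmetric] by simp
  have "mset_prod CG (block (b \<bullet> c)) = mset_prod CG (block b) \<otimes>\<^bsub>CG\<^esub> mset_prod CG (block c)"
    using assms(1-3) block_carrier[of b] block_carrier[of c] by (simp add: block_cmp)
  moreover have "mset_prod CG (block (b \<bullet> c)) = \<one>\<^bsub>CG\<^esub>" "mset_prod CG (block b) = \<one>\<^bsub>CG\<^esub>"
    using block_BM[OF assms(4)] block_BM[OF assms(1)] by (auto simp: carrier_BM)
  ultimately have "mset_prod CG (block c) = \<one>\<^bsub>CG\<^esub>" using block_carrier[OF assms(2)] by simp
  thus ?thesis using H_iff[OF assms(2) s] by simp
qed

text \<open>This is (T2) in the absence of nontrivial units. Only the first part must have trivial
  product; the second factor then lies in \<open>H\<close> by \<open>H_right_factor\<close>.\<close>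

lemma H_split:
  assumes "a \<in> H" "block a = X + Y" "X \<in> carrier BM"
  shows "\<exists>b c. b \<in> H \<and> c \<in> H \<and> tgt G b = src G c \<and> a = b \<bullet> c \<and> block b = X \<and> block c = Y"
proof -
  obtain b c where b: "b \<in> I" "c \<in> I" "tgt G b = src G c" "a = b \<bullet> c" "block b = X" "block c = Y"
    using block_split[of a X Y] assms by auto
  have "src G b = src G a" using b(1-3) unfolding b(4) by simp
  hence "b \<in> H" using H_I[of b] b(1,5) assms(1,3) by simp
  moreover have "c \<in> H" using H_right_factor[of b c] b(2,3) \<open>b \<in> H\<close> assms(1) unfolding b(4) by simp
  ultimately show ?thesis using b by blast
qed

text \<open>Every class of an atom is available at every vertex by \<open>atom_transport\<close>, so
  the element is built one atom at a time, each at the target of the previous one.\<close>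

lemma block_realize:
  assumes "set_mset X \<subseteq> atom_classes G H" "e \<in> identities G"
  shows "\<exists>a\<in>I. src G a = e \<and> block a = X"
  using assms
proof (induction X arbitrary: e)
  case empty
  have "e \<in> I" "src G e = e" using empty.prems integral_src[of e] by (auto simp: identity_iff)
  thus ?case using block_empty_iff[of e] by blast
next
  case (add g X)
  obtain u where u: "atom u" "g = cl (anorm u)"
    using add.prems(1) by (auto simp: atom_classes_def atom_iff abstract_norm_integral)
  obtain v where v: "atom v" "src G v = e" "anorm v = anorm u"
    using atom_transport[OF u(1) add.prems(2)] by blast
  obtain b where b: "b \<in> I" "src G b = tgt G v" "block b = X"
    using add.IH[of "tgt G v"] add.prems(1) v(1) by auto
  have "v \<bullet> b \<in> I" "src G (v \<bullet> b) = e" "block (v \<bullet> b) = add_mset g X"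
    using v b u(2) by (auto simp: block_cmp) (simp add: block_def)
  thus ?case by blast
qed

text \<open>Every list of atoms with product \<open>a\<close> has the norms of \<open>a\<close>, so
  the description in \<open>block_hom\<close> has exactly one value.\<close>

lemma block_hom_eq: 
  assumes "a \<in> I" shows "block_hom G H a = block a"
  unfolding block_hom_def
proof (rule the_equality)
  have *: "mset (map (\<lambda>u. cl (abstract_norm G u)) us) = block a"
    if "set us \<subseteq> Collect atom" "composable G (src G a) us" "a = lprod (src G a) us" for us
  proof -
    have "norms a = mset (map anorm us)"
      using norms_lprod[OF that(1,2)] that(3) assms by simp
    hence "block a = mset (map (\<lambda>u. cl (anorm u)) us)" by (simp add: block_def multiset.map_comp comp_def)
    also have "map (\<lambda>u. cl (anorm u)) us = map (\<lambda>u. cl (abstract_norm G u)) us"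
      using that(1) by (auto simp: abstract_norm_integral)
    finally show ?thesis ..
  qed
  have fold: "foldl (cmp G) (src G a) us = lprod (src G a) us" if "set us \<subseteq> Collect atom" "composable G (src G a) us" for us
    using that assms by (intro foldl_identity) auto
  have at: "atoms (integral_cat G) = Collect atom" using atom_iff by blast
  obtain us where us: "set us \<subseteq> Collect atom" "composable G (src G a) us" "a = lprod (src G a) us"
    using atom_list_exists[OF assms] by blast
  show "\<exists>us. set us \<subseteq> atoms (integral_cat G) \<and> composable G (src G a) us \<and> a = foldl (cmp G) (src G a) us \<and>
      block a = mset (map (\<lambda>u. cl (abstract_norm G u)) us)"
    using us *[OF us] fold[OF us(1,2)] at by (intro exI[of _ us]) simp
  fix B assume "\<exists>us. set us \<subseteq> atoms (integral_cat G) \<and> composable G (src G a) us \<and> a = foldl (cmp G) (src G a) us \<and>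
      B = mset (map (\<lambda>u. cl (abstract_norm G u)) us)"
  thus "B = block a" using * fold at by auto
qed

lemma units_HC: "cat_units HC = {a \<in> H. src G a = a}"
proof (intro equalityI subsetI)
  fix a assume "a \<in> cat_units HC"
  then obtain b where b: "a \<in> H" "b \<in> H" "src G b = tgt G a" "a \<bullet> b = src G a"
    by (auto simp: cat_units_def cat_inverse_def mem_hom_set)
  hence "iv a = b" by (intro iv_unique) auto
  hence "src G a = a" using b(1,2) by (intro integral_reduced) auto
  thus "a \<in> {a \<in> H. src G a = a}" using b(1) by simp
next
  fix a assume "a \<in> {a \<in> H. src G a = a}"
  hence a: "a \<in> H" "src G a = a" by auto
  moreover have "tgt G a = a" using a by (metis H_integral integral_carrier tgt_src)
  ultimately show "a \<in> cat_units HC"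
    by (auto simp: id_left cat_units_def cat_inverse_def mem_hom_set intro!: exI[of _ a])
qed

definition batom :: "'a set set multiset \<Rightarrow> bool"
  where "batom X \<longleftrightarrow> X \<in> carrier BM \<and> X \<noteq> {#} \<and>
    (\<forall>Y\<in>carrier BM. \<forall>Z\<in>carrier BM. X = Y + Z \<longrightarrow> Y = {#} \<or> Z = {#})"

lemma BC_simps [simp]: "carrier BC = carrier BM" "src BC X = {#}" "tgt BC X = {#}" "cmp BC X Y = X + Y"
  by (simp_all add: block_cat_def monoid_cat_def block_monoid_def)

lemma empty_BM [simp]: "{#} \<in> carrier BM"
  by (simp add: carrier_BM)

lemma atom_classes_carrier: "atom_classes G H \<subseteq> carrier CG"
  by (auto simp: atom_classes_def atom_iff abstract_norm_integral)

lemma plus_BM: "\<lbrakk>X \<in> carrier BM; Y \<in> carrier BM\<rbrakk> \<Longrightarrow> X + Y \<in> carrier BM"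
  using atom_classes_carrier CG.mset_prod_union[of X Y] by (auto simp: carrier_BM)

lemma units_BC: "cat_units BC = {{#}}"
  by (auto simp: cat_units_def cat_inverse_def mem_hom_set)

lemma atoms_BC: "X \<in> atoms BC \<longleftrightarrow> batom X"
  by (auto simp: atoms_def units_BC batom_def)

text \<open>Splittings of an element of \<open>H\<close> and of its block correspond by
  \<open>H_split\<close>. Consequently the block alone decides whether an element of
  \<open>H\<close> is an atom.\<close>

lemma atoms_HC: "u \<in> atoms HC \<longleftrightarrow> u \<in> H \<and> batom (block u)"
proof
  assume u: "u \<in> atoms HC"
  hence uH: "u \<in> H" and nu: "src G u \<noteq> u"
    and "\<forall>a\<in>H. \<forall>b\<in>H. tgt G a = src G b \<longrightarrow> u = a \<bullet> b \<longrightarrow> a \<in> cat_units HC \<or> b \<in> cat_units HC"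
    by (auto simp: atoms_def units_HC)
  hence max: "src G a = a \<or> src G b = b" if "a \<in> H" "b \<in> H" "tgt G a = src G b" "u = a \<bullet> b" for a b
    using that unfolding units_HC by fastforce
  have "batom (block u)"
    unfolding batom_def
  proof (intro conjI ballI impI)
    show "block u \<in> carrier BM" "block u \<noteq> {#}" using uH nu by (auto simp: block_empty_iff)
    fix Y Z assume YZ: "Y \<in> carrier BM" "Z \<in> carrier BM" "block u = Y + Z"
    then obtain b c where b: "b \<in> H" "c \<in> H" "tgt G b = src G c" "u = b \<bullet> c" "block b = Y" "block c = Z"
      using H_split[OF uH] by blast
    thus "Y = {#} \<or> Z = {#}" using max[OF b(1-4)] block_empty_iff[of b] block_empty_iff[of c] by auto
  qed
  thus "u \<in> H \<and> batom (block u)" using uH by simp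
next
  assume u: "u \<in> H \<and> batom (block u)"
  have "src G a = a \<or> src G b = b" if "a \<in> H" "b \<in> H" "tgt G a = src G b" "u = a \<bullet> b" for a b
  proof -
    have "block u = block a + block b" using that by (simp add: block_cmp)
    hence "block a = {#} \<or> block b = {#}" using u that(1,2) unfolding batom_def by auto
    thus ?thesis using that(1,2) by (simp add: block_empty_iff)
  qed
  moreover have "src G u \<noteq> u" using u block_empty_iff[of u] unfolding batom_def by auto
  ultimately show "u \<in> atoms HC" using u by (auto simp: atoms_def units_HC)
qed

section \<open>Connectedness of the fibers\<close>

text \<open>Lists of atoms of \<open>H\<close> with product \<open>a\<close>. Together with the
  identity \<open>src G a\<close> they are the rigid factorizations of \<open>a\<close>, see
  \<open>facs_of_HC\<close>.\<close>

inductive hfac :: "'a \<Rightarrow> 'a list \<Rightarrow> bool" where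
  Nil: "\<lbrakk>e \<in> H; src G e = e\<rbrakk> \<Longrightarrow> hfac e []"
| Cons: "\<lbrakk>u \<in> atoms HC; tgt G u = src G b; hfac b us\<rbrakk> \<Longrightarrow> hfac (u \<bullet> b) (u # us)"

inductive_cases hfac_ConsE: "hfac a (u # us)"
inductive_cases hfac_NilE: "hfac a []"

lemma hatom_H [simp]: "u \<in> atoms HC \<Longrightarrow> u \<in> H"
  by (simp add: atoms_HC)

lemma hfac_H: "hfac a us \<Longrightarrow> a \<in> H"
  by (induction rule: hfac.induct) (auto intro: H_cmp)

lemma hfac_block: "hfac a us \<Longrightarrow> block a = sum_list (map block us)"
proof (induction rule: hfac.induct)
  case (Nil e) thus ?case by (simp add: block_empty_iff)
next
  case (Cons u b us) thus ?case using hfac_H[of b us] by (simp add: block_cmp)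
qed

lemma hfac_batom: "hfac a us \<Longrightarrow> X \<in> set (map block us) \<Longrightarrow> batom X"
  by (induction rule: hfac.induct) (auto simp: atoms_HC)

text \<open>\<open>H_split\<close> removes one prescribed block after the other, so even the order
  of the blocks can be chosen.\<close>

lemma hfac_lift:
  assumes "a \<in> H" "\<forall>X\<in>set Xs. batom X" "block a = sum_list Xs"
  shows "\<exists>us. hfac a us \<and> map block us = Xs"
  using assms
proof (induction Xs arbitrary: a)
  case Nil
  thus ?case by (intro exI[of _ "[]"]) (auto intro: hfac.Nil simp: block_empty_iff)
next
  case (Cons X Xs)
  obtain b c where b: "b \<in> H" "c \<in> H" "tgt G b = src G c" "a = b \<bullet> c" "block b = X" "block c = sum_list Xs"
    using H_split[of a X "sum_list Xs"] Cons.prems unfolding batom_def by auto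
  obtain us where "hfac c us" "map block us = Xs" using Cons.IH[of c] Cons.prems(2) b by auto
  thus ?case using b Cons.prems(2) by (intro exI[of _ "b # us"]) (auto intro!: hfac.Cons simp: atoms_HC)
qed

lemma hfac_lift_mset:
  assumes "a \<in> H" "\<forall>X\<in>#M. batom X" "block a = sum_mset M"
  shows "\<exists>us. hfac a us \<and> mset (map block us) = M"
proof -
  obtain Xs where "mset Xs = M" using ex_mset by blast
  moreover from this obtain us where "hfac a us" "map block us = Xs"
    using hfac_lift[of a Xs] assms by (auto simp: sum_mset_sum_list[symmetric])
  ultimately show ?thesis by (intro exI[of _ us]) (simp del: mset_map)
qed

text \<open>The elementary step inside a fiber: two neighbouring atoms are replaced by two with the
  same product and, up to order, the same blocks.\<close>

inductive mv :: "'a list \<Rightarrow> 'a list \<Rightarrow> bool" where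
  here: "\<lbrakk>u \<in> atoms HC; v \<in> atoms HC; u' \<in> atoms HC; v' \<in> atoms HC; tgt G u = src G v; tgt G u' = src G v';
    u \<bullet> v = u' \<bullet> v'; {#block u, block v#} = {#block u', block v'#}\<rbrakk> \<Longrightarrow> mv (u # v # us) (u' # v' # us)"
| there: "mv us vs \<Longrightarrow> mv (w # us) (w # vs)"

abbreviation conn where "conn \<equiv> mv\<^sup>*\<^sup>*"

lemma conn_Cons: "conn us vs \<Longrightarrow> conn (w # us) (w # vs)"
  by (induction rule: rtranclp_induct) (auto intro: mv.there rtranclp.rtrancl_into_rtrancl)

lemma mv_hfac: "mv us vs \<Longrightarrow> hfac a us \<Longrightarrow> hfac a vs"
proof (induction arbitrary: a rule: mv.induct)
  case (here u v u' v' us)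
  from here(9) obtain b where "a = u \<bullet> b" "tgt G u = src G b" "hfac b (v # us)" by (auto elim: hfac_ConsE)
  moreover from this(3) obtain c where "b = v \<bullet> c" "tgt G v = src G c" "hfac c us" by (auto elim: hfac_ConsE)
  ultimately have a: "a = u \<bullet> (v \<bullet> c)" and c: "tgt G v = src G c" "hfac c us" by auto
  have cH: "c \<in> H" using c hfac_H by blast
  have t: "tgt G v' = src G c"
    using arg_cong[OF here(7), of "tgt G"] here(1-6) c(1) by simp
  have "a = (u \<bullet> v) \<bullet> c" unfolding a using here(1,2,5) c(1) cH by simp
  also have "\<dots> = u' \<bullet> (v' \<bullet> c)" unfolding here(7) using here(3,4,6) t cH by simp
  finally show ?case using here(3,4,6) t c(2) cH by (auto intro!: hfac.Cons)
next
  case (there us vs w)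
  thus ?case by (auto elim!: hfac_ConsE intro!: hfac.Cons)
qed

lemma mv_mset: "mv us vs \<Longrightarrow> mset (map block us) = mset (map block vs)"
proof (induction rule: mv.induct)
  case (here u v u' v' us)
  thus ?case using arg_cong[OF here(8), of "\<lambda>M. M + mset (map block us)"] by (simp add: add_mset_commute)
qed simp

lemma mv_length: "mv us vs \<Longrightarrow> length us = length vs"
  by (induction rule: mv.induct) auto

lemma conn_hfac: "conn us vs \<Longrightarrow> hfac a us \<Longrightarrow> hfac a vs"
  by (induction rule: rtranclp_induct) (auto intro: mv_hfac)

lemma conn_mset: "conn us vs \<Longrightarrow> mset (map block us) = mset (map block vs)"
  by (induction rule: rtranclp_induct) (auto dest: mv_mset)

text \<open>A common left divisor \<open>t\<close> of \<open>x\<close> and \<open>y\<close> divides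
  their join, so at least the factors of \<open>t\<close> disappear from the rest of
  \<open>x\<close>. This bounds the induction measure of the next lemma.\<close>

lemma size_join_quotient:
  assumes "x \<in> I" "y \<in> I" "t \<in> I" "src G y = src G x" "src G t = src G x" "x \<preceq> t" "y \<preceq> t"
  shows "size (norms (iv (jn x y) \<bullet> x)) + size (norms t) \<le> size (norms x)"
proof -
  define m where "m = jn x y"
  have m: "m \<in> I" "src G m = src G x" "x \<preceq> m" "m \<preceq> t"
    using assms by (auto simp: m_def intro: jn_integral jn_least)
  obtain c where c: "c \<in> I" "tgt G m = src G c" "x = m \<bullet> c"
    using le_imp_ex[of x m] m assms by auto
  obtain y' where y': "y' \<in> I" "tgt G t = src G y'" "m = t \<bullet> y'"
    using le_imp_ex[of m t] m assms by auto
  have "iv m \<bullet> x = c" unfolding c(3) using m(1) c by simp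
  moreover have "norms x = norms m + norms c" unfolding c(3) using m(1) c(1,2) by (rule norms_cmp)
  moreover have "norms m = norms t + norms y'" unfolding y'(3) using assms(3) y'(1,2) by (rule norms_cmp)
  ultimately show ?thesis by (simp add: m_def)
qed

text \<open>
  The induction is on the number of norms of \<open>g\<close> where \<open>w = jn w w' \<bullet> g\<close>.
\<close>

lemma conn_same_head:
  assumes P: "\<And>b us vs. hfac b us \<Longrightarrow> hfac b vs \<Longrightarrow> mset (map block us) = M \<Longrightarrow> mset (map block vs) = M \<Longrightarrow> conn us vs"
    and M: "\<forall>X\<in>#M. batom X"
    and "w \<in> atoms HC" "w' \<in> atoms HC" "r \<in> H" "r' \<in> H" "tgt G w = src G r" "tgt G w' = src G r'"
    and "w \<bullet> r = w' \<bullet> r'" "block w = block w'" "block r = sum_mset M"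
  shows "\<exists>us vs. hfac r us \<and> hfac r' vs \<and> mset (map block us) = M \<and> mset (map block vs) = M \<and> conn (w # us) (w' # vs)"
  using assms(3-)
proof (induction "size (norms (iv (jn w w') \<bullet> w))" arbitrary: w w' r r' rule: less_induct)
  case less
  note w = less.prems(1-2) and r = less.prems(3-6) and eq = less.prems(7) and Cleq = less.prems(8) and Clr = less.prems(9)
  have [simp]: "w \<in> H" "w' \<in> H" "r \<in> H" "r' \<in> H" using w r by auto
  have s: "src G w' = src G w" using arg_cong[OF eq, of "src G"] r by simp
  have Clr': "block r' = sum_mset M"
    using arg_cong[OF eq, of block] r Cleq Clr by (simp add: block_cmp)
  define m where "m = jn w w'"
  have m[simp]: "m \<in> I" "src G m = src G w" and wm: "w \<preceq> m" "w' \<preceq> m"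
    using s by (auto simp: m_def intro: jn_integral)
  obtain g where g: "g \<in> I" "tgt G m = src G g" "w = m \<bullet> g" using le_imp_ex[of w m] wm by auto
  obtain g' where g': "g' \<in> I" "tgt G m = src G g'" "w' = m \<bullet> g'" using le_imp_ex[of w' m] wm s by auto
  have gm: "g = iv m \<bullet> w" unfolding g(3) using g(1,2) by simp
  have Clg: "block g' = block g"
    using Cleq g(1,2) g'(1,2) unfolding g(3) g'(3) by (simp add: block_cmp)
  have jg: "jn g g' = src G g"
  proof -
    have "m \<bullet> jn g g' = jn (m \<bullet> g) (m \<bullet> g')" using g(1,2) g'(1,2) by (intro lmult_jn) auto
    also have "\<dots> = m \<bullet> tgt G m" unfolding g(3)[symmetric] g'(3)[symmetric] by (simp add: m_def[symmetric])
    finally have "jn g g' = tgt G m" by (rule iffD1[OF cancel_left, rotated -1]) (use g(1,2) g'(1,2) in auto)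
    thus ?thesis using g(2) by simp
  qed
  have sg: "src G g' = src G g" using g(2) g'(2) by simp
  define c where "c = iv g \<bullet> mt g g'"
  define c' where "c' = iv g' \<bullet> mt g g'"
  have c: "c \<in> I" "tgt G g = src G c" "mt g g' = g \<bullet> c"
    using le_iff_integral[of "mt g g'" g] g(1) g'(1) sg by (auto simp: c_def)
  have c': "c' \<in> I" "tgt G g' = src G c'" "mt g g' = g' \<bullet> c'"
    using le_iff_integral[of "mt g g'" g'] g(1) g'(1) sg by (auto simp: c'_def)
  \<comment> \<open>The interval from the meet to \<open>g\<close> is perspective to the one from
    \<open>g'\<close> to the identity. So \<open>c\<close> has the norms of \<open>g'\<close>, hence
    the block of \<open>g\<close>, though its norms may differ from those of
    \<open>g\<close>.\<close>
  have "norms c = norms g'" unfolding c_def using g(1) g'(1) sg jg by (intro norms_transpose) auto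
  hence Clc: "block c = block g" using Clg by (simp add: block_def)
  have "norms (iv g' \<bullet> mt g' g) = norms g"
    using g(1) g'(1) sg jg jn_comm[of g g'] by (intro norms_transpose) auto
  hence "norms c' = norms g" using mt_comm[of g g'] sg by (simp add: c'_def)
  hence Clc': "block c' = block g" by (simp add: block_def)
  have mtw: "mt w w' = m \<bullet> mt g g'"
    unfolding g(3) g'(3) using g(1,2) g'(1,2) by (intro lmult_mt[symmetric]) auto
  have "w \<bullet> r \<preceq> mt w w'"
  proof (rule mt_greatest)
    show "w \<bullet> r \<preceq> w" using r by (intro le_left) auto
    show "w \<bullet> r \<preceq> w'" unfolding eq using r by (intro le_left) auto
  qed (use r s in auto)
  then obtain q where q: "q \<in> I" "tgt G (mt w w') = src G q" "w \<bullet> r = mt w w' \<bullet> q"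
    using le_imp_ex[of "w \<bullet> r" "mt w w'"] r s by auto
  have tc: "tgt G c = src G q" using q(2) g(1,2) c(1,2) unfolding mtw c(3) by simp
  have tc': "tgt G c' = src G q" using q(2) g'(1,2) c'(1,2) unfolding mtw c'(3) by simp
  have rc: "r = c \<bullet> q"
  proof (rule iffD1[OF cancel_left, of w])
    have tw: "tgt G w = src G c" using g(1,2) c(2) unfolding g(3) by simp
    have "w \<bullet> r = m \<bullet> (g \<bullet> c) \<bullet> q" by (simp only: q(3) mtw c(3))
    also have "\<dots> = (m \<bullet> g) \<bullet> (c \<bullet> q)" using g(1,2) c(1,2) tc q(1) by simp
    finally show "w \<bullet> r = w \<bullet> (c \<bullet> q)" unfolding g(3)[symmetric] .
    show "tgt G w = src G (c \<bullet> q)" "c \<bullet> q \<in> carrier G" using tw c(1) tc q(1) by auto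
  qed (use r in auto)
  have rc': "r' = c' \<bullet> q"
  proof (rule iffD1[OF cancel_left, of w'])
    have tw: "tgt G w' = src G c'" using g'(1,2) c'(2) unfolding g'(3) by simp
    have "w' \<bullet> r' = m \<bullet> (g' \<bullet> c') \<bullet> q" by (simp only: eq[symmetric] q(3) mtw c'(3))
    also have "\<dots> = (m \<bullet> g') \<bullet> (c' \<bullet> q)" using g'(1,2) c'(1,2) tc' q(1) by simp
    finally show "w' \<bullet> r' = w' \<bullet> (c' \<bullet> q)" unfolding g'(3)[symmetric] .
    show "tgt G w' = src G (c' \<bullet> q)" "c' \<bullet> q \<in> carrier G" using tw c'(1) tc' q(1) by auto
  qed (use r in auto)
  have szg: "size (norms (iv (jn w w') \<bullet> w)) = size (block g)" unfolding m_def[symmetric] gm[symmetric] by simp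
  consider "size (block g) = 0" | "size (block g) = 1" | "size (block g) \<ge> 2" by linarith
  thus ?case
  proof cases
    case 1
    hence "block g = {#}" by (simp only: size_eq_0_iff_empty)
    hence "src G g = g" "src G g' = g'"
      using Clg block_empty_iff[OF g(1)] block_empty_iff[OF g'(1)] by simp_all
    hence "w = w'" using g(2,3) g'(2,3) by simp
    hence "r = r'" using eq by (intro iffD1[OF cancel_left, of w r r']) (use r in auto)
    obtain us where "hfac r us" "mset (map block us) = M"
      using hfac_lift_mset[of r M] M Clr by auto
    thus ?thesis using \<open>w = w'\<close> \<open>r = r'\<close> by auto
  next
    case 2
    then obtain \<gamma> where \<gamma>: "block g = {#\<gamma>#}" using size_1_singleton_mset by blast
    have Cr: "sum_mset M = add_mset \<gamma> (block q)"
      using Clr Clc \<gamma> c(1) tc q(1) unfolding rc by (simp add: block_cmp)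
    hence "\<gamma> \<in># sum_mset M" by simp
    \<comment> \<open>An atom block \<open>X\<close> of the tail contains \<open>\<gamma>\<close>.
      If \<open>p\<close> with the remaining classes of \<open>X\<close> is split off from
      \<open>q\<close>, then \<open>c \<bullet> p\<close> and \<open>c' \<bullet> p\<close> are
      atoms of \<open>H\<close> with block \<open>X\<close>, followed by the same tail
      \<open>y\<close>.\<close>
    then obtain X where X: "X \<in># M" "\<gamma> \<in># X" by (auto simp: in_Union_mset_iff)
    then obtain M' X' where M': "M = add_mset X M'" and X': "X = add_mset \<gamma> X'"
      by (metis mset_add)
    have "block q = X' + sum_mset M'" using Cr unfolding M' X' by simp
    then obtain p y where p: "p \<in> I" "y \<in> I" "tgt G p = src G y" "q = p \<bullet> y" "block p = X'" "block y = sum_mset M'"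
      using block_split[OF q(1)] by blast
    have bX: "batom X" using M X(1) by blast
    have key: "\<exists>x. x \<in> atoms HC \<and> block x = X \<and> tgt G z = src G x \<and> tgt G x = src G y \<and> d \<bullet> q = x \<bullet> y \<and> x = d \<bullet> p"
      if z: "z \<in> H" "tgt G z = src G d" "d \<in> I" "tgt G d = src G q" "block d = {#\<gamma>#}" for d z
    proof -
      have t: "tgt G d = src G p" using z(4) p(1-3) unfolding p(4) by simp
      have C: "block (d \<bullet> p) = X" using z(3,5) p(1,5) t X' by (simp add: block_cmp)
      have "src G d \<in> H" using z(1,2) H_tgt[of z] by simp
      hence "d \<bullet> p \<in> H" using C bX z(3) p(1) t by - (rule H_I, auto simp: batom_def)
      hence "d \<bullet> p \<in> atoms HC" using C bX by (simp add: atoms_HC)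
      thus ?thesis using C p(1-4) z(2,3) t by (intro exI[of _ "d \<bullet> p"]) simp
    qed
    have tw: "tgt G w = src G c" using g(1,2) c(2) unfolding g(3) by simp
    have tw': "tgt G w' = src G c'" using g'(1,2) c'(2) unfolding g'(3) by simp
    obtain x where x: "x \<in> atoms HC" "block x = X" "tgt G w = src G x" "tgt G x = src G y" "r = x \<bullet> y" "x = c \<bullet> p"
      using key[of w c] tw c(1) tc Clc \<gamma> rc by auto
    obtain x' where x': "x' \<in> atoms HC" "block x' = X" "tgt G w' = src G x'" "tgt G x' = src G y" "r' = x' \<bullet> y" "x' = c' \<bullet> p"
      using key[of w' c'] tw' c'(1) tc' Clc' \<gamma> rc' by auto
    have "x \<bullet> y \<in> H" unfolding x(5)[symmetric] by simp
    hence yH: "y \<in> H" using x(1,4) p(2) by - (rule H_right_factor[of x y], auto)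
    obtain ys where ys: "hfac y ys" "mset (map block ys) = M'"
      using hfac_lift_mset[OF yH, of M'] M p(6) unfolding M' by auto
    have sq: "tgt G c = src G p" "tgt G c' = src G p" using tc tc' p(1-3) unfolding p(4) by auto
    have "(m \<bullet> g) \<bullet> (c \<bullet> p) = m \<bullet> (g \<bullet> c) \<bullet> p" using g(1,2) c(1,2) sq p(1) by simp
    also have "\<dots> = m \<bullet> (g' \<bullet> c') \<bullet> p" by (simp only: c(3)[symmetric] c'(3)[symmetric])
    also have "\<dots> = (m \<bullet> g') \<bullet> (c' \<bullet> p)" using g'(1,2) c'(1,2) sq p(1) by simp
    finally have "w \<bullet> x = w' \<bullet> x'" unfolding g(3)[symmetric] g'(3)[symmetric] x(6)[symmetric] x'(6)[symmetric] .
    hence "mv (w # x # ys) (w' # x' # ys)"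
      using w x x' Cleq by (intro mv.here) auto
    moreover have "hfac r (x # ys)" "hfac r' (x' # ys)"
      unfolding x(5) x'(5) using x x' ys by (auto intro: hfac.Cons)
    ultimately show ?thesis using ys(2) x(2) x'(2) M'
      by (intro exI[of _ "x # ys"] exI[of _ "x' # ys"]) auto
  next
    case 3
    hence "norms g \<noteq> {#}" by auto
    then obtain p k where p: "atom p" "k \<in> I" "tgt G p = src G k" "g = p \<bullet> k"
      using norms_pull[OF g(1)] by (metis multiset_nonemptyE)
    define \<gamma> where "\<gamma> = cl (anorm p)"
    have Clp: "block p = {#\<gamma>#}" using p(1) by (simp add: block_def \<gamma>_def)
    \<comment> \<open>Only the class of \<open>p\<close> is matched in \<open>g'\<close>; no factor
      of \<open>g'\<close> need have the norm of \<open>p\<close>.\<close>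
    have Cgp: "block g' = block k + {#\<gamma>#}"
      using Clg Clp p(1-3) unfolding p(4) by (simp add: block_cmp)
    then obtain h z where h: "h \<in> I" "z \<in> I" "tgt G h = src G z" "g' = h \<bullet> z" "block h = block k"
      using block_split[OF g'(1)] by blast
    have sp: "src G p = src G g" "src G h = src G g"
      using p(1-3) h(1-3) sg unfolding p(4) h(4) by auto
    have gp: "g \<preceq> p" unfolding p(4) using p(1-3) by (intro le_left) auto
    have gh: "g' \<preceq> h" unfolding h(4) using h(1-3) by (intro le_left) auto
    have "jn g h = src G g"
      by (rule jn_mono_src[of g g']) (use g(1) g'(1) h(1) sg sp gh jg in auto)
    hence "jn h g = src G h" using jn_comm[of g h] sp by simp
    hence "jn h p = src G h"
      by (intro jn_mono_src[of h g p]) (use g(1) p(1) h(1) sp gp in auto)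
    hence jp: "jn p h = src G p" using jn_comm[of p h] sp by simp
    define g2 where "g2 = mt p h"
    have g2: "g2 \<in> I" "src G g2 = src G g" "g2 \<preceq> p" "g2 \<preceq> h"
      using p(1) h(1) sp by (auto simp: g2_def intro: mt_integral)
    obtain c2 where c2: "c2 \<in> I" "tgt G p = src G c2" "g2 = p \<bullet> c2"
      using le_imp_ex[of g2 p] g2 p(1) sp by auto
    \<comment> \<open>As \<open>p\<close> and \<open>h\<close> lie above \<open>g\<close> and
      \<open>g'\<close>, their join is the identity, and the cofactor of \<open>p\<close> in
      \<open>g2\<close> has the norms of \<open>h\<close>. Thus the block of \<open>g2\<close> is
      that of \<open>p\<close> plus that of \<open>h\<close>, which is the block of
      \<open>g\<close>.\<close>
    have "norms (iv p \<bullet> mt p h) = norms h" using p(1) h(1) sp jp by (intro norms_transpose) auto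
    moreover have "iv p \<bullet> mt p h = c2" unfolding g2_def[symmetric] c2(3) using p(1) c2(1,2) by simp
    ultimately have "norms c2 = norms h" by simp
    hence "block c2 = block k" using h(5) by (simp add: block_def)
    hence Clg2: "block g2 = block g" using Clp c2(1,2) p(1-3) unfolding c2(3) p(4) by (simp add: block_cmp)
    define v where "v = m \<bullet> g2"
    have v[simp]: "v \<in> I" "src G v = src G w" using g2 g(2) by (auto simp: v_def)
    have Clv: "block v = block w" using g2(1,2) g(1,2) Clg2 unfolding v_def g(3) by (simp add: block_cmp)
    have vH: "v \<in> H" using Clv by - (rule H_I, auto)
    have va: "v \<in> atoms HC" using vH Clv w(1) by (simp add: atoms_HC)
    have "mt g g' \<preceq> g2"
    proof -
      have "mt g g' \<preceq> p" using g(1) g'(1) sg sp p(1) gp by - (rule le_trans[of _ g], auto)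
      moreover have "mt g g' \<preceq> h" using g(1) g'(1) sg sp h(1) gh by - (rule le_trans[of _ g'], auto)
      ultimately show ?thesis unfolding g2_def using g(1) g'(1) sg sp p(1) h(1) by (intro mt_greatest) auto
    qed
    hence mv: "mt w w' \<preceq> v" unfolding mtw v_def using g(1,2) g'(1) sg g2 by (intro lmult) auto
    have "w \<bullet> r \<preceq> mt w w'" unfolding q(3) using s q(1,2) by (intro le_left) auto
    hence "w \<bullet> r \<preceq> v" using mv s r by - (rule le_trans[of _ "mt w w'"], auto)
    then obtain r2 where r2: "r2 \<in> I" "tgt G v = src G r2" "w \<bullet> r = v \<bullet> r2"
      using le_imp_ex[of "w \<bullet> r" v] r by auto
    have "w \<bullet> r \<in> H" using r by (intro H_cmp) auto
    hence r2H: "r2 \<in> H" using H_right_factor[OF vH r2(1,2)] r2(3) by simp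
    have Clr2: "block r2 = sum_mset M"
      using arg_cong[OF r2(3), of block] r r2(1,2) Clv Clr by (simp add: block_cmp)
    have szw: "size (norms w) = size (norms m) + size (block g)"
      unfolding g(3) using g(1,2) by (simp add: norms_cmp)
    \<comment> \<open>Both \<open>w\<close> and \<open>v\<close> lie below
      \<open>m \<bullet> p\<close>, so their join has at least one factor more than
      \<open>m\<close>.\<close>
    have m1: "size (norms (iv (jn w v) \<bullet> w)) < size (norms (iv (jn w w') \<bullet> w))"
    proof -
      have "size (norms (iv (jn w v) \<bullet> w)) + size (norms (m \<bullet> p)) \<le> size (norms w)"
      proof (rule size_join_quotient)
        show "w \<preceq> m \<bullet> p" unfolding g(3) using g(1,2) p(1) sp gp by (intro lmult) auto
        show "v \<preceq> m \<bullet> p" unfolding v_def using g(2) g2 p(1) sp by (intro lmult) auto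
      qed (use g(2) sp p(1) in auto)
      moreover have "size (norms (m \<bullet> p)) = Suc (size (norms m))" using g(2) sp p(1) by (simp add: norms_cmp)
      ultimately show ?thesis using szw szg by simp
    qed
    \<comment> \<open>Both \<open>v\<close> and \<open>w'\<close> lie below
      \<open>m \<bullet> h\<close>, and \<open>h\<close> has one factor less than \<open>g\<close>.
      The measure is therefore at most 1, which is a decrease because the block of \<open>g\<close>
      has at least two elements.\<close>
    have m2: "size (norms (iv (jn v w') \<bullet> v)) < size (norms (iv (jn w w') \<bullet> w))"
    proof -
      have "size (norms (iv (jn v w') \<bullet> v)) + size (norms (m \<bullet> h)) \<le> size (norms v)"
      proof (rule size_join_quotient)
        show "w' \<preceq> m \<bullet> h" unfolding g'(3) using g'(1,2) h(1) sg sp gh by (intro lmult) auto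
        show "v \<preceq> m \<bullet> h" unfolding v_def using g(2) g2 h(1) sp by (intro lmult) auto
      qed (use g(2) sp h(1) s in auto)
      moreover have "size (norms (m \<bullet> h)) = size (norms m) + size (norms h)" using g(2) sp h(1) by (simp add: norms_cmp)
      moreover have "size (block g) = Suc (size (norms h))"
        using arg_cong[OF Cgp, of size] Clg h(5) size_block[of h] by simp
      moreover have "size (norms v) = size (norms w)" using arg_cong[OF Clv, of size] by simp
      ultimately show ?thesis using szw szg 3 by simp
    qed
    obtain us1 vs1 where 1: "hfac r us1" "hfac r2 vs1" "mset (map block us1) = M" "mset (map block vs1) = M"
      "conn (w # us1) (v # vs1)"
      using less.hyps[OF m1 w(1) va r(1) r2H r(3) r2(2,3) Clv[symmetric] Clr] by blast
    have e2: "v \<bullet> r2 = w' \<bullet> r'" using r2(3) eq by simp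
    have C2: "block v = block w'" using Clv Cleq by simp
    obtain us2 vs2 where 2: "hfac r2 us2" "hfac r' vs2" "mset (map block us2) = M" "mset (map block vs2) = M"
      "conn (v # us2) (w' # vs2)"
      using less.hyps[OF m2 va w(2) r2H r(2) r2(2) r(4) e2 C2 Clr2] by blast
    \<comment> \<open>The two halves may end and begin with different factorizations of
      \<open>r2\<close>; the hypothesis on shorter lists joins them behind the common head
      \<open>v\<close>.\<close>
    have "conn (v # vs1) (v # us2)" using P 1 2 by (intro conn_Cons) blast
    hence "conn (w # us1) (w' # vs2)" using 1(5) 2(5) by (meson rtranclp_trans)
    thus ?thesis using 1 2 by blast
  qed
qed

text \<open>Heads with equal blocks are handled by \<open>conn_same_head\<close>, whose hypothesis
  on tails is the induction hypothesis. Otherwise the tail of \<open>us\<close> is moved so that an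
  atom with the block of \<open>w'\<close> comes second; splitting its product with \<open>w\<close>
  in the other order brings this block to the front.\<close>

theorem hfac_conn:
  assumes "hfac a us" "hfac a vs" "mset (map block us) = mset (map block vs)"
  shows "conn us vs"
  using assms
proof (induction "length us" arbitrary: a us vs)
  case 0
  hence "us = []" "vs = []" by auto
  thus ?case by simp
next
  case (Suc n)
  have same: "conn (w # us1) (w' # vs1)"
    if st: "hfac a (w # us1)" "hfac a (w' # vs1)" "length us1 = n" "mset (map block (w # us1)) = mset (map block (w' # vs1))" "block w = block w'"
    for w us1 w' vs1
  proof -
    obtain r where r: "w \<in> atoms HC" "tgt G w = src G r" "hfac r us1" "a = w \<bullet> r" using st(1) by (auto elim: hfac_ConsE)
    obtain r' where r': "w' \<in> atoms HC" "tgt G w' = src G r'" "hfac r' vs1" "a = w' \<bullet> r'" using st(2) by (auto elim: hfac_ConsE)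
    define M where "M = mset (map block us1)"
    have M': "mset (map block vs1) = M" using st(4,5) by (simp add: M_def)
    have szM: "length xs = n" if "mset (map block xs) = M" for xs
      using arg_cong[OF that, of size] \<open>length us1 = n\<close> by (simp add: M_def)
    have "\<exists>us vs. hfac r us \<and> hfac r' vs \<and> mset (map block us) = M \<and> mset (map block vs) = M \<and> conn (w # us) (w' # vs)"
    proof (rule conn_same_head)
      show "conn us vs" if "hfac b us" "hfac b vs" "mset (map block us) = M" "mset (map block vs) = M" for b us vs
        using Suc.hyps(1)[of us b vs] szM[OF that(3)] that by simp
      show "\<forall>X\<in>#M. batom X" using hfac_batom[OF r(3)] by (auto simp: M_def)
      show "block r = sum_mset M" using hfac_block[OF r(3)] by (simp add: M_def sum_mset_sum_list[symmetric])
    qed (use r r' st(5) hfac_H in auto)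
    then obtain us2 vs2 where 2: "hfac r us2" "hfac r' vs2" "mset (map block us2) = M" "mset (map block vs2) = M" "conn (w # us2) (w' # vs2)"
      by blast
    have "conn us1 us2" using Suc.hyps(1)[of us1 r us2] st(3) r(3) 2 by (simp add: M_def)
    moreover have "conn vs2 vs1" using Suc.hyps(1)[of vs2 r' vs1] szM[OF 2(4)] r'(3) 2 M' by simp
    ultimately show ?thesis using 2(5) conn_Cons[of us1 us2 w] conn_Cons[of vs2 vs1 w'] by (meson rtranclp_trans)
  qed
  obtain w us1 where us: "us = w # us1" using Suc.hyps(2) by (cases us) auto
  have len: "length us1 = n" using Suc.hyps(2) us by simp
  obtain w' vs1 where vs: "vs = w' # vs1" using Suc.prems(3) us by (cases vs) auto
  show ?case
  proof (cases "block w = block w'")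
    case True
    thus ?thesis using same[of w us1 w' vs1] Suc.prems len us vs by simp
  next
    case False
    obtain r where r: "w \<in> atoms HC" "tgt G w = src G r" "hfac r us1" "a = w \<bullet> r"
      using Suc.prems(1) us by (auto elim: hfac_ConsE)
    have "block w' \<in># mset (map block (w # us1))" unfolding Suc.prems(3)[unfolded us vs] by simp
    hence "block w' \<in># mset (map block us1)" using False by auto
    then obtain M' where M': "mset (map block us1) = add_mset (block w') M'" by (metis mset_add)
    obtain Xs where Xs: "mset Xs = M'" using ex_mset by blast
    have "\<exists>us. hfac r us \<and> map block us = block w' # Xs"
    proof (rule hfac_lift)
      show "r \<in> H" using r(3) hfac_H by blast
      have ms: "mset (map block us1) = mset (block w' # Xs)" using M' Xs by simp
      show "\<forall>X\<in>set (block w' # Xs). batom X"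
        using hfac_batom[OF r(3)] mset_eq_setD[OF ms] by blast
      show "block r = sum_list (block w' # Xs)"
        using hfac_block[OF r(3)] ms by (metis sum_mset_sum_list)
    qed
    then obtain x us2 where x: "hfac r (x # us2)" "block x = block w'" "map block us2 = Xs" by (auto simp: Cons_eq_map_conv map_eq_Cons_conv)
    have c1: "conn us1 (x # us2)"
      using Suc.hyps(1)[of us1 r "x # us2"] len r(3) x M' Xs by simp
    obtain y where y: "x \<in> atoms HC" "tgt G x = src G y" "hfac y us2" "r = x \<bullet> y" using x(1) by (auto elim: hfac_ConsE)
    have yH: "y \<in> H" using y(3) hfac_H by blast
    have wx: "tgt G w = src G x" using r(1,2) y(1,2) yH unfolding y(4) by simp
    have "w \<bullet> x \<in> H" using r(1) y(1) wx by (intro H_cmp) auto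
    moreover have "block (w \<bullet> x) = block x + block w" using r(1) y(1) wx by (simp add: block_cmp)
    moreover have "block x \<in> carrier BM" using y(1) by simp
    ultimately obtain w1 x1 where w1: "w1 \<in> H" "x1 \<in> H" "tgt G w1 = src G x1" "w \<bullet> x = w1 \<bullet> x1" "block w1 = block x" "block x1 = block w"
      using H_split by blast
    have at: "w1 \<in> atoms HC" "x1 \<in> atoms HC" using w1 y(1) r(1) by (auto simp: atoms_HC)
    have c2: "mv (w # x # us2) (w1 # x1 # us2)" using r(1) y(1) at wx w1 by (intro mv.here) auto
    have h: "hfac a (w # x # us2)" unfolding r(4) using r(1,2) x(1) by (intro hfac.Cons) auto
    have h1: "hfac a (w1 # x1 # us2)" using mv_hfac[OF c2 h] .
    have c12: "conn us (w1 # x1 # us2)"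
      unfolding us using conn_Cons[OF c1, of w] c2 by (rule rtranclp.rtrancl_into_rtrancl)
    have "length (x1 # us2) = n"
      using arg_cong[OF M', of size] len Xs x(3) by (metis length_Cons length_map size_add_mset size_mset)
    hence "conn (w1 # x1 # us2) (w' # vs1)"
      using same[of w1 "x1 # us2" w' vs1] h1 Suc.prems(2,3) vs w1(5) x(2) conn_mset[OF c12] by simp
    thus ?thesis using c12 vs by (meson rtranclp_trans)
  qed
qed

section \<open>Rigid factorizations of the subcategory and of the block monoid\<close>

lemma composable_HC [simp]: "composable HC e us = composable G e us"
  by (induction us arbitrary: e) auto

sublocale HC: reduced_category "G\<lparr>carrier := H\<rparr>"
proof
  show "cat_units HC \<subseteq> identities HC"
    by (auto simp: units_HC identities_def) (metis H_integral integral_carrier tgt_src)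
qed (use H_nonempty in \<open>auto intro: H_cmp\<close>)

sublocale BC: reduced_category "block_cat G H"
  by unfold_locales (auto simp: units_BC identities_def plus_BM intro: empty_BM)

lemma hfac_append: "\<lbrakk>hfac b xs; hfac c us; tgt G b = src G c\<rbrakk> \<Longrightarrow> hfac (b \<bullet> c) (xs @ us)"
proof (induction rule: hfac.induct)
  case (Nil e)
  have "tgt G e = e" using tgt_src[of e] Nil(1,2) by simp
  thus ?case using Nil id_left[of c e] hfac_H[of c us] by simp
next
  case (Cons u b xs)
  have "b \<in> H" "c \<in> H" using Cons hfac_H by auto
  thus ?case using Cons hfac.Cons[of u "b \<bullet> c" "xs @ us"] by simp
qed

lemma hfac_iff:
  "e \<in> carrier G \<Longrightarrow> src G e = e \<Longrightarrow> hfac a us \<and> src G a = e \<longleftrightarrow>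
    e \<in> H \<and> set us \<subseteq> atoms HC \<and> composable G e us \<and> foldl (cmp G) e us = a"
proof -
  assume e: "e \<in> carrier G" "src G e = e"
  have "hfac a us \<and> src G a = e \<longleftrightarrow> e \<in> H \<and> set us \<subseteq> atoms HC \<and> composable G e us \<and> lprod e us = a"
    using e
  proof (induction us arbitrary: a e)
    case Nil
    thus ?case by (auto elim: hfac_NilE intro: hfac.Nil)
  next
    case (Cons u us)
    have IH: "hfac b us \<and> src G b = tgt G u \<longleftrightarrow> tgt G u \<in> H \<and> set us \<subseteq> atoms HC \<and> composable G (tgt G u) us
        \<and> lprod (tgt G u) us = b" if "u \<in> H" for b
      using Cons.IH[of "tgt G u" b] that by simp
    show ?case
    proof
      assume a: "hfac a (u # us) \<and> src G a = e"
      then obtain b where b: "u \<in> atoms HC" "tgt G u = src G b" "hfac b us" "a = u \<bullet> b" by (auto elim: hfac_ConsE)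
      have "b \<in> H" using b(3) hfac_H by blast
      have "src G u = e" using a b \<open>b \<in> H\<close> by simp
      moreover have "e \<in> H" using a hfac_H H_src by blast
      ultimately show "e \<in> H \<and> set (u # us) \<subseteq> atoms HC \<and> composable G e (u # us) \<and> lprod e (u # us) = a"
        using IH[of b] b by auto
    next
      assume a: "e \<in> H \<and> set (u # us) \<subseteq> atoms HC \<and> composable G e (u # us) \<and> lprod e (u # us) = a"
      hence "hfac (lprod (tgt G u) us) us \<and> src G (lprod (tgt G u) us) = tgt G u"
        using IH[of "lprod (tgt G u) us"] by auto
      thus "hfac a (u # us) \<and> src G a = e"
        using a hfac.Cons[of u "lprod (tgt G u) us" us] hfac_H[of "lprod (tgt G u) us" us] by auto
    qed
  qed
  moreover have "foldl (cmp G) e us = lprod e us" if "set us \<subseteq> atoms HC" "composable G e us"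
    using that e by (intro foldl_identity) auto
  ultimately show ?thesis by auto
qed

lemma rtuples_HC: "(e, us) \<in> rtuples HC \<and> rtuple_prod HC (e, us) = a \<longleftrightarrow> e = src G a \<and> hfac a us"
proof -
  have *: "(e, us) \<in> rtuples HC \<and> rtuple_prod HC (e, us) = a \<longleftrightarrow> e \<in> H \<and> src G e = e \<and> set us \<subseteq> atoms HC \<and> composable G e us \<and> foldl (cmp G) e us = a"
    by (auto simp: HC.rtuples_iff rtuple_prod_def)
  show ?thesis
  proof (cases "e \<in> carrier G \<and> src G e = e")
    case True thus ?thesis using hfac_iff[of e a us] * by auto
  next
    case False
    moreover have "src G a \<in> carrier G \<and> src G (src G a) = src G a" if "hfac a us" using hfac_H[OF that] by simp
    ultimately show ?thesis using * by auto
  qed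
qed

lemma facs_of_HC: "facs_of HC a = {{(src G a, us)} | us. hfac a us}"
proof -
  have "facs_of HC a = {{(e, us)} | e us. (e, us) \<in> rtuples HC \<and> rtuple_prod HC (e, us) = a}"
    by (auto simp: HC.facs_of_eq)
  thus ?thesis unfolding rtuples_HC by auto
qed

lemma hfac_rtuple: "hfac a us \<Longrightarrow> (src G a, us) \<in> rtuples HC"
  using rtuples_HC by blast

lemma facs_of_BC: "facs_of BC A = {{({#}, Xs)} | Xs. set Xs \<subseteq> Collect batom \<and> sum_list Xs = A}"
proof -
  have c: "composable BC {#} Xs" for Xs by (induction Xs) auto
  have p: "foldl (cmp BC) B Xs = B + sum_list Xs" for Xs B by (induction Xs arbitrary: B) (auto simp: add.assoc)
  have at: "atoms BC = Collect batom" using atoms_BC by blast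
  have "(e, Xs) \<in> rtuples BC \<and> rtuple_prod BC (e, Xs) = A \<longleftrightarrow> e = {#} \<and> set Xs \<subseteq> Collect batom \<and> sum_list Xs = A" for e Xs
    by (auto simp: BC.rtuples_iff rtuple_prod_def p c at)
  moreover have "facs_of BC A = {{(e, us)} | e us. (e, us) \<in> rtuples BC \<and> rtuple_prod BC (e, us) = A}"
    by (auto simp: BC.facs_of_eq)
  ultimately show ?thesis by auto
qed

lemma perm_dist_BC: "perm_dist BC {({#}, Xs)} {({#}, Ys)} = list_dist Xs Ys"
proof -
  have "cat_associated BC X Y \<longleftrightarrow> X = Y" for X Y
    by (auto simp: cat_associated_def units_BC)
  thus ?thesis by (simp add: perm_dist_def rtuple_perm_dist_def list_dist_def card_matchings_def Let_def)
qed

lemma fac_map_HC: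
  assumes "hfac a us"
  shows "fac_map HC BC (block_hom G H) {(src G a, us)} = {({#}, map block us)}"
proof -
  have a: "a \<in> H" using assms by (rule hfac_H)
  have us: "set us \<subseteq> H" using assms by (induction rule: hfac.induct) auto
  have "block_hom G H (src G a) = {#}" using a block_hom_eq[of "src G a"] block_empty_iff[of "src G a"] by simp
  moreover have "map (block_hom G H) us = map block us" using us by (auto simp: block_hom_eq)
  moreover have "({#}, map block us) \<in> rtuples BC"
  proof -
    have "{({#}, map block us)} \<in> facs_of BC (block a)"
      unfolding facs_of_BC using hfac_batom[OF assms] hfac_block[OF assms] by auto
    thus ?thesis by (auto simp: BC.facs_of_eq)
  qed
  ultimately show ?thesis by (simp add: fac_map_def BC.rclass_eq del: map_eq_conv)
qed

lemma rtuple_tgt_HC: "hfac a us \<Longrightarrow> rtuple_tgt HC (src G a, us) = tgt G a"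
proof (induction rule: hfac.induct)
  case (Nil e) thus ?case by (simp add: rtuple_tgt_def)
next
  case (Cons u b us)
  have "b \<in> H" using Cons hfac_H by auto
  moreover from Cons(3) have "us = [] \<Longrightarrow> src G b = b" by (auto elim: hfac_NilE)
  moreover have "us = [] \<Longrightarrow> tgt G b = b"
    using calculation tgt_src[of b] by simp
  ultimately show ?case using Cons by (auto simp: rtuple_tgt_def split: if_splits)
qed

lemma tgt_Zstar_HC: "hfac a us \<Longrightarrow> tgt (Zstar HC) {(src G a, us)} = {(tgt G a, [])}"
  using HC.tgt_Zstar[of "(src G a, us)"] rtuple_tgt_HC[of a us] hfac_H[of a us] by (simp add: HC.rtuples_iff)

lemma src_Zstar_HC: "hfac a us \<Longrightarrow> src (Zstar HC) {(src G a, us)} = {(src G a, [])}"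
  using HC.src_Zstar[of "(src G a, us)"] hfac_rtuple[of a us] by simp

text \<open>The unit absorbed at the junction is the identity \<open>src G c\<close>, so
  multiplication of factorizations is concatenation of lists.\<close>

lemma cmp_Zstar_HC:
  assumes "hfac b xs" "hfac c us" "tgt G b = src G c"
  shows "cmp (Zstar HC) {(src G b, xs)} {(src G c, us)} = {(src G b, xs @ us)}"
proof -
  have b: "b \<in> H" "c \<in> H" using assms hfac_H by auto
  have m: "rtuple_mult HC (src G b, xs) (src G c, us) = (src G b, xs @ us)"
  proof (cases "xs = []")
    case True
    hence "src G b = b" using assms(1) by (auto elim: hfac_NilE)
    hence "tgt G b = b" using tgt_src[of b] b by simp
    hence "src G b = src G c" using \<open>src G b = b\<close> assms(3) by simp
    thus ?thesis using True b by (simp add: rtuple_mult_def)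
  next
    case False
    have "tgt G (last xs) = src G c" using rtuple_tgt_HC[OF assms(1)] False assms(3) by (simp add: rtuple_tgt_def)
    moreover have "last xs \<in> carrier G"
      using hfac_rtuple[OF assms(1)] last_in_set[OF False] HC.atoms_carrier by (auto simp: HC.rtuples_iff)
    ultimately have "last xs \<bullet> src G c = last xs" by simp
    hence "butlast xs @ (last xs \<bullet> src G c) # us = xs @ us"
      using append_butlast_last_id[OF False] by (metis append.assoc append_Cons append_Nil)
    thus ?thesis using False by (simp add: rtuple_mult_def)
  qed
  have "(src G b, xs @ us) \<in> rtuples HC"
    using hfac_rtuple[OF hfac_append[OF assms]] b assms(3) by simp
  thus ?thesis using HC.cmp_Zstar[of "(src G b, xs)" "(src G c, us)"] m by simp
qed

text \<open>The only unit of the block monoid is the empty multiset. So (T1) asks for surjectivity,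
  which follows from \<open>block_realize\<close>, and for a trivial kernel, and (T2) is
  \<open>H_split\<close>.\<close>

lemma transfer_hom_block: "transfer_hom HC BC (block_hom G H)"
  unfolding transfer_hom_def
proof (intro conjI ballI impI)
  have \<theta>: "block_hom G H a = block a" if "a \<in> H" for a using that by (simp add: block_hom_eq)
  show "cancellative_category HC"
  proof unfold_locales
    fix a b c assume "a \<in> carrier HC" "b \<in> carrier HC" "c \<in> carrier HC" "tgt HC a = src HC b" "tgt HC a = src HC c"
      "a \<bullet>\<^bsub>HC\<^esub> b = a \<bullet>\<^bsub>HC\<^esub> c"
    thus "b = c" using cancel_left[of a b c] by simp
  next
    fix a b c assume "a \<in> carrier HC" "b \<in> carrier HC" "c \<in> carrier HC" "tgt HC b = src HC a" "tgt HC c = src HC a"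
      "b \<bullet>\<^bsub>HC\<^esub> a = c \<bullet>\<^bsub>HC\<^esub> a"
    thus "b = c" using cancel_right[of a b c] by simp
  qed
  show "cancellative_category BC" by unfold_locales simp_all
  show "block_hom G H \<in> cat_hom HC BC"
    using block_empty_iff by (auto simp: cat_hom_def \<theta> H_cmp block_cmp)
  have "\<exists>a\<in>H. X = block a" if X: "X \<in> carrier BM" for X
  proof -
    obtain e where e: "e \<in> H" using H_nonempty by auto
    obtain a where "a \<in> I" "src G a = src G e" "block a = X"
      using block_realize[of X "src G e"] X e unfolding carrier_BM by auto
    hence "a \<in> H" using e X by - (rule H_I, auto)
    thus ?thesis using \<open>block a = X\<close> by auto
  qed
  hence "carrier BC = block_hom G H ` carrier HC" by (auto simp: image_iff \<theta>)
  thus "carrier BC = cat_set_mult BC (cat_set_mult BC (cat_units BC) (block_hom G H ` carrier HC)) (cat_units BC)"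
    by (auto simp: cat_set_mult_def units_BC)
  show "{a \<in> carrier HC. block_hom G H a \<in> cat_units BC} = cat_units HC"
    by (auto simp: units_BC units_HC \<theta> block_empty_iff)
  fix a b1 b2 assume "a \<in> carrier HC" "b1 \<in> carrier BC" "b2 \<in> carrier BC" "block_hom G H a = b1 \<bullet>\<^bsub>BC\<^esub> b2"
  hence a: "a \<in> H" "b1 \<in> carrier BM" "block a = b1 + b2" by (auto simp: \<theta>)
  obtain b c where "b \<in> H" "c \<in> H" "tgt G b = src G c" "a = b \<bullet> c" "block b = b1" "block c = b2"
    using H_split[OF a(1,3,2)] by blast
  moreover have "cat_inv BC {#} = {#}" by (rule BC.cat_inv_unit) (simp add: units_BC)
  ultimately show "\<exists>a1\<in>carrier HC. \<exists>a2\<in>carrier HC. \<exists>\<epsilon>\<in>cat_units BC.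
        tgt HC a1 = src HC a2 \<and> a = a1 \<bullet>\<^bsub>HC\<^esub> a2 \<and> tgt BC \<epsilon> = src BC b2 \<and>
        block_hom G H a1 = b1 \<bullet>\<^bsub>BC\<^esub> cat_inv BC \<epsilon> \<and> block_hom G H a2 = \<epsilon> \<bullet>\<^bsub>BC\<^esub> b2"
    by (intro bexI[of _ b] bexI[of _ c] bexI[of _ "{#}"]) (auto simp: \<theta> units_BC)
qed

end

section \<open>Distances and the lifting of chains\<close>

locale saturated_distance = saturated_subcategory +
  fixes d :: "'a rfac \<Rightarrow> 'a rfac \<Rightarrow> nat"
  assumes distance: "is_distance (G\<lparr>carrier := H\<rparr>) d"
begin

definition D :: "'a \<Rightarrow> 'a list \<Rightarrow> 'a list \<Rightarrow> nat"
  where "D e us vs = d {(e, us)} {(e, vs)}"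

lemma facs_of_mem: "hfac a us \<Longrightarrow> {(src G a, us)} \<in> facs_of HC a"
  by (auto simp: facs_of_HC)

lemma D_refl: "hfac a us \<Longrightarrow> D (src G a) us us = 0"
  using distance facs_of_mem unfolding is_distance_def D_def by blast

lemma D_left:
  assumes "hfac b xs" "hfac c us" "hfac c vs" "tgt G b = src G c"
  shows "D (src G b) (xs @ us) (xs @ vs) = D (src G c) us vs"
proof -
  have "{(src G b, xs)} \<in> carrier (Zstar HC)" using hfac_rtuple[OF assms(1)] by (auto simp: HC.carrier_Zstar)
  moreover have "tgt (Zstar HC) {(src G b, xs)} = src (Zstar HC) {(src G c, us)}"
    using assms by (simp add: tgt_Zstar_HC src_Zstar_HC)
  ultimately have "d ({(src G b, xs)} \<bullet>\<^bsub>Zstar HC\<^esub> {(src G c, us)}) ({(src G b, xs)} \<bullet>\<^bsub>Zstar HC\<^esub> {(src G c, vs)})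
      = d {(src G c, us)} {(src G c, vs)}"
    using distance facs_of_mem[OF assms(2)] facs_of_mem[OF assms(3)] unfolding is_distance_def by blast
  thus ?thesis using assms by (simp add: cmp_Zstar_HC D_def)
qed

lemma D_right:
  assumes "hfac c us" "hfac c vs" "hfac b ys" "tgt G c = src G b"
  shows "D (src G c) (us @ ys) (vs @ ys) = D (src G c) us vs"
proof -
  have "{(src G b, ys)} \<in> carrier (Zstar HC)" using hfac_rtuple[OF assms(3)] by (auto simp: HC.carrier_Zstar)
  moreover have "tgt (Zstar HC) {(src G c, us)} = src (Zstar HC) {(src G b, ys)}"
    using assms by (simp add: tgt_Zstar_HC src_Zstar_HC)
  ultimately have "d ({(src G c, us)} \<bullet>\<^bsub>Zstar HC\<^esub> {(src G b, ys)}) ({(src G c, vs)} \<bullet>\<^bsub>Zstar HC\<^esub> {(src G b, ys)})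
      = d {(src G c, us)} {(src G c, vs)}"
    using distance facs_of_mem[OF assms(1)] facs_of_mem[OF assms(2)] unfolding is_distance_def by blast
  thus ?thesis using assms by (simp add: cmp_Zstar_HC D_def)
qed

lemma D_le:
  assumes "hfac c us" "hfac c vs"
  shows "D (src G c) us vs \<le> Max {length us, length vs, 1}"
proof -
  have "d {(src G c, us)} {(src G c, vs)} \<le> Max {fac_length {(src G c, us)}, fac_length {(src G c, vs)}, 1}"
    using distance facs_of_mem[OF assms(1)] facs_of_mem[OF assms(2)] unfolding is_distance_def by blast
  thus ?thesis by (simp add: D_def)
qed

text \<open>Translation invariance strips the unchanged atoms on both sides; the remaining lists
  have length 2, and their distance is at most \<open>Max {2, 2, 1}\<close>.\<close>

lemma mv_D: "mv us vs \<Longrightarrow> hfac a us \<Longrightarrow> D (src G a) us vs \<le> 2"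
proof (induction arbitrary: a rule: mv.induct)
  case (here u v u' v' us)
  from here(9) obtain b where b: "a = u \<bullet> b" "tgt G u = src G b" "hfac b (v # us)" by (auto elim: hfac_ConsE)
  from b(3) obtain c where c: "b = v \<bullet> c" "tgt G v = src G c" "hfac c us" by (auto elim: hfac_ConsE)
  have cH: "c \<in> H" using c hfac_H by blast
  have h: "hfac (u \<bullet> v) [u, v]" if "u \<in> atoms HC" "v \<in> atoms HC" "tgt G u = src G v" for u v
    using that hfac.Cons[of u v "[v]"] hfac.Cons[of v "tgt G v" "[]"] hfac.Nil[of "tgt G v"] by simp
  have h1: "hfac (u \<bullet> v) [u, v]" using here by (intro h) auto
  have h2: "hfac (u \<bullet> v) [u', v']" unfolding here(7) using here by (intro h) auto
  have t: "tgt G (u \<bullet> v) = src G c" and s: "src G a = src G (u \<bullet> v)" using here(1,2,5) c b cH by auto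
  have "D (src G a) (u # v # us) (u' # v' # us) = D (src G (u \<bullet> v)) [u, v] [u', v']"
    using D_right[OF h1 h2 c(3) t] s by simp
  also have "\<dots> \<le> 2" using D_le[OF h1 h2] by simp
  finally show ?case .
next
  case (there us vs w)
  then obtain b where b: "a = w \<bullet> b" "tgt G w = src G b" "hfac b us" "w \<in> atoms HC" by (auto elim: hfac_ConsE)
  have bH: "b \<in> H" using b(3) hfac_H by blast
  have w: "hfac w [w]" using b(4) hfac.Cons[of w "tgt G w" "[]"] hfac.Nil[of "tgt G w"] by simp
  have "D (src G a) (w # us) (w # vs) = D (src G b) us vs"
    using D_left[OF w b(3) mv_hfac[OF there(1) b(3)] b(2)] b(1,2,4) bH by simp
  thus ?case using there(2)[OF b(3)] by simp
qed

text \<open>The relation \<open>Q\<close> restricts the lengths of consecutive factorizations.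
  Taking it trivial, \<open>\<le>\<close> or the converse of \<open>\<le>\<close> treats plain and
  monotone chains in one argument.\<close>

definition stepH :: "'a \<Rightarrow> enat \<Rightarrow> (nat \<Rightarrow> nat \<Rightarrow> bool) \<Rightarrow> 'a list \<Rightarrow> 'a list \<Rightarrow> bool"
  where "stepH a n Q us vs \<longleftrightarrow> hfac a us \<and> hfac a vs \<and> enat (D (src G a) us vs) \<le> n \<and> Q (length us) (length vs)"

lemma conn_steps:
  assumes "conn us vs" "hfac a us" "2 \<le> n" "\<And>k. Q k k"
  shows "(stepH a n Q)\<^sup>*\<^sup>* us vs"
  using assms(1)
proof (induction rule: rtranclp_induct)
  case (step vs ws)
  have h: "hfac a vs" using conn_hfac[OF step(1) assms(2)] .
  have "enat (D (src G a) vs ws) \<le> 2" using mv_D[OF step(2) h] by (simp add: numeral_eq_enat)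
  hence "enat (D (src G a) vs ws) \<le> n" using assms(3) by (rule order_trans)
  hence "stepH a n Q vs ws"
    using h mv_hfac[OF step(2) h] mv_length[OF step(2)] assms(4) by (simp add: stepH_def)
  thus ?case using step(3) by simp
qed simp

text \<open>Let \<open>R\<close> be the common part of \<open>Xs\<close> and \<open>Ys\<close>.
  Inside its fiber, \<open>us\<close> is moved to a list that begins with a lift of
  \<open>R\<close>. One further step exchanges the rest; after removal of the common head its
  distance is bounded by the larger number of exchanged atoms, which is the distance below.\<close>

lemma lift_step:
  assumes us: "hfac a us" "mset (map block us) = mset Xs"
    and Ys: "set Ys \<subseteq> Collect batom" "sum_list Ys = block a"
    and n: "enat (list_dist Xs Ys) \<le> n" "2 \<le> n" and Q: "\<And>k. Q k k" "Q (length Xs) (length Ys)"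
  shows "\<exists>vs. hfac a vs \<and> mset (map block vs) = mset Ys \<and> (stepH a n Q)\<^sup>*\<^sup>* us vs"
proof -
  obtain R S T where RST: "mset Xs = R + S" "mset Ys = R + T" "max (size S) (size T) = list_dist Xs Ys"
    using list_dist_decomp by blast
  have bat: "\<forall>X\<in>#R. batom X" "\<forall>X\<in>#S. batom X" "\<forall>X\<in>#T. batom X"
  proof -
    have 1: "batom X" if "X \<in># mset Ys" for X using that Ys(1) by auto
    have 2: "batom X" if "X \<in># mset Xs" for X
      using hfac_batom[OF us(1), of X] that unfolding us(2)[symmetric] by auto
    show "\<forall>X\<in>#R. batom X" "\<forall>X\<in>#S. batom X" "\<forall>X\<in>#T. batom X"
      using 1 2 unfolding RST(1,2) by auto
  qed
  have sumT: "block a = sum_mset R + sum_mset T"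
    using Ys(2) RST(2) by (metis sum_mset_sum_list sum_mset.union)
  have sumS: "block a = sum_mset R + sum_mset S"
    using hfac_block[OF us(1)] us(2) RST(1) by (metis sum_mset_sum_list sum_mset.union)
  have "sum_mset R \<in> carrier BM"
    using bat(1) by (induction R) (auto intro: plus_BM simp: batom_def)
  then obtain b c where b: "b \<in> H" "c \<in> H" "tgt G b = src G c" "a = b \<bullet> c" "block b = sum_mset R" "block c = sum_mset S"
    using H_split[OF hfac_H[OF us(1)] sumS] by blast
  have Clc: "block c = sum_mset T" using b(6) sumS sumT by simp
  obtain rs where rs: "hfac b rs" "mset (map block rs) = R" using hfac_lift_mset[OF b(1) bat(1) b(5)] by blast
  obtain ss where ss: "hfac c ss" "mset (map block ss) = S" using hfac_lift_mset[OF b(2) bat(2) b(6)] by blast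
  obtain ts where ts: "hfac c ts" "mset (map block ts) = T" using hfac_lift_mset[OF b(2) bat(3) Clc] by blast
  have h: "hfac a (rs @ ss)" "hfac a (rs @ ts)"
    unfolding b(4) using rs ss ts b(3) by (auto intro: hfac_append)
  have m: "mset (map block (rs @ ss)) = mset Xs" "mset (map block (rs @ ts)) = mset Ys"
    using rs ss ts RST by auto
  have "conn us (rs @ ss)" using us h(1) m(1) by (intro hfac_conn[of a]) auto
  hence 1: "(stepH a n Q)\<^sup>*\<^sup>* us (rs @ ss)" using us(1) n(2) Q(1) by (rule conn_steps)
  have len: "length ss = size S" "length ts = size T" using ss(2) ts(2) by auto
  have "D (src G a) (rs @ ss) (rs @ ts) = D (src G c) ss ts"
    using D_left[OF rs(1) ss(1) ts(1) b(3)] b(1-4) by simp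
  also have "\<dots> \<le> list_dist Xs Ys"
  \<comment> \<open>For two empty rests the axiom would only give the bound 1, while the distance
    below is 0; reflexivity settles this case.\<close>
  proof (cases "ss = [] \<and> ts = []")
    case True thus ?thesis using D_refl[OF ss(1)] by simp
  next
    case False
    hence "Max {length ss, length ts, 1} \<le> max (length ss) (length ts)"
      by (cases ss; cases ts) auto
    also have "\<dots> = list_dist Xs Ys" using len RST(3) by simp
    finally show ?thesis using D_le[OF ss(1) ts(1)] by (rule order_trans[rotated])
  qed
  finally have "enat (D (src G a) (rs @ ss) (rs @ ts)) \<le> n" using n(1) by (metis enat_ord_simps(1) order_trans)
  moreover have "length (rs @ ss) = length Xs" "length (rs @ ts) = length Ys"
    using mset_eq_length[OF m(1)] mset_eq_length[OF m(2)] by auto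
  ultimately have "stepH a n Q (rs @ ss) (rs @ ts)" using h Q(2) by (simp add: stepH_def)
  thus ?thesis using 1 h(2) m(2) by (meson rtranclp.rtrancl_into_rtrancl)
qed

text \<open>The lists of the chain below are realized one after the other, each only up to the order
  of its atoms. Corrections of the order are steps of distance at most 2 that keep the length, which
  is why \<open>Q\<close> must be reflexive.\<close>

lemma lift_chain:
  assumes z: "z \<in> facs_of HC a" "z' \<in> facs_of HC a"
    and c: "fac_chain BC (perm_dist BC) (block a) n k c (fac_map HC BC (block_hom G H) z) (fac_map HC BC (block_hom G H) z')"
    and Q: "\<And>k. Q k k" "\<forall>i<k. Q (fac_length (c i)) (fac_length (c (Suc i)))"
  shows "\<exists>k' c'. fac_chain HC d a (max n 2) k' c' z z' \<and> (\<forall>i<k'. Q (fac_length (c' i)) (fac_length (c' (Suc i))))"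
proof -
  obtain us vs where us: "z = {(src G a, us)}" "hfac a us" and vs: "z' = {(src G a, vs)}" "hfac a vs"
    using z by (auto simp: facs_of_HC)
  define X where "X i = snd (the_elem (c i))" for i
  have X: "c i = {({#}, X i)}" "set (X i) \<subseteq> Collect batom" "sum_list (X i) = block a" if "i \<le> k" for i
  proof -
    have "c i \<in> facs_of BC (block a)" using c that by (simp add: fac_chain_def)
    then obtain Xs where Xs: "c i = {({#}, Xs)}" "set Xs \<subseteq> Collect batom" "sum_list Xs = block a"
      unfolding facs_of_BC by blast
    moreover have "X i = Xs" by (simp add: X_def Xs(1))
    ultimately show "c i = {({#}, X i)}" "set (X i) \<subseteq> Collect batom" "sum_list (X i) = block a" by auto
  qed
  have X0: "X 0 = map block us" and Xk: "X k = map block vs"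
    using c X(1)[of 0] X(1)[of k] unfolding fac_chain_def us(1) vs(1) fac_map_HC[OF us(2)] fac_map_HC[OF vs(2)] by auto
  have "\<exists>ws. hfac a ws \<and> mset (map block ws) = mset (X j) \<and> (stepH a (max n 2) Q)\<^sup>*\<^sup>* us ws" if "j \<le> k" for j
    using that
  proof (induction j)
    case 0 thus ?case using us(2) X0 by auto
  next
    case (Suc j)
    then obtain ws where ws: "hfac a ws" "mset (map block ws) = mset (X j)" "(stepH a (max n 2) Q)\<^sup>*\<^sup>* us ws" by auto
    have "enat (list_dist (X j) (X (Suc j))) \<le> n"
      using c Suc.prems X(1)[of j] X(1)[of "Suc j"] unfolding fac_chain_def by (metis Suc_le_eq less_imp_le perm_dist_BC)
    hence d: "enat (list_dist (X j) (X (Suc j))) \<le> max n 2" by (rule order_trans) simp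
    have "Q (length (X j)) (length (X (Suc j)))"
      using Q(2) Suc.prems X(1)[of j] X(1)[of "Suc j"] by (auto simp: Suc_le_eq dest: spec[of _ j])
    then obtain ws' where "hfac a ws'" "mset (map block ws') = mset (X (Suc j))" "(stepH a (max n 2) Q)\<^sup>*\<^sup>* ws ws'"
      using lift_step[where Q = Q, OF ws(1,2) X(2,3)[OF Suc.prems] d] Q(1) by auto
    thus ?case using ws(3) by (meson rtranclp_trans)
  qed
  then obtain ws where ws: "hfac a ws" "mset (map block ws) = mset (X k)" "(stepH a (max n 2) Q)\<^sup>*\<^sup>* us ws" by blast
  \<comment> \<open>The lifted chain has reached the fiber of \<open>z'\<close> but not
    \<open>z'\<close> itself; moves inside the fiber close the gap.\<close>
  have "conn ws vs" using ws(1,2) vs(2) Xk by (intro hfac_conn[of a]) auto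
  hence "(stepH a (max n 2) Q)\<^sup>*\<^sup>* ws vs" using ws(1) Q(1) by (intro conn_steps) auto
  hence "(stepH a (max n 2) Q)\<^sup>*\<^sup>* us vs" using ws(3) by (meson rtranclp_trans)
  then obtain k' f where f: "f 0 = us" "f k' = vs" "\<forall>i<k'. stepH a (max n 2) Q (f i) (f (Suc i))"
    using relpowp_chain[of "stepH a (max n 2) Q" us vs] by blast
  have hf: "hfac a (f i)" if "i \<le> k'" for i
    using f that us(2) by (cases i) (auto simp: stepH_def Suc_le_eq)
  show ?thesis
    using f hf unfolding us(1) vs(1) fac_chain_def stepH_def D_def
    by (intro exI[of _ k'] exI[of _ "\<lambda>i. {(src G a, f i)}"]) (auto intro: facs_of_mem)
qed

text \<open>Permutable distance 0 between the images means equality of the block lists up to order.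
  Moves preserve this multiset, so the connecting chain never leaves the fiber.\<close>

lemma fiber_catenary_le:
  assumes "a \<in> H"
  shows "fiber_catenary HC BC (block_hom G H) d a \<le> 2"
  unfolding fiber_catenary_def
proof (rule Least_le, intro ballI impI)
  let ?f = "fac_map HC BC (block_hom G H)"
  fix z z' assume z: "z \<in> facs_of HC a" "z' \<in> facs_of HC a" "perm_dist BC (?f z) (?f z') = 0"
  obtain us vs where us: "z = {(src G a, us)}" "hfac a us" and vs: "z' = {(src G a, vs)}" "hfac a vs"
    using z by (auto simp: facs_of_HC)
  have "mset (map block us) = mset (map block vs)"
    using z(3) unfolding us(1) vs(1) fac_map_HC[OF us(2)] fac_map_HC[OF vs(2)] perm_dist_BC list_dist_eq_0_iff .
  hence "conn us vs" using us vs by (intro hfac_conn[of a]) auto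
  then obtain k f where f: "f 0 = us" "f k = vs" "\<forall>i<k. mv (f i) (f (Suc i))"
    using relpowp_chain[of mv us vs] by blast
  have cf: "conn us (f i)" if "i \<le> k" for i
    using chain_rtranclp[of i mv f] f that by auto
  have hf: "hfac a (f i)" if "i \<le> k" for i using conn_hfac[OF cf[OF that] us(2)] .
  have "fac_chain HC d a 2 k (\<lambda>i. {(src G a, f i)}) z z'"
    using f hf mv_D[of "f _" "f (Suc _)" a] unfolding fac_chain_def us(1) vs(1) D_def
    by (auto intro: facs_of_mem simp: numeral_eq_enat)
  moreover have "perm_dist BC (?f {(src G a, f i)}) (?f z) = 0" if "i \<le> k" for i
    unfolding us(1) fac_map_HC[OF us(2)] fac_map_HC[OF hf[OF that]] perm_dist_BC list_dist_eq_0_iff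
    using conn_mset[OF cf[OF that]] by simp
  ultimately show "\<exists>n c. fac_chain HC d a 2 n c z z' \<and> (\<forall>i\<le>n. perm_dist BC (?f (c i)) (?f z) = 0)"
    by blast
qed

lemma lift_monotone_chain:
  assumes z: "z \<in> facs_of HC a" "z' \<in> facs_of HC a"
    and c: "fac_chain BC (perm_dist BC) (block a) n k c (fac_map HC BC (block_hom G H) z) (fac_map HC BC (block_hom G H) z')"
    and mon: "monotone_chain k c"
  shows "\<exists>k' c'. fac_chain HC d a (max n 2) k' c' z z' \<and> monotone_chain k' c'"
  using mon[unfolded monotone_chain_def]
proof
  assume "\<forall>i<k. fac_length (c i) \<le> fac_length (c (Suc i))"
  thus ?thesis using lift_chain[OF z c, of "(\<le>)"] unfolding monotone_chain_def by blast
next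
  assume "\<forall>i<k. fac_length (c (Suc i)) \<le> fac_length (c i)"
  thus ?thesis using lift_chain[OF z c, of "\<lambda>i j. j \<le> i"] unfolding monotone_chain_def by blast
qed

lemma fac_map_facs_of:
  assumes "z \<in> facs_of HC a"
  shows "fac_map HC BC (block_hom G H) z \<in> facs_of BC (block a)"
    "fac_length (fac_map HC BC (block_hom G H) z) = fac_length z"
proof -
  obtain us where us: "z = {(src G a, us)}" "hfac a us" using assms by (auto simp: facs_of_HC)
  show "fac_map HC BC (block_hom G H) z \<in> facs_of BC (block a)"
    unfolding us(1) fac_map_HC[OF us(2)] facs_of_BC using hfac_batom[OF us(2)] hfac_block[OF us(2)] by auto
  show "fac_length (fac_map HC BC (block_hom G H) z) = fac_length z"
    unfolding us(1) fac_map_HC[OF us(2)] by simp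
qed

section \<open>Comparison of the catenary degrees\<close>

lemma catenary_le: "catenary HC d a \<le> max (catenary BC (perm_dist BC) (block a)) 2"
  unfolding catenary_def[of HC]
proof (rule Least_le, intro ballI)
  fix z z' assume z: "z \<in> facs_of HC a" "z' \<in> facs_of HC a"
  obtain k c where "fac_chain BC (perm_dist BC) (block a) (catenary BC (perm_dist BC) (block a)) k c
      (fac_map HC BC (block_hom G H) z) (fac_map HC BC (block_hom G H) z')"
    using catenary_chain[OF fac_map_facs_of(1)[OF z(1)] fac_map_facs_of(1)[OF z(2)]] by blast
  from lift_chain[OF z this, of "\<lambda>_ _. True"]
  show "\<exists>n c. fac_chain HC d a (max (catenary BC (perm_dist BC) (block a)) 2) n c z z'" by blast
qed

lemma catenary_mon_le: "catenary_mon HC d a \<le> max (catenary_mon BC (perm_dist BC) (block a)) 2"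
  unfolding catenary_mon_def[of HC]
proof (rule Least_le, intro ballI)
  fix z z' assume z: "z \<in> facs_of HC a" "z' \<in> facs_of HC a"
  show "\<exists>n c. fac_chain HC d a (max (catenary_mon BC (perm_dist BC) (block a)) 2) n c z z' \<and> monotone_chain n c"
    using catenary_mon_chain[OF fac_map_facs_of(1)[OF z(1)] fac_map_facs_of(1)[OF z(2)]]
      lift_monotone_chain[OF z] by blast
qed

lemma catenary_eq_le: "catenary_eq HC d a \<le> max (catenary_eq BC (perm_dist BC) (block a)) 2"
  unfolding catenary_eq_def[of HC]
proof (rule Least_le, intro ballI impI)
  fix z z' assume z: "z \<in> facs_of HC a" "z' \<in> facs_of HC a" and len: "fac_length z = fac_length z'"
  have "fac_length (fac_map HC BC (block_hom G H) z) = fac_length (fac_map HC BC (block_hom G H) z')"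
    using len fac_map_facs_of(2)[OF z(1)] fac_map_facs_of(2)[OF z(2)] by simp
  thus "\<exists>n c. fac_chain HC d a (max (catenary_eq BC (perm_dist BC) (block a)) 2) n c z z' \<and> monotone_chain n c"
    using catenary_eq_chain[OF fac_map_facs_of(1)[OF z(1)] fac_map_facs_of(1)[OF z(2)]]
      lift_monotone_chain[OF z] by blast
qed

end

theorem theorem7p8:
  fixes G :: "('a, 'm) ordered_cat_scheme"
    and H :: "'a set"
    and d :: "'a rfac \<Rightarrow> 'a rfac \<Rightarrow> nat"
  assumes "arithmetical_groupoid G"
    and "subcategory H (integral_cat G)"
    and "right_saturated G H"
    and "is_distance (G\<lparr>carrier := H\<rparr>) d"
    and "\<forall>a\<in>carrier G. src G a \<in> identities (G\<lparr>carrier := H\<rparr>) \<longrightarrow>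
           (a \<in> right_fractions G H \<longleftrightarrow> abstract_norm G a \<in> norm_subgroup G H)"
  shows "let HC = G\<lparr>carrier := H\<rparr>; B = block_cat G H; \<theta> = block_hom G H; d\<^sub>p = perm_dist B in
      transfer_hom HC B \<theta> \<and>
      cat_fiber_catenary HC B \<theta> d \<le> 2 \<and>
      (\<forall>a\<in>H. catenary HC d a \<le> max (catenary B d\<^sub>p (\<theta> a)) 2) \<and>
      cat_catenary HC d \<le> max (cat_catenary B d\<^sub>p) 2 \<and>
      (\<forall>a\<in>H. catenary_mon HC d a \<le> max (catenary_mon B d\<^sub>p (\<theta> a)) 2) \<and>
      cat_catenary_mon HC d \<le> max (cat_catenary_mon B d\<^sub>p) 2 \<and>
      (\<forall>a\<in>H. catenary_eq HC d a \<le> max (catenary_eq B d\<^sub>p (\<theta> a)) 2) \<and>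
      cat_catenary_eq HC d \<le> max (cat_catenary_eq B d\<^sub>p) 2"
proof -
  interpret arithmetical_groupoid G by (rule assms(1))
  interpret saturated_distance G H d
    by unfold_locales (rule assms(2-5))+
  have \<theta>: "block_hom G H a = block a" if "a \<in> H" for a using that by (simp add: block_hom_eq)
  have "cat_fiber_catenary (G\<lparr>carrier := H\<rparr>) (block_cat G H) (block_hom G H) d \<le> 2"
    unfolding cat_fiber_catenary_def by (rule SUP_least) (simp add: fiber_catenary_le)
  moreover have "cat_catenary (G\<lparr>carrier := H\<rparr>) d \<le> max (cat_catenary (block_cat G H) (perm_dist (block_cat G H))) 2"
    unfolding cat_catenary_def by (rule SUP_le_max_SUP[of _ block]) (simp_all add: catenary_le)
  moreover have "cat_catenary_mon (G\<lparr>carrier := H\<rparr>) d \<le> max (cat_catenary_mon (block_cat G H) (perm_dist (block_cat G H))) 2"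
    unfolding cat_catenary_mon_def by (rule SUP_le_max_SUP[of _ block]) (simp_all add: catenary_mon_le)
  moreover have "cat_catenary_eq (G\<lparr>carrier := H\<rparr>) d \<le> max (cat_catenary_eq (block_cat G H) (perm_dist (block_cat G H))) 2"
    unfolding cat_catenary_eq_def by (rule SUP_le_max_SUP[of _ block]) (simp_all add: catenary_eq_le)
  ultimately show ?thesis
    using transfer_hom_block catenary_le catenary_mon_le catenary_eq_le by (simp add: Let_def \<theta>)
qed

end
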